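(* Let $l \in \{1,\ldots,m+2\}$ and let $\Sigma \subseteq \mathbb{R}^n$ be an $m$-fine set. If $\mathcal{E}_p^l(\Sigma) \le E < \infty$ for some $p > ml$, then $\Sigma$ is a closed $C^{1,\alpha}$-manifold, where $\alpha = 1 - \frac{ml}{p}$. Moreover, there exist two constants $R_{\mathrm{g}} = R_{\mathrm{g}}(E,m,l,p) > 0$ and $C_{\mathrm{g}} = C_{\mathrm{g}}(E,m,l,p) > 0$, depending only on $E,m,l,p$, such that for every $x \in \Sigma$ there exists a function $F_x \in C^{1,\alpha}(T_x\Sigma, (T_x\Sigma)^{\perp})$ with $$\Sigma \cap \mathbb{B}(x,R_{\mathrm{g}}) = \big(x + \mathrm{Graph}(F_x)\big) \cap \mathbb{B}(x,R_{\mathrm{g}})$$ and $$\| DF_x(y) - DF_x(z) \| \le C_{\mathrm{g}} |y-z|^{\alpha} \quad \text{for all } y,z \in T_x\Sigma,$$ where $\mathrm{Graph}(F_x) = \{ z \in \mathbb{R}^n : \exists\, y \in T_x\Sigma,\ z = y + F_x(y) \}$.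
   Context: Here $1 \le m \le n$ are integers, $\mathcal{H}^s$ is the $s$-dimensional Hausdorff measure, $\mathbb{B}(x,r)$ and $\overline{\mathbb{B}}(x,r)$ are the open and closed balls in $\mathbb{R}^n$, $G(n,m)$ is the Grassmannian of $m$-dimensional linear subspaces of $\mathbb{R}^n$, and $\bigtriangleup(x_0,\ldots,x_k)$ is the convex hull of $\{x_0,\ldots,x_k\}$. A closed manifold is a compact manifold without boundary (here an embedded $m$-dimensional submanifold of $\mathbb{R}^n$); $T_x\Sigma$ is its tangent space at $x$, regarded as a linear subspace of $\mathbb{R}^n$, and $\|\cdot\|$ is the operator norm. For $x_0,\ldots,x_{m+1} \in \mathbb{R}^n$ set $$\mathcal{K}(x_0,\ldots,x_{m+1}) = \frac{\mathcal{H}^{m+1}(\bigtriangleup(x_0,\ldots,x_{m+1}))}{\mathrm{diam}(x_0,\ldots,x_{m+1})^{m+2}}$$ (with value $0$ if all points coincide). For $p>0$ and $l \in \{1,\ldots,m+2\}$, $$\mathcal{E}_p^l(\Sigma) = \int_{\Sigma^l} \sup_{x_l,\ldots,x_{m+1} \in \Sigma} \mathcal{K}(x_0,\ldots,x_{m+1})^p \, d\mathcal{H}^{ml}_{x_0,\ldots,x_{l-1}}$$ (if $l=m+2$ there is no supremum). For $x\in\Sigma$, $r>0$, $$\beta_m^{\Sigma}(x,r) = \frac1r \inf_{H \in G(n,m)} \ \sup_{z \in \Sigma \cap \overline{\mathbb{B}}(x,r)} \mathrm{dist}(z, x+H),$$ $$\theta_m^{\Sigma}(x,r) = \frac1r \inf_{H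 \in G(n,m)} d_{\mathcal{H}}\big(\Sigma \cap \overline{\mathbb{B}}(x,r), (x+H)\cap \overline{\mathbb{B}}(x,r)\big),$$ where $d_{\mathcal{H}}(E,F) = \sup_{y\in E}\mathrm{dist}(y,F) + \sup_{y \in F}\mathrm{dist}(y,E)$. A set $\Sigma\subseteq\mathbb{R}^n$ is $m$-fine if it is $m$-dimensional, compact, and satisfies: (a) there exist $R_{\mathrm{Ahl}}, A_{\mathrm{Ahl}} > 0$ with $\mathcal{H}^m(\Sigma \cap \mathbb{B}(x,r)) \ge A_{\mathrm{Ahl}} r^m$ for all $x \in \Sigma$, $0<r \le R_{\mathrm{Ahl}}$; (b) there exist $R_{\theta\beta} > 0$, $M_{\theta\beta} > 1$ with $\theta_m^{\Sigma}(x,r) \le M_{\theta\beta}\, \beta_m^{\Sigma}(x,r)$ for all $x \in \Sigma$, $0<r \le R_{\theta\beta}$. *)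

theory Defs
  imports "HOL-Analysis.Analysis"
begin

section \<open>Finitely supported sequences\<close>

text \<open>
  Euclidean space of dimension \<open>n\<close>, with \<open>n\<close> a term rather than a type, is the subspace of
  \<open>real finseq\<close> of sequences vanishing from index \<open>n\<close> on.  This permits a statement whose
  constants are chosen before \<open>n\<close>.  The construction is iterated: \<open>l\<close>-tuples of points are
  elements of \<open>real finseq finseq\<close>, and the inner product below induces on them the Euclidean
  product metric.
\<close>

typedef (overloaded) 'b finseq = "{f :: nat \<Rightarrow> 'b::zero. finite {i. f i \<noteq> 0}}"
  morphisms coord Abs_finseq
  by (rule exI[of _ "\<lambda>_. 0"]) simp

setup_lifting type_definition_finseq

lemma finite_support [simp]: "finite {i. coord x i \<noteq> 0}"
  using coord[of x] by simp

lemma finseq_eqI: "(\<And>i. coord x i = coord y i) \<Longrightarrow> x = y"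
  by (simp add: coord_inject[symmetric] fun_eq_iff)

instantiation finseq :: (real_vector) real_vector
begin

lift_definition zero_finseq :: "'a finseq" is "\<lambda>_. 0" by simp

lift_definition plus_finseq :: "'a finseq \<Rightarrow> 'a finseq \<Rightarrow> 'a finseq" is "\<lambda>f g i. f i + g i"
  subgoal for f g
    by (rule finite_subset[of _ "{i. f i \<noteq> 0} \<union> {i. g i \<noteq> 0}"]) auto
  done

lift_definition minus_finseq :: "'a finseq \<Rightarrow> 'a finseq \<Rightarrow> 'a finseq" is "\<lambda>f g i. f i - g i"
  subgoal for f g
    by (rule finite_subset[of _ "{i. f i \<noteq> 0} \<union> {i. g i \<noteq> 0}"]) auto
  done

lift_definition uminus_finseq :: "'a finseq \<Rightarrow> 'a finseq" is "\<lambda>f i. - f i" by simp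

lift_definition scaleR_finseq :: "real \<Rightarrow> 'a finseq \<Rightarrow> 'a finseq" is "\<lambda>c f i. c *\<^sub>R f i"
  subgoal for c f
    by (rule finite_subset[of _ "{i. f i \<noteq> 0}"]) auto
  done

instance
  by standard (transfer; simp add: fun_eq_iff algebra_simps)+

end

lemma coord_simps [simp]:
  "coord 0 i = 0"
  "coord (x + y) i = coord x i + coord y i"
  "coord (x - y) i = coord x i - coord y i"
  "coord (- x) i = - coord x i"
  "coord (c *\<^sub>R x) i = c *\<^sub>R coord x i"
  by (simp_all add: zero_finseq.rep_eq plus_finseq.rep_eq minus_finseq.rep_eq
      uminus_finseq.rep_eq scaleR_finseq.rep_eq)

instantiation finseq :: (real_inner) real_inner
begin

definition inner_finseq :: "'a finseq \<Rightarrow> 'a finseq \<Rightarrow> real" where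
  "inner_finseq x y = (\<Sum>i | coord x i \<noteq> 0. coord x i \<bullet> coord y i)"

definition norm_finseq :: "'a finseq \<Rightarrow> real" where
  "norm_finseq x = sqrt (inner x x)"

definition sgn_finseq :: "'a finseq \<Rightarrow> 'a finseq" where
  "sgn_finseq x = x /\<^sub>R norm x"

definition dist_finseq :: "'a finseq \<Rightarrow> 'a finseq \<Rightarrow> real" where
  "dist_finseq x y = norm (x - y)"

definition uniformity_finseq :: "('a finseq \<times> 'a finseq) filter" where
  "uniformity_finseq = (INF e\<in>{0<..}. principal {(x, y). dist (x :: 'a finseq) y < e})"

definition open_finseq :: "'a finseq set \<Rightarrow> bool" where
  "open_finseq U \<longleftrightarrow> (\<forall>x\<in>U. \<forall>\<^sub>F (x', y) in uniformity. x' = x \<longrightarrow> y \<in> U)"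

lemma inner_finseq_superset:
  assumes "finite I" "{i. coord x i \<noteq> 0} \<subseteq> I"
  shows "inner x y = (\<Sum>i\<in>I. coord x i \<bullet> coord y i)"
  unfolding inner_finseq_def using assms by (intro sum.mono_neutral_left) auto

instance
proof
  fix x y z :: "'a finseq" and r :: real
  define I where "I = {i. coord x i \<noteq> 0} \<union> {i. coord y i \<noteq> 0}"
  have I: "finite I" "{i. coord x i \<noteq> 0} \<subseteq> I" "{i. coord y i \<noteq> 0} \<subseteq> I"
    "{i. coord (x + y) i \<noteq> 0} \<subseteq> I" "{i. coord (r *\<^sub>R x) i \<noteq> 0} \<subseteq> I"
    by (auto simp: I_def)
  show "inner x y = inner y x"
    by (simp add: inner_finseq_superset[OF I(1,2)] inner_finseq_superset[OF I(1,3)] inner_commute)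
  show "inner (x + y) z = inner x z + inner y z"
    by (simp add: inner_finseq_superset[OF I(1,2)] inner_finseq_superset[OF I(1,3)]
        inner_finseq_superset[OF I(1,4)] inner_add_left sum.distrib)
  show "inner (r *\<^sub>R x) y = r * inner x y"
    by (simp add: inner_finseq_superset[OF I(1,2)] inner_finseq_superset[OF I(1,5)]
        sum_distrib_left)
  show "0 \<le> inner x x"
    by (simp add: inner_finseq_def sum_nonneg)
  show "inner x x = 0 \<longleftrightarrow> x = 0"
  proof
    assume "inner x x = 0"
    then have "\<forall>i\<in>{i. coord x i \<noteq> 0}. coord x i \<bullet> coord x i = 0"
      unfolding inner_finseq_def by (subst (asm) sum_nonneg_eq_0_iff) auto
    then show "x = 0" by (auto intro!: finseq_eqI)
  qed (simp add: inner_finseq_def)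
qed (simp_all add: norm_finseq_def sgn_finseq_def dist_finseq_def uniformity_finseq_def
    open_finseq_def)

end

definition tuples :: "nat \<Rightarrow> 'b::zero set \<Rightarrow> 'b finseq set" where
  "tuples l S = {t. (\<forall>i<l. coord t i \<in> S) \<and> (\<forall>i\<ge>l. coord t i = 0)}"

abbreviation R_space :: "nat \<Rightarrow> real finseq set" where
  "R_space n \<equiv> tuples n UNIV"

section \<open>Hausdorff measure and dimension\<close>

text \<open>
  The measure is normalised so that in integral dimensions it extends Lebesgue measure.
  Since \<open>0 powr 0 = 0\<close>, it is meaningful only for \<open>s > 0\<close>.
\<close>

definition hausdorff_content :: "real \<Rightarrow> real \<Rightarrow> 'a::metric_space set \<Rightarrow> ennreal" where
  "hausdorff_content d s A =
     (INF C \<in> {C :: nat \<Rightarrow> 'a set. A \<subseteq> (\<Union>i. C i) \<and> (\<forall>i. bounded (C i) \<and> diameter (C i) \<le> d)}.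
        \<Sum>i. ennreal (unit_ball_vol s * (diameter (C i) / 2) powr s))"

definition hausdorff :: "real \<Rightarrow> 'a::metric_space set \<Rightarrow> ennreal" where
  "hausdorff s A = (SUP d \<in> {0<..}. hausdorff_content d s A)"

text \<open>The measure obtained from the outer measure \<open>hausdorff s\<close> by restricting it to the
  sets measurable in the sense of Caratheodory.\<close>

definition hausdorff_measure :: "real \<Rightarrow> 'a::metric_space measure" where
  "hausdorff_measure s = measure_of UNIV (lambda_system UNIV UNIV (hausdorff s)) (hausdorff s)"

definition hausdorff_dim :: "'a::metric_space set \<Rightarrow> ereal" where
  "hausdorff_dim A = (INF s \<in> {s. 0 < s \<and> hausdorff s A = 0}. ereal s)"

lemma hausdorff_content_mono: "A \<subseteq> B \<Longrightarrow> hausdorff_content d s A \<le> hausdorff_content d s B"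
  unfolding hausdorff_content_def by (rule INF_superset_mono) auto

lemma hausdorff_mono: "A \<subseteq> B \<Longrightarrow> hausdorff s A \<le> hausdorff s B"
  unfolding hausdorff_def by (rule SUP_mono) (blast intro: hausdorff_content_mono)

lemma hausdorff_empty: "hausdorff s {} = 0"
proof -
  have "hausdorff_content d s ({} :: 'a set) \<le> 0" if "d > 0" for d
    unfolding hausdorff_content_def using that
    by (intro INF_lower2[of "\<lambda>_. {}"]) auto
  then show ?thesis
    unfolding hausdorff_def by (intro antisym SUP_least) auto
qed

lemma hausdorff_content_subadditive:
  "hausdorff_content d s (\<Union>i. A i :: 'a::metric_space set) \<le> (\<Sum>i. hausdorff_content d s (A i))"
proof (rule ennreal_le_epsilon)
  let ?H = "hausdorff_content d s :: 'a set \<Rightarrow> ennreal"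
  let ?f = "\<lambda>C :: 'a set. ennreal (unit_ball_vol s * (diameter C / 2) powr s)"
  let ?small = "\<lambda>C :: 'a set. bounded C \<and> diameter C \<le> d"
  fix e :: real assume "0 < e" "(\<Sum>n. ?H (A n)) < top"
  then have *: "?H (A n) < ?H (A n) + e * (1/2) ^ Suc n" for n
    by (auto simp add: less_top dest!: ennreal_suminf_lessD)
  have "\<exists>B. A n \<subseteq> (\<Union>i. B i) \<and> (\<forall>i. ?small (B i)) \<and>
      (\<Sum>i. ?f (B i)) \<le> ?H (A n) + e * (1/2) ^ Suc n" for n
    using *[of n] unfolding hausdorff_content_def INF_less_iff by (auto intro: less_imp_le)
  then obtain B where B: "\<And>n. A n \<subseteq> (\<Union>i. B n i)" "\<And>n i. ?small (B n i)"
    and le: "\<And>n. (\<Sum>i. ?f (B n i)) \<le> ?H (A n) + e * (1/2) ^ Suc n"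
    by metis
  define C where "C = case_prod B \<circ> prod_decode"
  have "(\<Union>i. A i) \<subseteq> (\<Union>i. C i)"
    using B(1) by (auto simp add: C_def subset_eq) (metis prod.case prod_encode_inverse)
  moreover have "?small (C i)" for i
    using B(2) by (simp add: C_def split_def)
  ultimately have "?H (\<Union>i. A i) \<le> (\<Sum>i. ?f (C i))"
    unfolding hausdorff_content_def by (intro INF_lower) simp
  also have "\<dots> = (\<Sum>n. \<Sum>i. ?f (B n i))"
    unfolding C_def comp_def
    using suminf_ennreal_2dimen[of "\<lambda>n. \<Sum>i. ?f (B n i)" "\<lambda>p. ?f (case_prod B p)"] by simp
  also have "\<dots> \<le> (\<Sum>n. ?H (A n) + e * (1/2) ^ Suc n)"
    by (intro suminf_le le) auto
  also have "\<dots> = (\<Sum>n. ?H (A n)) + (\<Sum>n. ennreal e * ennreal ((1/2) ^ Suc n))"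
    using \<open>0 < e\<close> by (subst suminf_add[symmetric])
      (auto simp del: ennreal_suminf_cmult simp add: ennreal_mult[symmetric])
  also have "\<dots> = (\<Sum>n. ?H (A n)) + e"
    unfolding ennreal_suminf_cmult
    by (subst suminf_ennreal_eq[OF zero_le_power power_half_series]) auto
  finally show "?H (\<Union>i. A i) \<le> (\<Sum>n. ?H (A n)) + e" .
qed

lemma outer_measure_space_hausdorff: "outer_measure_space UNIV (hausdorff s)"
  unfolding outer_measure_space_def positive_def increasing_def countably_subadditive_def
proof (intro conjI ballI allI impI)
  fix A :: "nat \<Rightarrow> 'a set"
  show "hausdorff s (\<Union>i. A i) \<le> (\<Sum>i. hausdorff s (A i))"
    unfolding hausdorff_def[of s "\<Union>i. A i"]
  proof (rule SUP_least)
    fix d :: real assume "d \<in> {0<..}"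
    then have "hausdorff_content d s (A i) \<le> hausdorff s (A i)" for i
      unfolding hausdorff_def by (rule SUP_upper)
    then have "(\<Sum>i. hausdorff_content d s (A i)) \<le> (\<Sum>i. hausdorff s (A i))"
      by (intro suminf_le) auto
    then show "hausdorff_content d s (\<Union>i. A i) \<le> (\<Sum>i. hausdorff s (A i))"
      using hausdorff_content_subadditive order_trans by blast
  qed
qed (auto simp: hausdorff_empty hausdorff_mono)

lemma measure_space_hausdorff:
  "measure_space UNIV (lambda_system UNIV UNIV (hausdorff s)) (hausdorff s)"
  using sigma_algebra.caratheodory_lemma[OF sigma_algebra_Pow[of UNIV], of "hausdorff s"]
    outer_measure_space_hausdorff[of s] by simp

lemma emeasure_hausdorff_measure:
  assumes "A \<in> lambda_system UNIV UNIV (hausdorff s)"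
  shows "emeasure (hausdorff_measure s) A = hausdorff s A"
  using measure_space_hausdorff[of s] assms unfolding hausdorff_measure_def measure_space_def
  by (intro emeasure_measure_of_sigma) auto

section \<open>Discrete curvature and energies\<close>

text \<open>If all points coincide then the diameter is \<open>0\<close>, and so is the quotient.\<close>

definition menger_curv :: "nat \<Rightarrow> (nat \<Rightarrow> 'a::real_inner) \<Rightarrow> real" where
  "menger_curv m x =
     enn2real (hausdorff (real (m + 1)) (convex hull (x ` {0..m + 1}))) /
     diameter (x ` {0..m + 1}) ^ (m + 2)"

definition energy :: "nat \<Rightarrow> nat \<Rightarrow> real \<Rightarrow> 'a::real_inner set \<Rightarrow> ennreal" where
  "energy m l p S =
     (\<integral>\<^sup>+ t \<in> tuples l S.
        (SUP x \<in> {x. (\<forall>i<l. x i = coord t i) \<and> (\<forall>i\<in>{l..m + 1}. x i \<in> S)}.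
           ennreal (menger_curv m x powr p))
      \<partial>hausdorff_measure (real (m * l)))"

section \<open>Flatness and fine sets\<close>

definition Grassmannian :: "nat \<Rightarrow> nat \<Rightarrow> real finseq set set" where
  "Grassmannian n m = {H. subspace H \<and> H \<subseteq> R_space n \<and> dim H = m}"

definition beta_num :: "nat \<Rightarrow> nat \<Rightarrow> real finseq set \<Rightarrow> real finseq \<Rightarrow> real \<Rightarrow> real" where
  "beta_num n m S x r =
     (1 / r) * (INF H\<in>Grassmannian n m. SUP z\<in>S \<inter> cball x r. infdist z ((+) x ` H))"

definition haus_dist :: "'a::metric_space set \<Rightarrow> 'a set \<Rightarrow> real" where
  "haus_dist E F = (SUP y\<in>E. infdist y F) + (SUP y\<in>F. infdist y E)"

definition theta_num :: "nat \<Rightarrow> nat \<Rightarrow> real finseq set \<Rightarrow> real finseq \<Rightarrow> real \<Rightarrow> real" where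
  "theta_num n m S x r =
     (1 / r) * (INF H\<in>Grassmannian n m. haus_dist (S \<inter> cball x r) ((+) x ` H \<inter> cball x r))"

definition fine_set :: "nat \<Rightarrow> nat \<Rightarrow> real finseq set \<Rightarrow> bool" where
  "fine_set n m S \<longleftrightarrow>
     S \<subseteq> R_space n \<and> compact S \<and> hausdorff_dim S = ereal (real m) \<and>
     (\<exists>R>0. \<exists>A>0. \<forall>x\<in>S. \<forall>r. 0 < r \<and> r \<le> R \<longrightarrow>
        hausdorff (real m) (S \<inter> ball x r) \<ge> ennreal (A * r ^ m)) \<and>
     (\<exists>R>0. \<exists>M>1. \<forall>x\<in>S. \<forall>r. 0 < r \<and> r \<le> R \<longrightarrow>
        theta_num n m S x r \<le> M * beta_num n m S x r)"

section \<open>Manifolds of Hoelder class\<close>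

definition opnorm_on :: "'a::real_normed_vector set \<Rightarrow> ('a \<Rightarrow> 'b::real_normed_vector) \<Rightarrow> real" where
  "opnorm_on T L = (SUP v\<in>T. norm (L v) / norm v)"

text \<open>
  Here \<open>W\<close> is meant to be a relatively open subset of a linear subspace \<open>T\<close>.  Then the
  derivative \<open>f' y\<close> is determined by \<open>f\<close> on \<open>T\<close>, and only there, whence the use of
  \<open>opnorm_on T\<close>.
\<close>

definition C1_holder_on ::
  "real \<Rightarrow> 'a::real_normed_vector set \<Rightarrow> 'a set \<Rightarrow> ('a \<Rightarrow> 'b::real_normed_vector)
    \<Rightarrow> ('a \<Rightarrow> 'a \<Rightarrow> 'b) \<Rightarrow> bool" where
  "C1_holder_on \<alpha> T W f f' \<longleftrightarrow>
     (\<forall>y\<in>W. (f has_derivative f' y) (at y within W)) \<and>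
     (\<forall>y\<in>W. \<exists>U C. open U \<and> y \<in> U \<and>
        (\<forall>z\<in>W \<inter> U. \<forall>w\<in>W \<inter> U.
           opnorm_on T (\<lambda>v. f' z v - f' w v) \<le> C * dist z w powr \<alpha>))"

text \<open>
  A compact embedded submanifold, without boundary because the parameter domains \<open>W\<close> are open
  in \<open>R_space m\<close>: around each point it is the homeomorphic image of such a domain under an
  immersion.
\<close>

definition closed_C1_holder_manifold :: "nat \<Rightarrow> nat \<Rightarrow> real \<Rightarrow> real finseq set \<Rightarrow> bool" where
  "closed_C1_holder_manifold n m \<alpha> S \<longleftrightarrow>
     S \<subseteq> R_space n \<and> compact S \<and>
     (\<forall>x\<in>S. \<exists>U W \<psi> \<phi> \<psi>'. open U \<and> x \<in> U \<and>
        openin (top_of_set (R_space m)) W \<and> homeomorphism W (S \<inter> U) \<psi> \<phi> \<and>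
        C1_holder_on \<alpha> (R_space m) W \<psi> \<psi>' \<and> (\<forall>y\<in>W. inj_on (\<psi>' y) (R_space m)))"

text \<open>The velocities at \<open>x\<close> of continuously differentiable curves in \<open>S\<close>.\<close>

definition tangent_space :: "'a::real_normed_vector set \<Rightarrow> 'a \<Rightarrow> 'a set" where
  "tangent_space S x =
     {v. \<exists>\<gamma> e. 0 < e \<and> \<gamma> C1_differentiable_on {-e<..<e} \<and> \<gamma> ` {-e<..<e} \<subseteq> S \<and>
        \<gamma> 0 = x \<and> (\<gamma> has_vector_derivative v) (at 0)}"

definition graph_over :: "'a::real_vector set \<Rightarrow> ('a \<Rightarrow> 'a) \<Rightarrow> 'a set" where
  "graph_over T F = {z. \<exists>y\<in>T. z = y + F y}"

end

theory Submission
  imports Defs "HOL-Probability.Product_PMF"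
begin

text \<open>
  If \<open>S\<close> is not flat near \<open>x\<close> at scale \<open>s\<close>, there are \<open>m + 2\<close> points of \<open>S\<close> near \<open>x\<close> spanning a fat
  simplex, and so do all points close to them; by lower bounds for the measure of \<open>S\<close> these
  configurations contribute to the energy. Hence \<open>S\<close> lies within \<open>K s powr (1 + \<kappa>)\<close> of a plane for some
  \<open>\<kappa> > 0\<close>. Since the planes at successive scales then converge geometrically, and since the condition
  \<open>theta \<le> M beta\<close> excludes holes, \<open>S\<close> is a Lipschitz graph over a disc at some scale depending on \<open>S\<close>.
  On such a graph the lower bounds for the measure hold with constants depending on \<open>m\<close> only,
  so that the first argument can be repeated with uniform constants, and it shows that the scale of
  the graph can be doubled until it is bounded below in terms of \<open>E\<close>, \<open>m\<close>, \<open>l\<close>, \<open>p\<close>.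

  The exponent \<open>\<kappa>\<close> obtained from single configurations is too small. For the optimal one, choose the
  base points of the approximating plane at random and iterate an improvement of the flatness that
  compares the given scale with a finer one. The tangent planes are the limits of the approximating
  planes and depend in a Hoelder continuous way on the base point; the derivative of the local graph
  function is the inverse of the projection from one tangent plane to another.
\<close>

section \<open>Frames and angles between planes\<close>

definition orthonormal :: "nat \<Rightarrow> (nat \<Rightarrow> 'a::real_inner) \<Rightarrow> bool" where
  "orthonormal m e \<longleftrightarrow> (\<forall>i<m. \<forall>j<m. e i \<bullet> e j = (if i = j then 1 else 0))"

definition proj :: "nat \<Rightarrow> (nat \<Rightarrow> 'a::real_inner) \<Rightarrow> 'a \<Rightarrow> 'a" where
  "proj m e v = (\<Sum>i<m. (v \<bullet> e i) *\<^sub>R e i)"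

definition rej :: "nat \<Rightarrow> (nat \<Rightarrow> 'a::real_inner) \<Rightarrow> 'a \<Rightarrow> 'a" where
  "rej m e v = v - proj m e v"

definition fat :: "nat \<Rightarrow> (nat \<Rightarrow> 'a::real_normed_vector) \<Rightarrow> real \<Rightarrow> bool" where
  "fat m v g \<longleftrightarrow> (\<forall>a. \<forall>k<m. g * \<bar>a k\<bar> \<le> norm (\<Sum>i<m. a i *\<^sub>R v i))"

definition tilt :: "nat \<Rightarrow> (nat \<Rightarrow> 'a::real_inner) \<Rightarrow> (nat \<Rightarrow> 'a) \<Rightarrow> real \<Rightarrow> bool" where
  "tilt m e e' d \<longleftrightarrow> (\<forall>v. norm (rej m e' (proj m e v)) \<le> d * norm v)"

lemma linear_proj: "linear (proj m e)"
  unfolding proj_def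
  by (rule linearI)
     (simp_all add: inner_add_left scaleR_add_left sum.distrib scaleR_sum_right)

lemma linear_rej: "linear (rej m e)"
  unfolding rej_def[abs_def] using linear_proj linear_compose_sub linear_ident by blast

lemmas proj_simps = linear_add[OF linear_proj] linear_diff[OF linear_proj]
  linear_cmul[OF linear_proj] linear_0[OF linear_proj] linear_sum[OF linear_proj]
  linear_neg[OF linear_proj]
lemmas rej_simps = linear_add[OF linear_rej] linear_diff[OF linear_rej]
  linear_cmul[OF linear_rej] linear_0[OF linear_rej] linear_sum[OF linear_rej]
  linear_neg[OF linear_rej]

lemma proj_plus_rej: "proj m e v + rej m e v = v"
  by (simp add: rej_def)

lemma orthonormal_sum_inner:
  assumes "orthonormal m e" "k < m"
  shows "(\<Sum>i<m. a i *\<^sub>R e i) \<bullet> e k = a k"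
proof -
  have "(\<Sum>i<m. a i *\<^sub>R e i) \<bullet> e k = (\<Sum>i<m. a i * (if i = k then 1 else 0))"
    unfolding inner_sum_left using assms by (intro sum.cong) (auto simp: orthonormal_def)
  then show ?thesis using assms(2) by (simp add: sum.delta if_distrib cong: if_cong)
qed

lemma proj_inner: "orthonormal m e \<Longrightarrow> k < m \<Longrightarrow> proj m e v \<bullet> e k = v \<bullet> e k"
  unfolding proj_def by (rule orthonormal_sum_inner)

lemma rej_inner: "orthonormal m e \<Longrightarrow> k < m \<Longrightarrow> rej m e v \<bullet> e k = 0"
  by (simp add: rej_def inner_diff_left proj_inner)

lemma proj_comb:
  assumes "orthonormal m e"
  shows "proj m e (\<Sum>i<m. a i *\<^sub>R e i) = (\<Sum>i<m. a i *\<^sub>R e i)"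
  unfolding proj_def[of m e "\<Sum>i<m. a i *\<^sub>R e i"] using assms by (simp add: orthonormal_sum_inner)

lemma proj_proj [simp]: "orthonormal m e \<Longrightarrow> proj m e (proj m e v) = proj m e v"
  unfolding proj_def[of m e v] by (rule proj_comb)

lemma proj_rej [simp]: "orthonormal m e \<Longrightarrow> proj m e (rej m e v) = 0"
  by (simp add: rej_def proj_simps)

lemma rej_proj [simp]: "orthonormal m e \<Longrightarrow> rej m e (proj m e v) = 0"
  by (simp add: rej_def)

lemma proj_self_inner: "orthonormal m e \<Longrightarrow> j < m \<Longrightarrow> proj m e (e j) = e j"
  using proj_comb[of m e "\<lambda>i. if i = j then 1 else 0"]
  by (simp add: if_distrib[of "\<lambda>c. c *\<^sub>R _"] sum.delta cong: if_cong)

lemma rej_orth: "orthonormal m e \<Longrightarrow> rej m e v \<bullet> proj m e w = 0"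
  unfolding proj_def[of m e w] by (simp add: inner_sum_right rej_inner)

lemma norm_pyth:
  assumes "orthonormal m e"
  shows "norm v ^ 2 = norm (proj m e v) ^ 2 + norm (rej m e v) ^ 2"
proof -
  have "norm v ^ 2 = norm (proj m e v + rej m e v) ^ 2" by (simp add: proj_plus_rej)
  also have "\<dots> = norm (proj m e v) ^ 2 + norm (rej m e v) ^ 2"
    using rej_orth[OF assms, of v v] by (simp add: power2_norm_eq_inner algebra_simps inner_commute)
  finally show ?thesis .
qed

lemma norm_proj_le: "orthonormal m e \<Longrightarrow> norm (proj m e v) \<le> norm v"
  by (rule power2_le_imp_le) (simp_all add: norm_pyth[of m e v])

lemma norm_rej_le: "orthonormal m e \<Longrightarrow> norm (rej m e v) \<le> norm v"
  by (rule power2_le_imp_le) (simp_all add: norm_pyth[of m e v])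

lemma norm_le_proj_rej: "norm v \<le> norm (proj m e v) + norm (rej m e v)"
  using norm_triangle_ineq[of "proj m e v" "rej m e v"] by (simp add: proj_plus_rej)

lemma norm_rej_le_dist:
  assumes "orthonormal m e" "proj m e w = w"
  shows "norm (rej m e v) \<le> norm (v - w)"
proof -
  have "rej m e v = rej m e (v - w)" using assms by (simp add: rej_simps) (simp add: rej_def)
  then show ?thesis using norm_rej_le[OF assms(1)] by metis
qed

lemma proj_in_span: "proj m e v \<in> span (e ` {..<m})"
  unfolding proj_def by (intro span_sum span_scale span_base) auto

lemma proj_span:
  assumes "orthonormal m e" "v \<in> span (e ` {..<m})"
  shows "proj m e v = v"
proof -
  have "subspace {v. proj m e v = v}"
    by (auto simp: subspace_def proj_simps)
  moreover have "e ` {..<m} \<subseteq> {v. proj m e v = v}"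
    using assms(1) by (auto simp: proj_self_inner)
  ultimately show ?thesis using span_minimal assms(2) by blast
qed

lemma in_span_iff_proj: "orthonormal m e \<Longrightarrow> v \<in> span (e ` {..<m}) \<longleftrightarrow> proj m e v = v"
  using proj_span proj_in_span by metis

lemma orthonormal_coeff_le:
  assumes "orthonormal m e" "k < m"
  shows "\<bar>a k\<bar> \<le> norm (\<Sum>i<m. a i *\<^sub>R e i)"
  using Cauchy_Schwarz_ineq2[of "\<Sum>i<m. a i *\<^sub>R e i" "e k"] assms
  by (simp add: orthonormal_sum_inner) (simp add: orthonormal_def norm_eq_sqrt_inner)

lemma orthonormal_norm: "orthonormal m e \<Longrightarrow> k < m \<Longrightarrow> norm (e k) = 1"
  by (simp add: orthonormal_def norm_eq_sqrt_inner)

lemma fatD: "fat m v g \<Longrightarrow> k < m \<Longrightarrow> g * \<bar>a k\<bar> \<le> norm (\<Sum>i<m. a i *\<^sub>R v i)"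
  unfolding fat_def by blast

lemma fat_orthonormal: "orthonormal m e \<Longrightarrow> fat m e 1"
  by (simp add: fat_def orthonormal_coeff_le)

lemma fat_scale:
  assumes "fat m v g" "c \<ge> 0"
  shows "fat m (\<lambda>i. c *\<^sub>R v i) (c * g)"
  unfolding fat_def
proof (intro allI impI)
  fix a :: "nat \<Rightarrow> real" and k assume "k < m"
  have "g * \<bar>a k\<bar> \<le> norm (\<Sum>i<m. a i *\<^sub>R v i)" using assms \<open>k < m\<close> by (auto simp: fat_def)
  from mult_left_mono[OF this assms(2)]
  have "c * g * \<bar>a k\<bar> \<le> norm (c *\<^sub>R (\<Sum>i<m. a i *\<^sub>R v i))" using assms(2) by (simp add: mult.assoc)
  also have "c *\<^sub>R (\<Sum>i<m. a i *\<^sub>R v i) = (\<Sum>i<m. a i *\<^sub>R c *\<^sub>R v i)"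
    by (simp add: scaleR_sum_right mult.commute)
  finally show "c * g * \<bar>a k\<bar> \<le> norm (\<Sum>i<m. a i *\<^sub>R c *\<^sub>R v i)" .
qed

lemma fat_perturb:
  fixes v v' :: "nat \<Rightarrow> 'a::real_normed_vector"
  assumes f: "fat m v g" and d: "\<And>i. i < m \<Longrightarrow> norm (v' i - v i) \<le> d" and md: "real m * d \<le> g / 2"
  shows "fat m v' (g / 2)"
  unfolding fat_def
proof (intro allI impI)
  fix a :: "nat \<Rightarrow> real" and k assume k: "k < m"
  define M where "M = Max ((\<lambda>i. \<bar>a i\<bar>) ` {..<m})"
  have le: "\<bar>a i\<bar> \<le> M" if "i < m" for i unfolding M_def using that by (intro Max_ge) auto
  have "M \<in> (\<lambda>i. \<bar>a i\<bar>) ` {..<m}" unfolding M_def using k by (intro Max_in) auto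
  then obtain j where j: "j < m" "M = \<bar>a j\<bar>" by auto
  have M0: "0 \<le> M" using j by simp
  have "0 \<le> d" using d[OF k] norm_ge_zero order_trans by blast
  then have "0 \<le> real m * d" by simp
  then have g0: "0 \<le> g" using md by linarith
  have "norm (\<Sum>i<m. a i *\<^sub>R v i) \<le> norm (\<Sum>i<m. a i *\<^sub>R v' i) + norm (\<Sum>i<m. a i *\<^sub>R (v' i - v i))"
    using norm_triangle_ineq4[of "\<Sum>i<m. a i *\<^sub>R v' i" "\<Sum>i<m. a i *\<^sub>R (v' i - v i)"]
    by (simp add: sum_subtractf scaleR_diff_right)
  moreover have "norm (\<Sum>i<m. a i *\<^sub>R (v' i - v i)) \<le> (\<Sum>i<m. M * d)"
    by (rule sum_norm_le) (use le d M0 in \<open>auto intro!: mult_mono\<close>)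
  moreover have "(\<Sum>i<m. M * d) \<le> M * (g / 2)"
    using mult_left_mono[OF md M0] by (simp add: algebra_simps)
  moreover have "g * M \<le> norm (\<Sum>i<m. a i *\<^sub>R v i)" using fatD[OF f j(1), of a] j by simp
  ultimately have "g / 2 * M \<le> norm (\<Sum>i<m. a i *\<^sub>R v' i)" by (simp add: algebra_simps)
  moreover have "g / 2 * \<bar>a k\<bar> \<le> g / 2 * M" using le[OF k] g0 by (intro mult_left_mono) auto
  ultimately show "g / 2 * \<bar>a k\<bar> \<le> norm (\<Sum>i<m. a i *\<^sub>R v' i)" by linarith
qed

lemma fat_independent:
  assumes "fat m u g" "g > 0"
  shows "inj_on u {..<m}" "independent (u ` {..<m})"
proof -
  show inj: "inj_on u {..<m}"
  proof (rule inj_onI, rule ccontr)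
    fix i j assume ij: "i \<in> {..<m}" "j \<in> {..<m}" "u i = u j" "i \<noteq> j"
    have "(\<Sum>k<m. (if k = i then 1 else if k = j then -1 else 0) *\<^sub>R u k)
        = (\<Sum>k\<in>{i,j}. (if k = i then 1 else if k = j then -1 else 0) *\<^sub>R u k)"
      using ij by (intro sum.mono_neutral_right) auto
    also have "\<dots> = 0" using ij by simp
    finally have *: "(\<Sum>k<m. (if k = i then 1 else if k = j then -1 else 0) *\<^sub>R u k) = 0" .
    let ?c = "\<lambda>k. if k = i then 1 else if k = j then -1 else (0::real)"
    have "g * \<bar>?c i\<bar> \<le> norm (\<Sum>k<m. ?c k *\<^sub>R u k)"
      by (rule fatD[OF assms(1)]) (use ij in simp)
    with * assms(2) show False by simp
  qed
  show "independent (u ` {..<m})"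
  proof
    assume "dependent (u ` {..<m})"
    then obtain c v where c: "v \<in> u ` {..<m}" "c v \<noteq> 0" "(\<Sum>v\<in>u ` {..<m}. c v *\<^sub>R v) = 0"
      by (subst (asm) dependent_finite) auto
    then obtain k where k: "k < m" "v = u k" by auto
    have "(\<Sum>i<m. c (u i) *\<^sub>R u i) = 0" using c(3) inj by (simp add: sum.reindex)
    moreover have "g * \<bar>c (u k)\<bar> \<le> norm (\<Sum>i<m. c (u i) *\<^sub>R u i)"
      by (rule fatD[OF assms(1) k(1), of "\<lambda>i. c (u i)"])
    ultimately show False using assms(2) c(2) k by (simp add: mult_le_0_iff)
  qed
qed

lemma span_image_explicit:
  fixes u :: "nat \<Rightarrow> 'a::real_vector"
  assumes "inj_on u {..<m}" "v \<in> span (u ` {..<m})"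
  obtains a where "v = (\<Sum>i<m. a i *\<^sub>R u i)"
proof -
  obtain c where "v = (\<Sum>w\<in>u ` {..<m}. c w *\<^sub>R w)"
    using assms(2) by (subst (asm) span_finite) auto
  then have "v = (\<Sum>i<m. c (u i) *\<^sub>R u i)" using assms(1) by (simp add: sum.reindex)
  then show thesis by (rule that)
qed

lemma independent_spans:
  fixes u :: "nat \<Rightarrow> 'a::real_vector"
  assumes "independent S" "finite S" "card S = m" "S \<subseteq> span (e ` {..<m})" "v \<in> span (e ` {..<m})"
  shows "v \<in> span S"
proof (rule ccontr)
  assume v: "v \<notin> span S"
  then have "independent (insert v S)" using assms(1) by (simp add: independent_insert)
  moreover have "v \<notin> S" using v span_base by blast
  ultimately have "card (insert v S) \<le> card (e ` {..<m})"
    using assms independent_span_bound[of "e ` {..<m}" "insert v S"] by auto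
  moreover have "card (insert v S) = Suc m" using \<open>v \<notin> S\<close> assms by simp
  ultimately show False using card_image_le[of "{..<m}" e] by simp
qed

lemma fat_spans:
  assumes e: "orthonormal m e" and u: "\<And>i. i < m \<Longrightarrow> proj m e (u i) = u i" and f: "fat m u g" "g > 0"
    and v: "proj m e v = v"
  obtains a where "v = (\<Sum>i<m. a i *\<^sub>R u i)"
proof -
  have "v \<in> span (u ` {..<m})"
  proof (rule independent_spans[where m = m and e = e])
    show "card (u ` {..<m}) = m" using fat_independent(1)[OF f] by (simp add: card_image)
    show "u ` {..<m} \<subseteq> span (e ` {..<m})" using e u by (auto simp: in_span_iff_proj)
  qed (use fat_independent[OF f] e v in \<open>auto simp: in_span_iff_proj\<close>)
  then show thesis using span_image_explicit[OF fat_independent(1)[OF f]] that by blast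
qed

lemma fat_expand:
  assumes e: "orthonormal m e" and f: "fat m w g" "g > 0"
    and d: "\<And>i. i < m \<Longrightarrow> norm (rej m e (w i)) \<le> d" "real m * d \<le> g / 2"
    and u: "norm (rej m e u) \<le> d'"
  obtains a where "\<And>i. i < m \<Longrightarrow> \<bar>a i\<bar> \<le> 2 * norm u / g"
    "norm (u - (\<Sum>i<m. a i *\<^sub>R w i)) \<le> d' + real m * (2 * norm u / g * d)"
proof -
  let ?w = "\<lambda>i. proj m e (w i)"
  have fw: "fat m ?w (g / 2)"
  proof (rule fat_perturb[OF f(1) _ d(2)])
    fix i assume "i < m"
    then show "norm (?w i - w i) \<le> d" using d(1)[of i] by (simp add: rej_def norm_minus_commute)
  qed
  obtain a where a: "proj m e u = (\<Sum>i<m. a i *\<^sub>R ?w i)"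
    using fat_spans[OF e _ fw, of "proj m e u"] f(2) e by auto
  have ale: "\<bar>a i\<bar> \<le> 2 * norm u / g" if "i < m" for i
  proof -
    have "g / 2 * \<bar>a i\<bar> \<le> norm (proj m e u)" unfolding a by (rule fatD[OF fw that])
    also have "\<dots> \<le> norm u" by (rule norm_proj_le[OF e])
    finally show ?thesis using f(2) by (simp add: field_simps)
  qed
  have "u - (\<Sum>i<m. a i *\<^sub>R w i) = rej m e u - (\<Sum>i<m. a i *\<^sub>R rej m e (w i))"
    using a by (simp add: rej_def scaleR_diff_right sum_subtractf)
  then have "norm (u - (\<Sum>i<m. a i *\<^sub>R w i)) \<le> norm (rej m e u) + norm (\<Sum>i<m. a i *\<^sub>R rej m e (w i))"
    by (metis norm_triangle_ineq4)
  also have "norm (\<Sum>i<m. a i *\<^sub>R rej m e (w i)) \<le> (\<Sum>i<m. 2 * norm u / g * d)"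
    by (rule sum_norm_le) (use ale d(1) f(2) in \<open>auto intro!: mult_mono simp del: times_divide_eq_left\<close>)
  finally have "norm (u - (\<Sum>i<m. a i *\<^sub>R w i)) \<le> d' + real m * (2 * norm u / g * d)" using u by simp
  with ale show thesis by (rule that)
qed

lemma norm_rej_add: "norm (rej m e (v + w)) \<le> norm (rej m e v) + norm (rej m e w)"
  by (simp add: rej_simps norm_triangle_ineq)

lemma norm_rej_split:
  "norm (rej m e v) \<le> norm (rej m e (rej m e' v)) + norm (rej m e (proj m e' v))"
  using norm_rej_add[of m e "rej m e' v" "proj m e' v"] by (simp add: proj_plus_rej add.commute)

lemma norm_rej_sum_le:
  fixes w :: "nat \<Rightarrow> 'a::real_inner"
  assumes "\<And>i. i < m \<Longrightarrow> \<bar>a i\<bar> \<le> A" "\<And>i. i < m \<Longrightarrow> norm (rej k e (w i)) \<le> d" "0 \<le> A"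
  shows "norm (rej k e (\<Sum>i<m. a i *\<^sub>R w i)) \<le> real m * (A * d)"
proof -
  have "norm (rej k e (\<Sum>i<m. a i *\<^sub>R w i)) \<le> (\<Sum>i<m. A * d)"
    unfolding rej_simps by (rule sum_norm_le) (use assms in \<open>auto intro!: mult_mono\<close>)
  then show ?thesis by simp
qed

lemma fat_tilt:
  assumes e: "orthonormal m e" "orthonormal m e'" and f: "fat m w g" "g > 0"
    and d: "\<And>i. i < m \<Longrightarrow> norm (rej m e (w i)) \<le> d" "real m * d \<le> g / 2"
    and d': "\<And>i. i < m \<Longrightarrow> norm (rej m e' (w i)) \<le> d'"
  shows "tilt m e e' (2 * real m * (d + d') / g)"
  unfolding tilt_def
proof
  fix v
  define u where "u = proj m e v"
  have nu: "norm u \<le> norm v" unfolding u_def by (rule norm_proj_le[OF e(1)])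
  have "norm (rej m e u) \<le> 0" using e by (simp add: u_def)
  then obtain a where a: "\<And>i. i < m \<Longrightarrow> \<bar>a i\<bar> \<le> 2 * norm u / g"
    "norm (u - (\<Sum>i<m. a i *\<^sub>R w i)) \<le> 0 + real m * (2 * norm u / g * d)"
    using fat_expand[OF e(1) f d] by metis
  have "norm (rej m e' u) \<le> norm (rej m e' (u - (\<Sum>i<m. a i *\<^sub>R w i)))
      + norm (rej m e' (\<Sum>i<m. a i *\<^sub>R w i))"
    using norm_rej_add[of m e' "u - (\<Sum>i<m. a i *\<^sub>R w i)" "\<Sum>i<m. a i *\<^sub>R w i"] by simp
  also have "norm (rej m e' (u - (\<Sum>i<m. a i *\<^sub>R w i))) \<le> norm (u - (\<Sum>i<m. a i *\<^sub>R w i))"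
    by (rule norm_rej_le[OF e(2)])
  also have "norm (rej m e' (\<Sum>i<m. a i *\<^sub>R w i)) \<le> real m * (2 * norm u / g * d')"
    by (rule norm_rej_sum_le) (use a(1) d' f in auto)
  finally have "norm (rej m e' u) \<le> real m * (2 * norm u / g * d) + real m * (2 * norm u / g * d')"
    using a(2) by simp
  then have "norm (rej m e' u) \<le> 2 * real m * (d + d') / g * norm u"
    using f(2) by (simp add: field_simps)
  also have "\<dots> \<le> 2 * real m * (d + d') / g * norm v"
  proof (cases "m = 0")
    case False
    then have "0 \<le> d" "0 \<le> d'" using d(1)[of 0] d'[of 0] norm_ge_zero order_trans by blast+
    then show ?thesis using nu f by (intro mult_left_mono) auto
  qed simp
  finally show "norm (rej m e' (proj m e v)) \<le> 2 * real m * (d + d') / g * norm v"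
    by (simp add: u_def)
qed

lemma tilt_trans:
  assumes e: "orthonormal m e" "orthonormal m e''" and t: "tilt m e e' d" "tilt m e' e'' d'" and "0 \<le> d'"
  shows "tilt m e e'' (d + d')"
  unfolding tilt_def
proof
  fix v
  let ?p = "proj m e v"
  have "norm (rej m e'' ?p) \<le> norm (rej m e'' (rej m e' ?p)) + norm (rej m e'' (proj m e' ?p))"
    by (rule norm_rej_split)
  also have "norm (rej m e'' (rej m e' ?p)) \<le> d * norm v"
    using t(1) norm_rej_le[OF e(2), of "rej m e' ?p"] unfolding tilt_def by (auto intro: order_trans)
  also have "norm (rej m e'' (proj m e' ?p)) \<le> d' * norm ?p" using t(2) unfolding tilt_def by blast
  also have "d' * norm ?p \<le> d' * norm v" using norm_proj_le[OF e(1)] assms by (intro mult_left_mono)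
  finally show "norm (rej m e'' ?p) \<le> (d + d') * norm v" by (simp add: algebra_simps)
qed

lemma tilt_refl: "orthonormal m e \<Longrightarrow> tilt m e e 0"
  by (simp add: tilt_def)

lemma tilt_mono: "tilt m e e' d \<Longrightarrow> d \<le> d' \<Longrightarrow> tilt m e e' d'"
  unfolding tilt_def by (meson mult_right_mono norm_ge_zero order_trans)

lemma rej_via_tilt:
  assumes e: "orthonormal m e'" and t: "tilt m e e' d"
  shows "norm (rej m e' v) \<le> norm (rej m e v) + d * norm v"
proof -
  have "norm (rej m e' (proj m e v)) \<le> d * norm v" using t by (simp add: tilt_def)
  then show ?thesis
    using norm_rej_split[of m e' v e] norm_rej_le[OF e, of "rej m e v"] by linarith
qed

section \<open>Finitely supported sequences\<close>

definition mk :: "nat \<Rightarrow> (nat \<Rightarrow> 'a::zero) \<Rightarrow> 'a finseq" where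
  "mk l f = Abs_finseq (\<lambda>i. if i < l then f i else 0)"

lemma coord_mk [simp]: "coord (mk l f) i = (if i < l then f i else 0)"
proof -
  have "finite {i. (if i < l then f i else 0) \<noteq> 0}"
    by (rule finite_subset[of _ "{..<l}"]) auto
  then show ?thesis unfolding mk_def by (subst Abs_finseq_inverse) auto
qed

definition single :: "nat \<Rightarrow> 'a::zero \<Rightarrow> 'a finseq" where
  "single i x = mk (Suc i) (\<lambda>j. if j = i then x else 0)"

lemma coord_single [simp]: "coord (single i x) j = (if j = i then x else 0)"
  by (auto simp: single_def)

lemma inner_single: "t \<bullet> single i x = coord t i \<bullet> (x :: 'a::real_inner)"
proof -
  have "t \<bullet> single i x = (\<Sum>j\<in>insert i {j. coord t j \<noteq> 0}. coord t j \<bullet> coord (single i x) j)"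
    by (rule inner_finseq_superset) auto
  also have "\<dots> = (\<Sum>j\<in>insert i {j. coord t j \<noteq> 0}. if j = i then coord t i \<bullet> x else 0)"
    by (intro sum.cong) auto
  also have "\<dots> = coord t i \<bullet> x" by (subst sum.delta) auto
  finally show ?thesis .
qed

lemma norm_single [simp]: "norm (single i x) = norm (x :: 'a::real_inner)"
  by (simp add: norm_eq_sqrt_inner inner_single)

lemma norm_coord_le: "norm (coord t i) \<le> norm (t :: 'a::real_inner finseq)"
proof (cases "coord t i = 0")
  case False
  have "norm (coord t i) * norm (coord t i) = t \<bullet> single i (coord t i)"
    by (simp add: inner_single power2_norm_eq_inner[symmetric] power2_eq_square)
  also have "\<dots> \<le> norm t * norm (coord t i)" using norm_cauchy_schwarz[of t "single i (coord t i)"] by simp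
  finally show ?thesis using False by simp
qed simp

lemma dist_coord_le: "dist (coord s i) (coord t i) \<le> dist s (t :: 'a::real_inner finseq)"
  using norm_coord_le[of "s - t" i] by (simp add: dist_norm)

lemma bounded_linear_coord: "bounded_linear (\<lambda>t :: 'a::real_inner finseq. coord t i)"
  by (rule bounded_linear_intro[of _ 1]) (auto simp: norm_coord_le)

lemma bounded_linear_single: "bounded_linear (single i :: 'a::real_inner \<Rightarrow> _)"
  by (rule bounded_linear_intro[of _ 1]) (auto intro!: finseq_eqI)

lemmas continuous_on_coord [continuous_intros] = bounded_linear.continuous_on[OF bounded_linear_coord]
lemmas continuous_on_single [continuous_intros] = bounded_linear.continuous_on[OF bounded_linear_single]

definition prodset :: "nat \<Rightarrow> (nat \<Rightarrow> 'a::zero set) \<Rightarrow> 'a finseq set" where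
  "prodset l K = {t. (\<forall>i<l. coord t i \<in> K i) \<and> (\<forall>i\<ge>l. coord t i = 0)}"

lemma tuples_eq_prodset: "tuples l S = prodset l (\<lambda>_. S)"
  by (simp add: tuples_def prodset_def)

lemma mk_in_prodset: "(\<And>i. i < l \<Longrightarrow> f i \<in> K i) \<Longrightarrow> mk l f \<in> prodset l K"
  by (simp add: prodset_def)

lemma compact_prodset:
  fixes K :: "nat \<Rightarrow> 'a::real_inner set"
  assumes "\<And>i. i < l \<Longrightarrow> compact (K i)"
  shows "compact (prodset l K)"
  using assms
proof (induction l)
  case 0
  have "prodset 0 K = {0}" by (auto simp: prodset_def intro!: finseq_eqI)
  then show ?case by simp
next
  case (Suc l)
  let ?f = "\<lambda>(t, x). t + single l x"
  have "prodset (Suc l) K = ?f ` (prodset l K \<times> K l)"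
  proof (intro set_eqI iffI)
    fix t assume t: "t \<in> prodset (Suc l) K"
    have "t = ?f (mk l (coord t), coord t l)" using t
      by (auto simp: prodset_def intro!: finseq_eqI)
    moreover have "(mk l (coord t), coord t l) \<in> prodset l K \<times> K l"
      using t by (auto simp: prodset_def)
    ultimately show "t \<in> ?f ` (prodset l K \<times> K l)" by blast
  qed (auto simp: prodset_def less_Suc_eq)
  moreover have "compact (?f ` (prodset l K \<times> K l))"
    by (intro compact_continuous_image compact_Times Suc)
       (auto simp: split_def intro!: continuous_intros Suc.prems)
  ultimately show ?case by simp
qed

lemma mem_R_space: "x \<in> R_space n \<longleftrightarrow> (\<forall>i\<ge>n. coord x i = 0)"
  by (simp add: tuples_def)

lemma subspace_R_space: "subspace (R_space n)"
  by (auto simp: subspace_def mem_R_space)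

lemma closed_R_space: "closed (R_space n)"
proof -
  have "R_space n = (\<Inter>i\<in>{n..}. {x. coord x i = 0})" by (auto simp: mem_R_space)
  then show ?thesis by (auto intro!: closed_INT closed_Collect_eq continuous_intros)
qed

lemma abs_coord_le: "\<bar>coord t i\<bar> \<le> norm (t :: real finseq)"
  using norm_coord_le[of t i] by simp

lemma compact_R_space_cball: "compact (R_space n \<inter> cball 0 r)"
proof -
  have "R_space n \<inter> cball 0 r \<subseteq> prodset n (\<lambda>_. cball 0 r)"
    by (auto simp: prodset_def mem_R_space intro: order_trans[OF abs_coord_le])
  then have "R_space n \<inter> cball 0 r = prodset n (\<lambda>_. cball 0 r) \<inter> (R_space n \<inter> cball 0 r)" by auto
  moreover have "compact \<dots>"
    by (intro compact_Int_closed compact_prodset closed_Int closed_R_space) auto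
  ultimately show ?thesis by simp
qed

definition frame :: "nat \<Rightarrow> nat \<Rightarrow> (nat \<Rightarrow> real finseq) \<Rightarrow> bool" where
  "frame n m e \<longleftrightarrow> orthonormal m e \<and> (\<forall>i<m. e i \<in> R_space n)"

lemma frame_orthonormal [dest]: "frame n m e \<Longrightarrow> orthonormal m e"
  by (simp add: frame_def)

lemma frame_proj_in: "frame n m e \<Longrightarrow> proj m e v \<in> R_space n"
  unfolding proj_def
  by (intro subspace_sum subspace_R_space subspace_scale) (auto simp: frame_def)

lemma frame_rej_in: "frame n m e \<Longrightarrow> v \<in> R_space n \<Longrightarrow> rej m e v \<in> R_space n"
  unfolding rej_def by (intro subspace_diff subspace_R_space frame_proj_in)

lemma orthonormal_single: "orthonormal n (\<lambda>i. single i (1::real))"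
  by (simp add: orthonormal_def inner_single)

lemma frame_single: "m \<le> n \<Longrightarrow> frame n m (\<lambda>i. single i (1::real))"
  by (simp add: frame_def orthonormal_single mem_R_space)

lemma frame_new_vector:
  assumes "frame n k e" "k < n"
  obtains u where "u \<in> R_space n" "norm u = 1" "\<And>i. i < k \<Longrightarrow> u \<bullet> e i = 0"
proof -
  let ?b = "\<lambda>i. single i (1::real)"
  have orthonormal: "orthonormal k e" using assms by auto
  have "\<exists>i<n. ?b i \<notin> span (e ` {..<k})"
  proof (rule ccontr)
    assume "\<not> ?thesis"
    then have "?b ` {..<n} \<subseteq> span (e ` {..<k})" by auto
    moreover have f: "fat n ?b 1" by (rule fat_orthonormal[OF orthonormal_single])
    ultimately have "card (?b ` {..<n}) \<le> card (e ` {..<k})"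
      using independent_span_bound[of "e ` {..<k}" "?b ` {..<n}"] fat_independent[OF f] by simp
    moreover have "card (?b ` {..<n}) = n" using fat_independent(1)[OF f] by (simp add: card_image)
    ultimately show False using card_image_le[of "{..<k}" e] assms(2) by simp
  qed
  then obtain i where i: "i < n" "?b i \<notin> span (e ` {..<k})" by blast
  define r where "r = rej k e (?b i)"
  have "r \<noteq> 0" using i(2) unfolding in_span_iff_proj[OF orthonormal] by (auto simp: r_def rej_def)
  have "r \<in> R_space n" unfolding r_def
    by (rule frame_rej_in[OF assms(1)]) (use i in \<open>simp add: mem_R_space\<close>)
  show thesis
  proof
    show "(1 / norm r) *\<^sub>R r \<in> R_space n" by (rule subspace_scale[OF subspace_R_space]) fact
    show "norm ((1 / norm r) *\<^sub>R r) = 1" using \<open>r \<noteq> 0\<close> by simp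
    show "((1 / norm r) *\<^sub>R r) \<bullet> e j = 0" if "j < k" for j
      using that by (simp add: r_def rej_inner[OF orthonormal])
  qed
qed

lemma gram_schmidt:
  assumes "\<And>i. i < m \<Longrightarrow> w i \<in> R_space n" "m \<le> n"
  obtains e where "frame n m e" "\<And>i. i < m \<Longrightarrow> proj m e (w i) = w i"
proof -
  have "\<exists>e. frame n m e \<and> (\<forall>i<m. w i \<in> span (e ` {..<m}))"
    using assms
  proof (induction m)
    case 0 then show ?case by (auto simp: frame_def orthonormal_def)
  next
    case (Suc k)
    then obtain e where e: "frame n k e" "\<And>i. i < k \<Longrightarrow> w i \<in> span (e ` {..<k})" by auto
    have orthonormal: "orthonormal k e" using e by auto
    define r where "r = rej k e (w k)"
    obtain u where u: "u \<in> R_space n" "norm u = 1" "\<And>i. i < k \<Longrightarrow> u \<bullet> e i = 0" "r \<in> span {u}"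
    proof (cases "r = 0")
      case True
      then show thesis using frame_new_vector[OF e(1)] Suc.prems that by (metis Suc_le_lessD span_zero)
    next
      case False
      have "r \<in> R_space n" unfolding r_def by (rule frame_rej_in[OF e(1)]) (use Suc.prems in simp)
      show thesis
      proof (rule that)
        show "(1 / norm r) *\<^sub>R r \<in> R_space n" by (rule subspace_scale[OF subspace_R_space]) fact
        show "norm ((1 / norm r) *\<^sub>R r) = 1" using False by simp
        show "((1 / norm r) *\<^sub>R r) \<bullet> e j = 0" if "j < k" for j
          using that by (simp add: r_def rej_inner[OF orthonormal])
        have "r = norm r *\<^sub>R (1 / norm r) *\<^sub>R r" using False by simp
        then show "r \<in> span {(1 / norm r) *\<^sub>R r}" by (metis span_base span_scale singletonI)
      qed
    qed
    let ?e = "e(k := u)"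
    have im: "?e ` {..<Suc k} = insert u (e ` {..<k})" by (auto simp: less_Suc_eq image_iff)
    have "frame n (Suc k) ?e"
      using e(1) u by (auto simp: frame_def orthonormal_def less_Suc_eq inner_commute power2_norm_eq_inner[symmetric])
    moreover have "w i \<in> span (?e ` {..<Suc k})" if "i < Suc k" for i
    proof (cases "i = k")
      case True
      have "proj k e (w k) \<in> span (insert u (e ` {..<k}))"
        using proj_in_span span_mono[of "e ` {..<k}" "insert u (e ` {..<k})"] by blast
      moreover have "r \<in> span (insert u (e ` {..<k}))"
        using u(4) span_mono[of "{u}" "insert u (e ` {..<k})"] by blast
      ultimately have "proj k e (w k) + r \<in> span (insert u (e ` {..<k}))" by (rule span_add)
      then show ?thesis unfolding im r_def proj_plus_rej True .
    next
      case False
      then have "w i \<in> span (e ` {..<k})" using that e by simp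
      then show ?thesis unfolding im using span_mono[of "e ` {..<k}" "insert u (e ` {..<k})"] by blast
    qed
    ultimately show ?case by blast
  qed
  then show thesis using that in_span_iff_proj frame_orthonormal by metis
qed

section \<open>Lower bounds and measurability for Hausdorff measure\<close>

lemma hausdorff_content_finite_cover:
  fixes A :: "'a::metric_space set"
  assumes I: "finite I" and A: "A \<subseteq> (\<Union>i\<in>I. C i)"
    and C: "\<And>i. i \<in> I \<Longrightarrow> bounded (C i) \<and> diameter (C i) \<le> d" and "0 \<le> d"
  shows "hausdorff_content d s A \<le> (\<Sum>i\<in>I. ennreal (unit_ball_vol s * (diameter (C i) / 2) powr s))"
proof -
  obtain h where h: "bij_betw h {..<card I} I"
    using bij_betw_from_nat_into_finite[OF I] by blast
  define D where "D j = (if j < card I then C (h j) else {})" for j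
  let ?f = "\<lambda>C :: 'a set. ennreal (unit_ball_vol s * (diameter C / 2) powr s)"
  have "A \<subseteq> (\<Union>j. D j)"
  proof
    fix x assume "x \<in> A"
    then obtain i where "i \<in> I" "x \<in> C i" using A by auto
    moreover obtain j where "j < card I" "h j = i"
      using h \<open>i \<in> I\<close> unfolding bij_betw_def by (metis imageE lessThan_iff)
    ultimately show "x \<in> (\<Union>j. D j)" by (auto simp: D_def)
  qed
  moreover have "bounded (D j) \<and> diameter (D j) \<le> d" for j
    using C h \<open>0 \<le> d\<close> by (auto simp: D_def bij_betw_def)
  ultimately have "hausdorff_content d s A \<le> (\<Sum>j. ?f (D j))"
    unfolding hausdorff_content_def by (intro INF_lower) simp
  also have "\<dots> = (\<Sum>j<card I. ?f (D j))"
    by (rule suminf_finite) (auto simp: D_def)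
  also have "\<dots> = (\<Sum>j<card I. ?f (C (h j)))" by (intro sum.cong) (auto simp: D_def)
  also have "\<dots> = (\<Sum>i\<in>I. ?f (C i))" by (rule sum.reindex_bij_betw[OF h])
  finally show ?thesis .
qed

lemma hausdorff_content_le: "0 < d \<Longrightarrow> hausdorff_content d s A \<le> hausdorff s A"
  unfolding hausdorff_def by (rule SUP_upper) simp

lemma hausdorff_content_antimono: "d \<le> d' \<Longrightarrow> hausdorff_content d' s A \<le> hausdorff_content d s A"
  unfolding hausdorff_content_def by (rule INF_superset_mono) (auto intro: order_trans)

definition growth :: "real \<Rightarrow> real \<Rightarrow> real \<Rightarrow> real \<Rightarrow> 'a::metric_space pmf \<Rightarrow> bool" where
  "growth s M \<eta> \<delta> q \<longleftrightarrow> (\<forall>C d. \<eta> \<le> d \<longrightarrow> d \<le> \<delta> \<longrightarrow> (\<forall>x\<in>C. \<forall>y\<in>C. dist x y \<le> d) \<longrightarrow>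
     measure_pmf.prob q C \<le> M * d powr s)"

text \<open>The mass distribution principle, uniformly over measures whose growth is controlled
  only above some small scale: this lets finitely supported measures replace limits of such.\<close>

lemma mass_distribution:
  fixes B :: "'a::metric_space set"
  assumes B: "compact B" and s: "0 < s" and H: "hausdorff s B < ennreal H" and \<delta>: "0 < \<delta>"
  obtains \<eta> where "0 < \<eta>"
    "\<And>(q :: 'a pmf) M. 0 \<le> M \<Longrightarrow> growth s M \<eta> \<delta> q \<Longrightarrow>
      measure_pmf.prob q B \<le> M * (2 powr s / unit_ball_vol s) * H"
proof -
  define w where "w = unit_ball_vol s"
  have w: "0 < w" using s by (simp add: w_def)
  have "hausdorff_content (\<delta> / 2) s B < ennreal H"
    using hausdorff_content_le[of "\<delta> / 2" s B] H \<delta> by simp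
  then obtain C :: "nat \<Rightarrow> 'a set" where C: "B \<subseteq> (\<Union>i. C i)"
      "\<And>i. bounded (C i)" "\<And>i. diameter (C i) \<le> \<delta> / 2"
      "(\<Sum>i. ennreal (w * (diameter (C i) / 2) powr s)) < ennreal H"
    unfolding hausdorff_content_def INF_less_iff w_def by auto
  define f where "f i = w * (diameter (C i) / 2) powr s" for i
  have f0: "0 \<le> f i" for i using w by (simp add: f_def)
  have "summable f" "suminf f < H"
  proof -
    have top: "(\<Sum>i. ennreal (f i)) \<noteq> top" using C(4) by (auto simp: f_def)
    then show sm: "summable f" using f0 by (intro summable_suminf_not_top) auto
    have "ennreal (suminf f) < ennreal H" using C(4) suminf_ennreal2[OF f0 sm] by (simp add: f_def[abs_def])
    then show "suminf f < H" by (simp add: ennreal_less_iff suminf_nonneg sm f0)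
  qed
  define g where "g = H - suminf f"
  have g: "0 < g" using \<open>suminf f < H\<close> by (simp add: g_def)
  have "\<exists>e>0. e \<le> \<delta> / 2 \<and> w * ((diameter (C i) + e) / 2) powr s \<le> f i + g * (1/2) ^ Suc i" for i
  proof -
    have "((\<lambda>e. w * ((diameter (C i) + e) / 2) powr s) \<longlongrightarrow> w * ((diameter (C i) + 0) / 2) powr s) (at_right 0)"
      using s by (intro tendsto_intros)
        (auto intro!: eventually_at_rightI[of 0 1] add_nonneg_nonneg diameter_ge_0 C(2))
    then have "eventually (\<lambda>e. w * ((diameter (C i) + e) / 2) powr s < f i + g * (1/2) ^ Suc i) (at_right 0)"
      by (rule order_tendstoD) (use g in \<open>simp add: f_def\<close>)
    moreover have "eventually (\<lambda>e. 0 < e \<and> e < \<delta> / 2) (at_right (0::real))"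
      using \<delta> by (auto intro!: eventually_at_rightI[of 0 "\<delta>/2"])
    ultimately have "eventually (\<lambda>e. 0 < e \<and> e \<le> \<delta> / 2 \<and> w * ((diameter (C i) + e) / 2) powr s \<le> f i + g * (1/2) ^ Suc i) (at_right 0)"
      by eventually_elim auto
    then show ?thesis using eventually_happens trivial_limit_at_right_real by (metis (no_types, lifting))
  qed
  then obtain e where e: "\<And>i. 0 < e i" "\<And>i. e i \<le> \<delta> / 2"
      "\<And>i. w * ((diameter (C i) + e i) / 2) powr s \<le> f i + g * (1/2) ^ Suc i"
    by metis
  define U where "U i = (\<Union>x\<in>C i. ball x (e i / 2))" for i
  define d where "d i = diameter (C i) + e i" for i
  have d0: "0 < d i" "d i \<le> \<delta>" for i
    using e(1,2)[of i] diameter_ge_0[OF C(2)[of i]] C(3)[of i] by (auto simp: d_def intro: add_nonneg_pos)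
  have Ud: "dist x y \<le> d i" if xy: "x \<in> U i" "y \<in> U i" for x y i
  proof -
    obtain x' y' where "x' \<in> C i" "dist x' x < e i / 2" "y' \<in> C i" "dist y' y < e i / 2"
      using xy by (auto simp: U_def)
    moreover have "dist x' y' \<le> diameter (C i)"
      using calculation C(2) diameter_bounded_bound by blast
    moreover have "dist x y \<le> dist x' x + dist x' y' + dist y' y"
      using dist_triangle[of x y x'] dist_triangle[of x' y y'] by (simp add: dist_commute[of x x'])
    ultimately show ?thesis by (simp add: d_def)
  qed
  obtain F where F: "finite F" "B \<subseteq> (\<Union>i\<in>F. U i)"
  proof -
    have CU: "C i \<subseteq> U i" for i
    proof
      fix x assume "x \<in> C i"
      then show "x \<in> U i" unfolding U_def by (rule UN_I) (use e(1)[of i] in simp)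
    qed
    have BU: "B \<subseteq> (\<Union>i\<in>UNIV. U i)" using C(1) by (rule order_trans) (intro UN_mono order_refl CU)
    have op: "open (U i)" for i unfolding U_def by (intro open_UN ballI open_ball)
    obtain F where "F \<subseteq> UNIV" "finite F" "B \<subseteq> (\<Union>i\<in>F. U i)"
      using BU by (rule compactE_image[where f = U and C = UNIV, OF B op])
    then show thesis using that by blast
  qed
  define \<eta> where "\<eta> = Min (insert \<delta> (d ` F))"
  have "0 < \<eta>" using F(1) \<delta> d0 by (auto simp: \<eta>_def)
  moreover have "measure_pmf.prob q B \<le> M * (2 powr s / unit_ball_vol s) * H"
    if M: "0 \<le> M" and q: "growth s M \<eta> \<delta> q" for q :: "'a pmf" and M
  proof -
    have "measure_pmf.prob q B \<le> measure_pmf.prob q (\<Union>i\<in>F. U i)"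
      using F(2) by (intro measure_pmf.finite_measure_mono) auto
    also have "\<dots> \<le> (\<Sum>i\<in>F. measure_pmf.prob q (U i))"
      by (rule measure_pmf.finite_measure_subadditive_finite) (use F in auto)
    also have "\<dots> \<le> (\<Sum>i\<in>F. M * d i powr s)"
      by (intro sum_mono q[unfolded growth_def, rule_format] d0 Ud) (use F(1) in \<open>auto simp: \<eta>_def\<close>)
    also have "\<dots> = M * (2 powr s / w) * (\<Sum>i\<in>F. w * (d i / 2) powr s)"
    proof -
      have "M * d i powr s = M * (2 powr s / w) * (w * (d i / 2) powr s)" for i
        using w d0(1)[of i] by (simp add: powr_divide)
      then show ?thesis by (simp add: sum_distrib_left)
    qed
    also have "\<dots> \<le> M * (2 powr s / w) * (\<Sum>i\<in>F. f i + g * (1/2) ^ Suc i)"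
      using M w by (intro mult_left_mono sum_mono) (auto simp: d_def intro: e(3) simp del: power_Suc)
    also have "\<dots> \<le> M * (2 powr s / w) * H"
    proof (intro mult_left_mono)
      have "(\<Sum>i\<in>F. f i) \<le> suminf f" using F(1) f0 \<open>summable f\<close> by (intro sum_le_suminf) auto
      moreover have "(\<Sum>i\<in>F. (1/2) ^ Suc i) \<le> (\<Sum>i. (1/2) ^ Suc i :: real)"
        using F(1) sums_summable[OF power_half_series] by (intro sum_le_suminf) auto
      then have "(\<Sum>i\<in>F. (1/2) ^ Suc i) \<le> (1::real)" using sums_unique[OF power_half_series] by simp
      then have "g * (\<Sum>i\<in>F. (1/2) ^ Suc i) \<le> g * 1" using g by (intro mult_left_mono) auto
      ultimately show "(\<Sum>i\<in>F. f i + g * (1/2) ^ Suc i) \<le> H"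
        by (simp add: sum.distrib sum_distrib_left g_def del: power_Suc)
    qed (use M w in auto)
    finally show ?thesis by (simp add: w_def)
  qed
  ultimately show thesis by (rule that)
qed

lemma hausdorff_separated:
  fixes P Q :: "'a::metric_space set"
  assumes r: "0 < r" "\<And>x y. x \<in> P \<Longrightarrow> y \<in> Q \<Longrightarrow> r \<le> dist x y"
  shows "hausdorff s P + hausdorff s Q \<le> hausdorff s (P \<union> Q)"
proof -
  let ?f = "\<lambda>C :: 'a set. ennreal (unit_ball_vol s * (diameter C / 2) powr s)"
  have content: "hausdorff_content d s P + hausdorff_content d s Q \<le> hausdorff_content d s (P \<union> Q)"
    if d: "0 < d" "d < r" for d
    unfolding hausdorff_content_def[of d s "P \<union> Q"]
  proof (rule INF_greatest)
    fix C :: "nat \<Rightarrow> 'a set"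
    assume "C \<in> {C. P \<union> Q \<subseteq> (\<Union>i. C i) \<and> (\<forall>i. bounded (C i) \<and> diameter (C i) \<le> d)}"
    then have C: "P \<union> Q \<subseteq> (\<Union>i. C i)" "\<And>i. bounded (C i)" "\<And>i. diameter (C i) \<le> d" by auto
    define CP where "CP i = (if C i \<inter> P = {} then {} else C i)" for i
    define CQ where "CQ i = (if C i \<inter> P = {} then C i else {})" for i
    have disj: "C i \<inter> Q = {}" if CP: "C i \<inter> P \<noteq> {}" for i
    proof (rule ccontr)
      assume "C i \<inter> Q \<noteq> {}"
      then obtain x y where "x \<in> C i" "x \<in> P" "y \<in> C i" "y \<in> Q" using CP by blast
      then have "r \<le> diameter (C i)" using r(2) diameter_bounded_bound[OF C(2)] order_trans by blast
      then show False using C(3)[of i] d by simp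
    qed
    have "hausdorff_content d s P \<le> (\<Sum>i. ?f (CP i))" unfolding hausdorff_content_def
    proof (rule INF_lower, safe)
      fix x assume "x \<in> P"
      then obtain i where "x \<in> C i" using C(1) by auto
      then have "x \<in> CP i" using \<open>x \<in> P\<close> by (auto simp: CP_def)
      then show "x \<in> (\<Union>i. CP i)" by auto
    qed (use C d in \<open>auto simp: CP_def\<close>)
    moreover have "hausdorff_content d s Q \<le> (\<Sum>i. ?f (CQ i))" unfolding hausdorff_content_def
    proof (rule INF_lower, safe)
      fix x assume "x \<in> Q"
      then obtain i where "x \<in> C i" using C(1) by auto
      then have "x \<in> CQ i" using \<open>x \<in> Q\<close> disj[of i] by (auto simp: CQ_def)
      then show "x \<in> (\<Union>i. CQ i)" by auto
    qed (use C d in \<open>auto simp: CQ_def\<close>)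
    moreover have "(\<Sum>i. ?f (CP i)) + (\<Sum>i. ?f (CQ i)) = (\<Sum>i. ?f (C i))"
      by (subst suminf_add) (auto simp: CP_def CQ_def intro!: suminf_cong)
    ultimately show "hausdorff_content d s P + hausdorff_content d s Q \<le> (\<Sum>i. ?f (C i))"
      by (metis add_mono)
  qed
  have "hausdorff s P + hausdorff s Q = (SUP d\<in>{0<..}. hausdorff_content d s P + hausdorff_content d s Q)"
    unfolding hausdorff_def
  proof (rule SUP_add_directed_ennreal[symmetric])
    fix i j :: real assume "i \<in> {0<..}" "j \<in> {0<..}"
    then show "\<exists>k\<in>{0<..}. hausdorff_content i s P + hausdorff_content j s Q
        \<le> hausdorff_content k s P + hausdorff_content k s Q"
      by (intro bexI[of _ "min i j"] add_mono hausdorff_content_antimono) auto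
  qed
  also have "\<dots> \<le> hausdorff s (P \<union> Q)"
  proof (rule SUP_least)
    fix d :: real assume "d \<in> {0<..}"
    define d' where "d' = min d (r / 2)"
    have d': "0 < d'" "d' < r" "d' \<le> d" using r(1) \<open>d \<in> {0<..}\<close> by (auto simp: d'_def)
    have "hausdorff_content d s P + hausdorff_content d s Q
        \<le> hausdorff_content d' s P + hausdorff_content d' s Q"
      by (intro add_mono hausdorff_content_antimono d')
    also have "\<dots> \<le> hausdorff_content d' s (P \<union> Q)" by (rule content[OF d'(1,2)])
    also have "\<dots> \<le> hausdorff s (P \<union> Q)" by (rule hausdorff_content_le[OF d'(1)])
    finally show "hausdorff_content d s P + hausdorff_content d s Q \<le> hausdorff s (P \<union> Q)" .
  qed
  finally show ?thesis .
qed

lemma hausdorff_UN_le: "hausdorff s (\<Union>i. A i) \<le> (\<Sum>i::nat. hausdorff s (A i))"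
  unfolding hausdorff_def[of s "\<Union>i. A i"]
proof (rule SUP_least)
  fix d :: real assume "d \<in> {0<..}"
  then have "(\<Sum>i. hausdorff_content d s (A i)) \<le> (\<Sum>i. hausdorff s (A i))"
    by (intro suminf_le hausdorff_content_le) auto
  then show "hausdorff_content d s (\<Union>i. A i) \<le> (\<Sum>i. hausdorff s (A i))"
    using hausdorff_content_subadditive order_trans by blast
qed

lemma hausdorff_Un_le: "hausdorff s (P \<union> Q) \<le> hausdorff s P + hausdorff s Q"
proof -
  have "hausdorff s (\<Union>i. (case i of 0 \<Rightarrow> P | Suc 0 \<Rightarrow> Q | _ \<Rightarrow> {})) \<le>
      (\<Sum>i. hausdorff s (case i of 0 \<Rightarrow> P | Suc 0 \<Rightarrow> Q | _ \<Rightarrow> {}))"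
    by (rule hausdorff_UN_le)
  also have "(\<Union>i. (case i of 0 \<Rightarrow> P | Suc 0 \<Rightarrow> Q | _ \<Rightarrow> {})) = P \<union> Q"
    by (auto split: nat.splits)
  also have "(\<Sum>i. hausdorff s (case i of 0 \<Rightarrow> P | Suc 0 \<Rightarrow> Q | _ \<Rightarrow> {})) =
      (\<Sum>i<2. hausdorff s (case i of 0 \<Rightarrow> P | Suc 0 \<Rightarrow> Q | _ \<Rightarrow> {}))"
    by (rule suminf_finite) (auto simp: hausdorff_empty split: nat.splits)
  also have "\<dots> = hausdorff s P + hausdorff s Q"
    by (simp add: numeral_2_eq_2)
  finally show ?thesis .
qed

text \<open>Caratheodory's criterion: the layers \<open>L k\<close> of \<open>X - B\<close> at distance about \<open>1/k\<close> from \<open>B\<close>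
  with indices of equal parity are separated, hence their measures are summable.\<close>

lemma closed_in_lambda_system:
  fixes B :: "'a::metric_space set"
  assumes "closed B"
  shows "B \<in> lambda_system UNIV UNIV (hausdorff s)"
proof (cases "B = {}")
  case True
  then show ?thesis by (simp add: lambda_system_def hausdorff_empty)
next
  case ne: False
  let ?H = "hausdorff s :: 'a set \<Rightarrow> ennreal"
  have ge: "?H (B \<inter> X) + ?H (X - B) \<le> ?H X" for X
  proof (cases "?H X = top")
    case fin: False
    define K where "K k = {x\<in>X. 1 / real (Suc k) \<le> infdist x B}" for k
    define L where "L k = K (Suc k) - K k" for k
    have K_sub: "K k \<subseteq> X - B" for k
    proof
      fix x assume "x \<in> K k"
      then have "x \<in> X" "0 < infdist x B" by (auto simp: K_def intro: less_le_trans[rotated])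
      then show "x \<in> X - B" by auto
    qed
    have K_mono: "K k \<subseteq> K (Suc k)" for k
    proof
      fix x assume "x \<in> K k"
      moreover have "1 / real (Suc (Suc k)) \<le> 1 / real (Suc k)" by (intro divide_left_mono) auto
      ultimately show "x \<in> K (Suc k)" by (auto simp: K_def simp del: of_nat_Suc)
    qed
    have K_mono': "K j \<subseteq> K k" if "j \<le> k" for j k
      using lift_Suc_mono_le[of K, OF K_mono that] .
    have sepK: "?H (B \<inter> X) + ?H (K k) \<le> ?H X" for k
    proof -
      have "?H (B \<inter> X) + ?H (K k) \<le> ?H (B \<inter> X \<union> K k)"
      proof (rule hausdorff_separated)
        show "0 < 1 / real (Suc k)" by simp
        fix x y assume "x \<in> B \<inter> X" "y \<in> K k"
        then show "1 / real (Suc k) \<le> dist x y"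
          using infdist_le[of x B y] by (auto simp: K_def dist_commute intro: order_trans)
      qed
      also have "\<dots> \<le> ?H X" using K_sub by (intro hausdorff_mono) auto
      finally show ?thesis .
    qed
    have par: "(\<Sum>i<n. ?H (L (2 * i + c))) \<le> ?H (\<Union>i<n. L (2 * i + c))" for n c
    proof (induction n)
      case (Suc n)
      show ?case
      proof (cases n)
        case 0
        then show ?thesis by (simp add: lessThan_Suc)
      next
        case (Suc k)
        have "(\<Sum>i<Suc n. ?H (L (2 * i + c))) \<le> ?H (\<Union>i<n. L (2 * i + c)) + ?H (L (2 * n + c))"
          using Suc.IH by (simp add: add_right_mono)
        also have "\<dots> \<le> ?H ((\<Union>i<n. L (2 * i + c)) \<union> L (2 * n + c))"
        proof (rule hausdorff_separated)
          show "0 < 1 / real (2 * n + c) - 1 / real (Suc (2 * n + c))"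
            using Suc by (simp add: divide_strict_left_mono)
          fix x y assume "x \<in> (\<Union>i<n. L (2 * i + c))" "y \<in> L (2 * n + c)"
          then obtain i where i: "i < n" "x \<in> K (Suc (2 * i + c))" "y \<notin> K (2 * n + c)" "y \<in> X"
            by (auto simp: L_def K_def)
          have "Suc (2 * i + c) \<le> 2 * n + c - 1" using i(1) by linarith
          from K_mono'[OF this] i(2) have "x \<in> K (2 * n + c - 1)" by (rule subsetD)
          moreover have "Suc (2 * n + c - 1) = 2 * n + c" using Suc by simp
          ultimately have "1 / real (2 * n + c) \<le> infdist x B" unfolding K_def by (simp del: of_nat_Suc)
          moreover have "infdist y B < 1 / real (Suc (2 * n + c))"
            using i(3,4) by (simp add: K_def del: of_nat_Suc)
          ultimately show "1 / real (2 * n + c) - 1 / real (Suc (2 * n + c)) \<le> dist x y"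
            using infdist_triangle[of x B y] by linarith
        qed
        also have "(\<Union>i<n. L (2 * i + c)) \<union> L (2 * n + c) = (\<Union>i<Suc n. L (2 * i + c))"
          by (simp add: lessThan_Suc Un_commute)
        finally show ?thesis .
      qed
    qed simp
    have LX: "?H (\<Union>i<n. L (2 * i + c)) \<le> ?H X" for n c
      by (rule hausdorff_mono) (auto simp: L_def K_def)
    have sumL: "(\<Sum>i. ?H (L i)) \<le> ?H X + ?H X"
    proof (rule suminf_le_const)
      fix N
      have "(\<Sum>i<N. ?H (L i)) \<le> (\<Sum>i<2 * N. ?H (L i))" by (intro sum_mono2) auto
      also have "\<dots> = (\<Sum>i<N. ?H (L (2 * i + 0))) + (\<Sum>i<N. ?H (L (2 * i + 1)))"
        by (induction N) (simp_all add: algebra_simps)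
      also have "\<dots> \<le> ?H X + ?H X"
        by (intro add_mono order_trans[OF par LX])
      finally show "(\<Sum>i<N. ?H (L i)) \<le> ?H X + ?H X" .
    qed simp
    moreover have "?H X + ?H X < top" using fin by (simp add: less_top)
    ultimately have tot: "(\<Sum>i. ?H (L i)) < top" by (rule le_less_trans)
    have cover: "X - B \<subseteq> K k \<union> (\<Union>j. L (j + k))" for k
    proof
      fix x assume x: "x \<in> X - B"
      then have "0 < infdist x B"
        using assms ne by (simp add: infdist_nonneg in_closed_iff_infdist_zero less_le)
      then obtain N where N: "1 / real (Suc N) < infdist x B" using nat_approx_posE by blast
      have "x \<in> K N" using x N by (simp add: K_def)
      show "x \<in> K k \<union> (\<Union>j. L (j + k))"
      proof (cases "x \<in> K k")
        case False
        define j where "j = (LEAST j. x \<in> K j)"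
        have j: "x \<in> K j" unfolding j_def using \<open>x \<in> K N\<close> by (rule LeastI)
        have "k < j" using False j K_mono'[of j k] by (metis linorder_not_le subsetD)
        then obtain i where i: "j = Suc (i + k)" by (metis add.commute less_imp_Suc_add)
        have "x \<notin> K (i + k)" using not_less_Least[of "i + k" "\<lambda>j. x \<in> K j"] i by (simp add: j_def)
        then have "x \<in> L (i + k)" using j i by (simp add: L_def)
        then show ?thesis by blast
      qed simp
    qed
    define S where "S = (SUP k. ?H (K k))"
    have "?H (X - B) + (\<Sum>i. ?H (L i)) \<le> S + (\<Sum>i. ?H (L i))"
    proof -
      have "?H (X - B) + (\<Sum>i<k. ?H (L i)) \<le> S + (\<Sum>i. ?H (L i))" for k
      proof -
        have "?H (X - B) \<le> ?H (K k) + ?H (\<Union>j. L (j + k))"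
          using hausdorff_mono[OF cover[of k]] hausdorff_Un_le order_trans by blast
        also have "?H (\<Union>j. L (j + k)) \<le> (\<Sum>j. ?H (L (j + k)))" by (rule hausdorff_UN_le)
        also have "?H (K k) \<le> S" unfolding S_def by (rule SUP_upper) simp
        finally have "?H (X - B) + (\<Sum>i<k. ?H (L i)) \<le> S + (\<Sum>j. ?H (L (j + k))) + (\<Sum>i<k. ?H (L i))"
          by (simp add: add_right_mono add_left_mono)
        also have "\<dots> = S + (\<Sum>i. ?H (L i))"
          using suminf_offset[of "\<lambda>i. ?H (L i)" k] by (simp add: add.assoc add.commute)
        finally show ?thesis .
      qed
      then have "(SUP k. ?H (X - B) + (\<Sum>i<k. ?H (L i))) \<le> S + (\<Sum>i. ?H (L i))"
        by (rule SUP_least)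
      then show ?thesis by (simp add: ennreal_SUP_add_right suminf_eq_SUP)
    qed
    then have "?H (X - B) \<le> S" using tot ennreal_add_left_cancel_le[of "\<Sum>i. ?H (L i)" "?H (X - B)" S]
      by (auto simp: add.commute)
    then have "?H (B \<inter> X) + ?H (X - B) \<le> ?H (B \<inter> X) + S" by (rule add_left_mono)
    also have "\<dots> = (SUP k. ?H (B \<inter> X) + ?H (K k))" by (simp add: S_def ennreal_SUP_add_right)
    also have "\<dots> \<le> ?H X" by (rule SUP_least) (rule sepK)
    finally show ?thesis .
  qed simp
  have "?H (B \<inter> X) + ?H ((UNIV - B) \<inter> X) = ?H X" for X
  proof (rule antisym)
    have eq: "(UNIV - B) \<inter> X = X - B" by auto
    show "?H (B \<inter> X) + ?H ((UNIV - B) \<inter> X) \<le> ?H X" using ge[of X] by (simp add: eq)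
    have "?H X \<le> ?H ((B \<inter> X) \<union> (X - B))" by (rule hausdorff_mono) auto
    also have "\<dots> \<le> ?H (B \<inter> X) + ?H (X - B)" by (rule hausdorff_Un_le)
    finally show "?H X \<le> ?H (B \<inter> X) + ?H ((UNIV - B) \<inter> X)" by (simp add: eq)
  qed
  then show ?thesis by (simp add: lambda_system_def)
qed

lemma sets_hausdorff_measure:
  "sets (hausdorff_measure s) = lambda_system UNIV UNIV (hausdorff s)"
proof -
  have "sigma_algebra UNIV (lambda_system UNIV UNIV (hausdorff s :: 'a set \<Rightarrow> ennreal))"
    using measure_space_hausdorff unfolding measure_space_def by blast
  then show ?thesis unfolding hausdorff_measure_def
    by (simp add: sigma_algebra.sigma_sets_eq)
qed

lemma energy_ge:
  fixes S :: "'a::real_inner set"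
  assumes B: "compact B" "B \<subseteq> tuples l S"
    and ext: "\<And>t. t \<in> B \<Longrightarrow> \<exists>x. (\<forall>i<l. x i = coord t i) \<and> (\<forall>i\<in>{l..m + 1}. x i \<in> S) \<and> c \<le> menger_curv m x"
    and "0 \<le> c" "0 \<le> p"
  shows "ennreal (c powr p) * hausdorff (real (m * l)) B \<le> energy m l p S"
proof -
  let ?M = "hausdorff_measure (real (m * l)) :: 'a finseq measure"
  have mem: "B \<in> lambda_system UNIV UNIV (hausdorff (real (m * l)))"
    by (rule closed_in_lambda_system) (use B compact_imp_closed in auto)
  have "ennreal (c powr p) * hausdorff (real (m * l)) B = ennreal (c powr p) * emeasure ?M B"
    by (simp only: emeasure_hausdorff_measure[OF mem])
  also have "\<dots> = (\<integral>\<^sup>+ t. ennreal (c powr p) * indicator B t \<partial>?M)"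
    by (rule nn_integral_cmult_indicator[symmetric]) (use mem in \<open>simp add: sets_hausdorff_measure\<close>)
  also have "\<dots> \<le> energy m l p S"
    unfolding energy_def
  proof (rule nn_integral_mono)
    fix t
    let ?X = "{x. (\<forall>i<l. x i = coord t i) \<and> (\<forall>i\<in>{l..m + 1}. x i \<in> S)}"
    show "ennreal (c powr p) * indicator B t
        \<le> (SUP x\<in>?X. ennreal (menger_curv m x powr p)) * indicator (tuples l S) t"
    proof (cases "t \<in> B")
      case True
      then obtain x where x: "x \<in> ?X" "c \<le> menger_curv m x" using ext by blast
      have "ennreal (c powr p) \<le> ennreal (menger_curv m x powr p)"
        using x(2) assms(4,5) by (intro ennreal_leI powr_mono2) auto
      also have "\<dots> \<le> (SUP x\<in>?X. ennreal (menger_curv m x powr p))" by (rule SUP_upper[OF x(1)])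
      finally show ?thesis using True B(2) by (auto simp: indicator_def)
    qed simp
  qed
  finally show ?thesis .
qed

lemma hausdorff_ge_mass:
  fixes B :: "'a::metric_space set"
  assumes B: "compact B" and "0 < s" "0 < \<delta>" "0 < M"
    and q: "\<And>\<eta>. 0 < \<eta> \<Longrightarrow> \<exists>q. set_pmf q \<subseteq> B \<and> growth s M \<eta> \<delta> q"
  shows "ennreal (unit_ball_vol s / (2 * 2 powr s * M)) \<le> hausdorff s B"
proof (rule ccontr)
  let ?H = "unit_ball_vol s / (2 * 2 powr s * M)"
  assume "\<not> ?thesis"
  then have "hausdorff s B < ennreal ?H" by simp
  then obtain \<eta> where \<eta>: "0 < \<eta>" "\<And>(q :: 'a pmf) M. 0 \<le> M \<Longrightarrow> growth s M \<eta> \<delta> q \<Longrightarrow>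
      measure_pmf.prob q B \<le> M * (2 powr s / unit_ball_vol s) * ?H"
    using mass_distribution[OF B assms(2) _ assms(3)] by metis
  obtain q where "set_pmf q \<subseteq> B" "growth s M \<eta> \<delta> q" using q[OF \<eta>(1)] by blast
  then have "measure_pmf.prob q B = 1" "measure_pmf.prob q B \<le> M * (2 powr s / unit_ball_vol s) * ?H"
    using \<eta>(2)[of M q] assms(4) by (auto simp: measure_pmf.prob_eq_1 AE_measure_pmf_iff)
  moreover have "M * (2 powr s / unit_ball_vol s) * ?H = 1 / 2"
  proof -
    have "unit_ball_vol s \<noteq> 0" using unit_ball_vol_pos[of s] assms(2) by linarith
    then show ?thesis using assms(4) by (simp add: field_simps)
  qed
  ultimately show False by simp
qed

lemma growth_mono: "growth s M \<eta> \<delta> q \<Longrightarrow> M \<le> M' \<Longrightarrow> growth s M' \<eta> \<delta> q"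
  unfolding growth_def by (meson mult_right_mono order_trans powr_ge_zero)

section \<open>Volumes of simplices\<close>

lemma card_nat_diff_le:
  assumes "finite Y" "0 \<le> r" "\<And>y y'. y \<in> Y \<Longrightarrow> y' \<in> Y \<Longrightarrow> \<bar>real y - real y'\<bar> \<le> r"
  shows "real (card Y) \<le> r + 1"
proof (cases "Y = {}")
  case False
  have "Y \<subseteq> {Min Y..Max Y}" using assms(1) by auto
  then have "card Y \<le> Suc (Max Y) - Min Y" using card_mono[of "{Min Y..Max Y}" Y] by simp
  moreover have "\<bar>real (Max Y) - real (Min Y)\<bar> \<le> r"
    using assms(1) False by (intro assms(3)) auto
  moreover have "Min Y \<le> Max Y" using assms(1) False by (meson Max_ge Min_in)
  ultimately show ?thesis by linarith
qed (use assms in simp)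

abbreviation grid_pmf :: "nat \<Rightarrow> nat \<Rightarrow> (nat \<Rightarrow> nat) pmf" where
  "grid_pmf D Q \<equiv> Pi_pmf {..<D} 0 (\<lambda>_. pmf_of_set {..<Q})"

lemma grid_pmf_support:
  assumes "0 < Q" "k \<in> set_pmf (grid_pmf D Q)"
  shows "\<forall>i<D. k i < Q"
proof -
  have "k \<in> PiE_dflt {..<D} 0 (set_pmf \<circ> (\<lambda>_. pmf_of_set {..<Q}))"
    using assms(2) by (simp add: set_Pi_pmf)
  moreover have "set_pmf (pmf_of_set {..<Q}) = {..<Q}" using assms(1) by (intro set_pmf_of_set) auto
  ultimately show ?thesis by (auto simp: PiE_dflt_def)
qed

lemma grid_prob_le:
  assumes Q: "0 < Q" and c: "\<And>j. j < D \<Longrightarrow> 0 \<le> c j"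
    and A: "\<And>k k' j. k \<in> A \<Longrightarrow> k' \<in> A \<Longrightarrow> j < D \<Longrightarrow> (\<And>i. j < i \<Longrightarrow> i < D \<Longrightarrow> k i = k' i) \<Longrightarrow>
      \<bar>real (k j) - real (k' j)\<bar> \<le> c j * real Q"
  shows "measure_pmf.prob (grid_pmf D Q) A \<le> (\<Prod>j<D. c j + 1 / real Q)"
  using c A
proof (induction D arbitrary: A)
  case (Suc D)
  let ?P = "\<Prod>j<D. c j + 1 / real Q"
  have P0: "0 \<le> ?P" using Suc.prems(1) by (intro prod_nonneg) auto
  define Y where "Y = {y\<in>{..<Q}. \<exists>f. f(D := y) \<in> A}"
  have IH: "measure_pmf.prob (grid_pmf D Q) {f. f(D := y) \<in> A} \<le> ?P" for y
  proof (rule Suc.IH)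
    fix k k' :: "nat \<Rightarrow> nat" and j
    assume *: "k \<in> {f. f(D := y) \<in> A}" "k' \<in> {f. f(D := y) \<in> A}" "j < D"
      "\<And>i. j < i \<Longrightarrow> i < D \<Longrightarrow> k i = k' i"
    have "\<bar>real ((k(D := y)) j) - real ((k'(D := y)) j)\<bar> \<le> c j * real Q"
      using *(1-3) *(4) by (intro Suc.prems(2)[of "k(D := y)" "k'(D := y)" j, OF CollectD[OF *(1)] CollectD[OF *(2)]]) auto
    then show "\<bar>real (k j) - real (k' j)\<bar> \<le> c j * real Q" using \<open>j < D\<close> by simp
  qed (use Suc.prems in auto)
  have cardY: "real (card Y) \<le> c D * real Q + 1"
  proof (rule card_nat_diff_le)
    fix y y' assume "y \<in> Y" "y' \<in> Y"
    then obtain f f' where f: "f(D := y) \<in> A" "f'(D := y') \<in> A" by (auto simp: Y_def)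
    have "\<bar>real ((f(D := y)) D) - real ((f'(D := y')) D)\<bar> \<le> c D * real Q"
      by (rule Suc.prems(2)[OF f]) auto
    then show "\<bar>real y - real y'\<bar> \<le> c D * real Q" by simp
  qed (use Suc.prems(1) in \<open>auto simp: Y_def\<close>)
  have "{..<Suc D} = insert D {..<D}" by auto
  then have "emeasure (grid_pmf (Suc D) Q) A =
      (\<integral>\<^sup>+y. emeasure (grid_pmf D Q) {f. f(D := y) \<in> A} \<partial>pmf_of_set {..<Q})"
    by (simp add: Pi_pmf_insert' emeasure_bind_pmf map_pmf_def[symmetric] vimage_def)
  also have "\<dots> \<le> (\<integral>\<^sup>+y. ennreal ?P * indicator Y y \<partial>pmf_of_set {..<Q})"
  proof (rule nn_integral_mono_AE, unfold AE_measure_pmf_iff, safe)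
    fix y assume "y \<in> set_pmf (pmf_of_set {..<Q})"
    moreover have "set_pmf (pmf_of_set {..<Q}) = {..<Q}" using Q by (intro set_pmf_of_set) auto
    ultimately have "y < Q" by simp
    show "emeasure (grid_pmf D Q) {f. f(D := y) \<in> A} \<le> ennreal ?P * indicator Y y"
    proof (cases "y \<in> Y")
      case True
      then show ?thesis using IH[of y] by (simp add: measure_pmf.emeasure_eq_measure ennreal_leI)
    next
      case False
      then have "{f. f(D := y) \<in> A} = {}" using \<open>y < Q\<close> by (auto simp: Y_def)
      then show ?thesis by simp
    qed
  qed
  also have "\<dots> = ennreal ?P * emeasure (pmf_of_set {..<Q}) Y"
    by (simp add: nn_integral_cmult_indicator)
  also have "emeasure (measure_pmf (pmf_of_set {..<Q})) Y = ennreal (real (card Y) / real Q)"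
  proof -
    have "{..<Q} \<inter> Y = Y" by (auto simp: Y_def)
    then show ?thesis using Q by (subst emeasure_pmf_of_set) (auto simp: )
  qed
  also have "ennreal ?P * ennreal (real (card Y) / real Q) = ennreal (?P * (real (card Y) / real Q))"
    by (rule ennreal_mult[symmetric]) (use P0 in auto)
  finally have "measure_pmf.prob (grid_pmf (Suc D) Q) A \<le> ?P * (real (card Y) / real Q)"
    using P0 by (simp add: measure_pmf.emeasure_eq_measure)
  also have "\<dots> \<le> ?P * (c D + 1 / real Q)"
    using cardY Q P0 by (intro mult_left_mono) (auto simp: field_simps)
  finally show ?case by (simp add: mult.commute)
qed simp

lemma grid_growth:
  fixes g :: "(nat \<Rightarrow> nat) \<Rightarrow> 'a::metric_space"
  assumes Q: "0 < Q" "0 < \<eta>" and \<rho>: "\<And>j. j < D \<Longrightarrow> 0 < \<rho> j" "\<And>j. j < D \<Longrightarrow> \<rho> j \<le> \<eta> * real Q"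
    and g: "\<And>k k' j. (\<And>i. i < D \<Longrightarrow> k i < Q) \<Longrightarrow> (\<And>i. i < D \<Longrightarrow> k' i < Q) \<Longrightarrow> j < D \<Longrightarrow>
      (\<And>i. j < i \<Longrightarrow> i < D \<Longrightarrow> k i = k' i) \<Longrightarrow>
      \<rho> j * \<bar>real (k j) - real (k' j)\<bar> / real Q \<le> dist (g k) (g k')"
  shows "growth (real D) (2 ^ D / (\<Prod>j<D. \<rho> j)) \<eta> \<delta> (map_pmf g (grid_pmf D Q))"
  unfolding growth_def
proof (intro allI impI)
  fix C :: "'a set" and d :: real assume d: "\<eta> \<le> d" "d \<le> \<delta>" and C: "\<forall>x\<in>C. \<forall>y\<in>C. dist x y \<le> d"
  define A where "A = {k. g k \<in> C \<and> (\<forall>i<D. k i < Q)}"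
  have "measure_pmf.prob (map_pmf g (grid_pmf D Q)) C = measure_pmf.prob (grid_pmf D Q) (g -` C)"
    by simp
  also have "\<dots> = measure_pmf.prob (grid_pmf D Q) A"
    by (rule measure_pmf.finite_measure_eq_AE)
       (use grid_pmf_support[OF Q(1)] in \<open>auto simp: AE_measure_pmf_iff A_def\<close>)
  also have "\<dots> \<le> (\<Prod>j<D. d / \<rho> j + 1 / real Q)"
  proof (rule grid_prob_le[OF Q(1)])
    fix j assume "j < D" then show "0 \<le> d / \<rho> j" using \<rho>(1)[of j] d(1) Q(2) by simp
  next
    fix k k' j assume *: "k \<in> A" "k' \<in> A" "j < D" "\<And>i. j < i \<Longrightarrow> i < D \<Longrightarrow> k i = k' i"
    have "\<rho> j * \<bar>real (k j) - real (k' j)\<bar> / real Q \<le> dist (g k) (g k')"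
      by (rule g) (use * in \<open>auto simp: A_def\<close>)
    also have "\<dots> \<le> d" using C * by (auto simp: A_def)
    finally show "\<bar>real (k j) - real (k' j)\<bar> \<le> d / \<rho> j * real Q"
      using \<rho>(1)[OF *(3)] Q(1) by (simp add: field_simps)
  qed
  also have "\<dots> \<le> (\<Prod>j<D. 2 * d / \<rho> j)"
  proof (rule prod_mono, safe)
    fix j assume "j < D"
    have "1 / real Q \<le> \<eta> / \<rho> j" using \<rho>[OF \<open>j < D\<close>] Q(1) by (simp add: field_simps)
    also have "\<dots> \<le> d / \<rho> j" using \<rho>(1)[OF \<open>j < D\<close>] d by (intro divide_right_mono) auto
    finally show "d / \<rho> j + 1 / real Q \<le> 2 * d / \<rho> j" by simp
    show "0 \<le> d / \<rho> j + 1 / real Q" using \<rho>(1)[OF \<open>j < D\<close>] d(1) Q(2) by simp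
  qed
  also have "\<dots> = 2 ^ D / (\<Prod>j<D. \<rho> j) * d powr real D"
    using d(1) Q(2) by (simp add: prod_dividef prod.distrib powr_realpow power_mult_distrib)
  finally show "measure_pmf.prob (map_pmf g (grid_pmf D Q)) C \<le> 2 ^ D / (\<Prod>j<D. \<rho> j) * d powr real D" .
qed

definition vol_const :: "nat \<Rightarrow> real" where
  "vol_const D = unit_ball_vol (real D) / (2 * 2 powr real D * (2 * real D) ^ D)"

lemma vol_const_pos: "0 < D \<Longrightarrow> 0 < vol_const D"
  by (simp add: vol_const_def)

lemma hausdorff_simplex_ge:
  fixes v :: "nat \<Rightarrow> 'a::real_normed_vector"
  assumes D: "0 < D" and \<rho>: "\<And>j. j < D \<Longrightarrow> 0 < \<rho> j"
    and v: "\<And>j a. j < D \<Longrightarrow> \<rho> j * \<bar>a j\<bar> \<le> norm (\<Sum>i\<le>j. a i *\<^sub>R v i)"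
    and B: "compact B" "\<And>a. (\<And>i. i < D \<Longrightarrow> 0 \<le> a i) \<Longrightarrow> sum a {..<D} \<le> 1 \<Longrightarrow> x + (\<Sum>i<D. a i *\<^sub>R v i) \<in> B"
  shows "ennreal (vol_const D * (\<Prod>j<D. \<rho> j)) \<le> hausdorff (real D) B"
proof -
  define M where "M = 2 ^ D / (\<Prod>j<D. \<rho> j / real D)"
  have P0: "0 < (\<Prod>j<D. \<rho> j)" using \<rho> by (intro prod_pos) auto
  have M0: "0 < M" unfolding M_def using \<rho> D by (intro divide_pos_pos prod_pos) auto
  have "ennreal (unit_ball_vol (real D) / (2 * 2 powr real D * M)) \<le> hausdorff (real D) B"
  proof (rule hausdorff_ge_mass[OF B(1), where \<delta> = 1])
    fix \<eta> :: real assume "0 < \<eta>"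
    define Q where "Q = Suc (nat \<lceil>Max ((\<lambda>j. \<rho> j / \<eta>) ` {..<D})\<rceil>)"
    have Q: "\<rho> j \<le> \<eta> * real Q" if "j < D" for j
    proof -
      have "\<rho> j / \<eta> \<le> Max ((\<lambda>j. \<rho> j / \<eta>) ` {..<D})" using that by (intro Max_ge) auto
      also have "\<dots> \<le> real Q" unfolding Q_def by linarith
      finally show ?thesis using \<open>0 < \<eta>\<close> by (simp add: field_simps)
    qed
    define g where "g k = x + (\<Sum>i<D. (real (k i) / (real Q * real D)) *\<^sub>R v i)" for k :: "nat \<Rightarrow> nat"
    have Q0: "0 < Q" by (simp add: Q_def)
    have "growth (real D) M \<eta> 1 (map_pmf g (grid_pmf D Q))"
      unfolding M_def
    proof (rule grid_growth[OF Q0 \<open>0 < \<eta>\<close>])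
      fix j assume j: "j < D"
      show "0 < \<rho> j / real D" using \<rho>[OF j] D by simp
      have "\<rho> j / real D \<le> \<rho> j / 1" using \<rho>[OF j] D by (intro divide_left_mono) auto
      then show "\<rho> j / real D \<le> \<eta> * real Q" using Q[OF j] by simp
    next
      fix k k' :: "nat \<Rightarrow> nat" and j assume j: "j < D" and eq: "\<And>i. j < i \<Longrightarrow> i < D \<Longrightarrow> k i = k' i"
      let ?a = "\<lambda>i. (real (k i) - real (k' i)) / (real Q * real D)"
      have "g k - g k' = (\<Sum>i<D. ?a i *\<^sub>R v i)"
        by (simp add: g_def sum_subtractf[symmetric] scaleR_diff_left[symmetric] diff_divide_distrib)
      also have "\<dots> = (\<Sum>i\<le>j. ?a i *\<^sub>R v i)"
        using j eq by (intro sum.mono_neutral_right) auto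
      finally have "\<rho> j * \<bar>?a j\<bar> \<le> dist (g k) (g k')" using v[OF j, of ?a] by (simp add: dist_norm)
      then show "\<rho> j / real D * \<bar>real (k j) - real (k' j)\<bar> / real Q \<le> dist (g k) (g k')"
        by (simp add: abs_mult mult.commute)
    qed
    moreover have "set_pmf (map_pmf g (grid_pmf D Q)) \<subseteq> B"
    proof
      fix y assume "y \<in> set_pmf (map_pmf g (grid_pmf D Q))"
      then obtain k where k: "y = g k" "\<forall>i<D. k i < Q" using grid_pmf_support[OF Q0] by auto
      have "(\<Sum>i<D. real (k i) / (real Q * real D)) \<le> (\<Sum>i<D. 1 / real D)"
        using k Q0 D by (intro sum_mono) (auto simp: field_simps)
      then have "(\<Sum>i<D. real (k i) / (real Q * real D)) \<le> 1" using D by simp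
      then show "y \<in> B" unfolding k(1) g_def by (intro B(2)) auto
    qed
    ultimately show "\<exists>q. set_pmf q \<subseteq> B \<and> growth (real D) M \<eta> 1 q" by blast
  qed (use D M0 in auto)
  moreover have "unit_ball_vol (real D) / (2 * 2 powr real D * M) = vol_const D * (\<Prod>j<D. \<rho> j)"
    using P0 D by (simp add: vol_const_def M_def prod_dividef power_mult_distrib)
  ultimately show ?thesis by metis
qed

lemma hausdorff_parallelotope_finite:
  fixes v :: "nat \<Rightarrow> 'a::real_normed_vector"
  assumes D: "0 < D"
  shows "hausdorff (real D) {x + (\<Sum>i<D. a i *\<^sub>R v i) | a. \<forall>i<D. 0 \<le> a i \<and> a i \<le> 1} < top"
    (is "hausdorff _ ?P < top")
proof -
  define L where "L = (\<Sum>i<D. norm (v i)) + 1"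
  have L: "0 < L" unfolding L_def by (intro add_nonneg_pos sum_nonneg) auto
  have "hausdorff (real D) ?P \<le> ennreal (unit_ball_vol (real D) * (L / 2) ^ D)"
    unfolding hausdorff_def
  proof (rule SUP_least)
    fix \<delta> :: real assume "\<delta> \<in> {0<..}"
    then have \<delta>: "0 < \<delta>" by simp
    define Q where "Q = Suc (nat \<lceil>L / \<delta>\<rceil>)"
    have LQ: "L / \<delta> \<le> real Q" unfolding Q_def by linarith
    have Q0: "0 < Q" by (simp add: Q_def)
    have Q: "0 < Q" "L / real Q \<le> \<delta>" using LQ \<delta> Q0 by (simp_all add: field_simps)
    define I where "I = PiE {..<D} (\<lambda>_. {..<Q})"
    define C where "C k = {x + (\<Sum>i<D. a i *\<^sub>R v i) | a. \<forall>i<D. real (k i) / Q \<le> a i \<and> a i \<le> (real (k i) + 1) / Q}"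
      for k :: "nat \<Rightarrow> nat"
    have diff: "norm (y - z) \<le> L / Q" if yz: "y \<in> C k" "z \<in> C k" for y z k
    proof -
      obtain a b where a: "y = x + (\<Sum>i<D. a i *\<^sub>R v i)" "\<forall>i<D. real (k i) / Q \<le> a i \<and> a i \<le> (real (k i) + 1) / Q"
        and b: "z = x + (\<Sum>i<D. b i *\<^sub>R v i)" "\<forall>i<D. real (k i) / Q \<le> b i \<and> b i \<le> (real (k i) + 1) / Q"
        using yz unfolding C_def by blast
      have "norm (y - z) = norm (\<Sum>i<D. (a i - b i) *\<^sub>R v i)"
        by (simp add: a(1) b(1) sum_subtractf scaleR_diff_left)
      also have "\<dots> \<le> (\<Sum>i<D. 1 / Q * norm (v i))"
      proof (rule sum_norm_le)
        fix i assume "i \<in> {..<D}"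
        then have "\<bar>a i - b i\<bar> \<le> 1 / Q" using a(2) b(2) by (fastforce simp: add_divide_distrib abs_le_iff)
        then show "norm ((a i - b i) *\<^sub>R v i) \<le> 1 / Q * norm (v i)"
          unfolding norm_scaleR by (rule mult_right_mono) simp
      qed
      also have "\<dots> = 1 / Q * (\<Sum>i<D. norm (v i))" by (rule sum_distrib_left[symmetric])
      also have "\<dots> \<le> L / Q" using Q(1) by (simp add: L_def divide_right_mono)
      finally show ?thesis .
    qed
    have diam: "diameter (C k) \<le> L / Q" for k
      using diff L Q by (intro diameter_le) auto
    have bdd: "bounded (C k)" for k
    proof (cases "C k = {}")
      case False
      then obtain z where "z \<in> C k" by blast
      then show ?thesis using diff[of z k] unfolding bounded_def dist_norm by blast
    qed simp
    have cov: "?P \<subseteq> (\<Union>k\<in>I. C k)"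
    proof
      fix y assume "y \<in> ?P"
      then obtain a where a: "y = x + (\<Sum>i<D. a i *\<^sub>R v i)" "\<forall>i<D. 0 \<le> a i \<and> a i \<le> 1" by blast
      define k where "k = restrict (\<lambda>i. if a i = 1 then Q - 1 else nat \<lfloor>a i * Q\<rfloor>) {..<D}"
      have "k \<in> I" unfolding I_def
      proof (rule PiE_I)
        fix i assume i: "i \<in> {..<D}"
        have "nat \<lfloor>a i * Q\<rfloor> < Q" if "a i \<noteq> 1"
        proof -
          have "a i < 1" using a(2) i that by force
          then have "a i * Q < Q" using Q by simp
          then show ?thesis using a(2) i Q by (auto simp: nat_less_iff floor_less_iff)
        qed
        then show "k i \<in> {..<Q}" using i Q by (auto simp: k_def)
      qed (simp add: k_def)
      moreover have "y \<in> C k" unfolding C_def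
      proof (intro CollectI exI conjI allI impI)
        fix i assume i: "i < D"
        have "real (nat \<lfloor>a i * Q\<rfloor>) = of_int \<lfloor>a i * Q\<rfloor>" using a(2) i by (intro of_nat_nat) simp
        then have "real (nat \<lfloor>a i * Q\<rfloor>) \<le> a i * Q \<and> a i * Q \<le> real (nat \<lfloor>a i * Q\<rfloor>) + 1" by linarith
        then have "real (k i) \<le> a i * Q \<and> a i * Q \<le> real (k i) + 1"
          using i Q by (auto simp: k_def of_nat_diff)
        then show "real (k i) / Q \<le> a i" "a i \<le> (real (k i) + 1) / Q" using Q by (auto simp: field_simps)
      qed (rule a(1))
      ultimately show "y \<in> (\<Union>k\<in>I. C k)" by blast
    qed
    have "hausdorff_content \<delta> (real D) ?P \<le> (\<Sum>k\<in>I. ennreal (unit_ball_vol (real D) * (diameter (C k) / 2) powr real D))"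
      by (rule hausdorff_content_finite_cover[OF _ cov])
         (use bdd diam Q \<delta> in \<open>auto simp: I_def intro!: finite_PiE intro: order_trans\<close>)
    also have "\<dots> \<le> (\<Sum>k\<in>I. ennreal (unit_ball_vol (real D) * (L / Q / 2) powr real D))"
      by (intro sum_mono ennreal_leI mult_left_mono powr_mono2 divide_right_mono diam)
         (auto intro: diameter_ge_0[OF bdd])
    also have "\<dots> = ennreal (real (Q ^ D) * (unit_ball_vol (real D) * (L / Q / 2) powr real D))"
      by (simp add: I_def card_PiE ennreal_mult' ennreal_of_nat_eq_real_of_nat)
    also have "real (Q ^ D) * (unit_ball_vol (real D) * (L / Q / 2) powr real D) = unit_ball_vol (real D) * (L / 2) ^ D"
      using L Q by (simp add: powr_realpow power_divide)
    finally show "hausdorff_content \<delta> (real D) ?P \<le> ennreal (unit_ball_vol (real D) * (L / 2) ^ D)" .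
  qed
  also have "\<dots> < top" by simp
  finally show ?thesis .
qed

lemma menger_curv_ge:
  fixes x :: "nat \<Rightarrow> 'a::real_inner"
  defines "v \<equiv> \<lambda>i. x (Suc i) - x 0"
  assumes \<rho>: "\<And>j. j \<le> m \<Longrightarrow> 0 < \<rho> j"
    and v: "\<And>j a. j \<le> m \<Longrightarrow> \<rho> j * \<bar>a j\<bar> \<le> norm (\<Sum>i\<le>j. a i *\<^sub>R v i)"
    and d: "\<And>i j. i \<le> m + 1 \<Longrightarrow> j \<le> m + 1 \<Longrightarrow> dist (x i) (x j) \<le> d"
  shows "vol_const (m + 1) * (\<Prod>j\<le>m. \<rho> j) / d ^ (m + 2) \<le> menger_curv m x"
proof -
  let ?X = "x ` {0..m + 1}"
  let ?P = "{x 0 + (\<Sum>i<m + 1. a i *\<^sub>R v i) | a. \<forall>i<m + 1. 0 \<le> a i \<and> a i \<le> 1}"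
  have hull: "convex hull ?X \<subseteq> ?P"
  proof (rule hull_minimal)
    show "?X \<subseteq> ?P"
    proof
      fix y assume "y \<in> ?X"
      then obtain i where i: "i \<le> m + 1" "y = x i" by auto
      have "y = x 0 + (\<Sum>k<m + 1. (if Suc k = i then 1 else 0) *\<^sub>R v k)"
      proof (cases i)
        case (Suc k)
        have "(\<Sum>k<m + 1. (if Suc k = i then 1 else 0) *\<^sub>R v k) = (\<Sum>j<m + 1. if j = k then v k else 0)"
          by (intro sum.cong) (auto simp: Suc)
        then show ?thesis using i Suc by (simp add: v_def)
      qed (use i in simp)
      then show "y \<in> ?P" by (intro CollectI exI[of _ "\<lambda>k. if Suc k = i then 1 else 0"]) auto
    qed
    show "convex ?P"
    proof (rule convexI)
      fix y z and s t :: real assume y: "y \<in> ?P" and z: "z \<in> ?P" and st: "0 \<le> s" "0 \<le> t" "s + t = 1"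
      obtain a where a: "y = x 0 + (\<Sum>i<m + 1. a i *\<^sub>R v i)" "\<forall>i<m + 1. 0 \<le> a i \<and> a i \<le> 1" using y by blast
      obtain b where b: "z = x 0 + (\<Sum>i<m + 1. b i *\<^sub>R v i)" "\<forall>i<m + 1. 0 \<le> b i \<and> b i \<le> 1" using z by blast
      show "s *\<^sub>R y + t *\<^sub>R z \<in> ?P"
      proof (intro CollectI exI conjI allI impI)
        have "s *\<^sub>R y + t *\<^sub>R z = (s + t) *\<^sub>R x 0 + (\<Sum>i<m + 1. (s * a i + t * b i) *\<^sub>R v i)"
          unfolding a(1) b(1) scaleR_add_right scaleR_sum_right scaleR_add_left sum.distrib
          by (simp add: algebra_simps)
        then show "s *\<^sub>R y + t *\<^sub>R z = x 0 + (\<Sum>i<m + 1. (s * a i + t * b i) *\<^sub>R v i)" by (simp add: st)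
        fix i assume i: "i < m + 1"
        show "0 \<le> s * a i + t * b i" using a(2) b(2) i st by simp
        have "s * a i \<le> s * 1" "t * b i \<le> t * 1" using a(2) b(2) i st by (auto intro!: mult_left_le)
        then show "s * a i + t * b i \<le> 1" using st by simp
      qed
    qed
  qed
  have fin: "hausdorff (real (m + 1)) (convex hull ?X) < top"
    using hausdorff_mono[OF hull] hausdorff_parallelotope_finite[of "m + 1" "x 0" v] by (auto intro: le_less_trans)
  have "ennreal (vol_const (m + 1) * (\<Prod>j<m + 1. \<rho> j)) \<le> hausdorff (real (m + 1)) (convex hull ?X)"
  proof (rule hausdorff_simplex_ge[where x = "x 0" and v = v])
    fix a :: "nat \<Rightarrow> real" assume a: "\<And>i. i < m + 1 \<Longrightarrow> 0 \<le> a i" "sum a {..<m + 1} \<le> 1"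
    define b where "b i = (case i of 0 \<Rightarrow> 1 - sum a {..<m + 1} | Suc k \<Rightarrow> a k)" for i
    have split: "(\<Sum>i\<le>m + 1. f i) = f 0 + (\<Sum>i<m + 1. f (Suc i))" for f :: "nat \<Rightarrow> 'b::comm_monoid_add"
      using sum.atMost_Suc_shift[of f m] by (simp add: lessThan_Suc_atMost del: sum.atMost_Suc)
    have "(\<Sum>i\<le>m + 1. b i *\<^sub>R x i) \<in> convex hull ?X"
    proof (rule convex_sum)
      have "sum b {..m + 1} = b 0 + (\<Sum>i<m + 1. b (Suc i))" by (rule split)
      then show "sum b {..m + 1} = 1" by (simp add: b_def)
      show "0 \<le> b i" if "i \<in> {..m + 1}" for i using that a by (auto simp: b_def split: nat.splits)
      show "x i \<in> convex hull ?X" if "i \<in> {..m + 1}" for i using that by (intro hull_inc) auto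
    qed (auto simp: convex_convex_hull)
    moreover have "(\<Sum>i\<le>m + 1. b i *\<^sub>R x i) = x 0 + (\<Sum>i<m + 1. a i *\<^sub>R v i)"
    proof -
      have "(\<Sum>i\<le>m + 1. b i *\<^sub>R x i) = b 0 *\<^sub>R x 0 + (\<Sum>i<m + 1. b (Suc i) *\<^sub>R x (Suc i))" by (rule split)
      also have "\<dots> = x 0 + (\<Sum>i<m + 1. a i *\<^sub>R v i)"
        by (simp only: b_def nat.case v_def scaleR_diff_right sum_subtractf scaleR_diff_left scaleR_sum_left[symmetric]) simp
      finally show ?thesis .
    qed
    ultimately show "x 0 + (\<Sum>i<m + 1. a i *\<^sub>R v i) \<in> convex hull ?X" by simp
  qed (use \<rho> v in \<open>auto intro!: finite_imp_compact_convex_hull\<close>)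
  moreover obtain h where h: "0 \<le> h" "hausdorff (real (m + 1)) (convex hull ?X) = ennreal h"
    using fin by (cases "hausdorff (real (m + 1)) (convex hull ?X)") auto
  ultimately have num: "vol_const (m + 1) * (\<Prod>j\<le>m. \<rho> j) \<le> enn2real (hausdorff (real (m + 1)) (convex hull ?X))"
    by (simp add: lessThan_Suc_atMost)
  have "0 < norm (v 0)" using v[of 0 "\<lambda>_. 1"] \<rho>[of 0] by (simp del: zero_less_norm_iff)
  then have "0 < dist (x 1) (x 0)" by (simp add: v_def dist_norm del: zero_less_norm_iff)
  also have "dist (x 1) (x 0) \<le> diameter ?X"
    by (rule diameter_bounded_bound) (auto intro!: finite_imp_bounded)
  finally have diam0: "0 < diameter ?X" .
  have "0 \<le> d" using d[of 0 0] by simp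
  have diam: "diameter ?X \<le> d"
    using d \<open>0 \<le> d\<close> by (intro diameter_le) (auto simp: dist_norm)
  have "vol_const (m + 1) * (\<Prod>j\<le>m. \<rho> j) / d ^ (m + 2) \<le> vol_const (m + 1) * (\<Prod>j\<le>m. \<rho> j) / diameter ?X ^ (m + 2)"
    using diam diam0 \<rho> vol_const_pos[of "m + 1"]
    by (intro divide_left_mono power_mono mult_nonneg_nonneg prod_nonneg mult_pos_pos zero_less_power) (auto intro: less_imp_le)
  also have "\<dots> \<le> menger_curv m x"
    unfolding menger_curv_def using num diam0 by (intro divide_right_mono) auto
  finally show ?thesis .
qed

section \<open>Frostman measures on products\<close>

lemma growth_mono_scale: "growth s M \<eta> \<delta> q \<Longrightarrow> \<eta> \<le> \<eta>' \<Longrightarrow> \<delta>' \<le> \<delta> \<Longrightarrow> growth s M \<eta>' \<delta>' q"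
  unfolding growth_def by (meson order_trans)

lemma prod_growth:
  fixes p :: "'i \<Rightarrow> 'a::real_inner pmf" and \<sigma> :: "nat \<Rightarrow> 'i"
  assumes A: "finite A" "inj_on \<sigma> {..<l}" "\<sigma> ` {..<l} \<subseteq> A"
    and p: "\<And>i. i < l \<Longrightarrow> growth s M \<eta> \<delta> (p (\<sigma> i))" and "0 < \<eta>" "0 \<le> M"
  shows "growth (s * real l) (M ^ l) \<eta> \<delta> (map_pmf (\<lambda>f. mk l (f \<circ> \<sigma>)) (Pi_pmf A dflt p))"
  unfolding growth_def
proof (intro allI impI)
  fix C :: "'a finseq set" and d :: real
  assume d: "\<eta> \<le> d" "d \<le> \<delta>" and C: "\<forall>x\<in>C. \<forall>y\<in>C. dist x y \<le> d"
  define B where "B k = {y. \<forall>i<l. \<sigma> i = k \<longrightarrow> y \<in> (\<lambda>t. coord t i) ` C}" for k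
  have B: "measure_pmf.prob (p (\<sigma> i)) (B (\<sigma> i)) \<le> M * d powr s" if i: "i < l" for i
  proof -
    have "B (\<sigma> i) \<subseteq> (\<lambda>t. coord t i) ` C" using i by (auto simp: B_def)
    then have "measure_pmf.prob (p (\<sigma> i)) (B (\<sigma> i)) \<le> measure_pmf.prob (p (\<sigma> i)) ((\<lambda>t. coord t i) ` C)"
      by (intro measure_pmf.finite_measure_mono) auto
    also have "\<dots> \<le> M * d powr s"
    proof (rule p[OF i, unfolded growth_def, rule_format, OF d])
      fix x y assume "x \<in> (\<lambda>t. coord t i) ` C" "y \<in> (\<lambda>t. coord t i) ` C"
      then obtain u w where "u \<in> C" "w \<in> C" "x = coord u i" "y = coord w i" by auto
      then show "dist x y \<le> d" using C dist_coord_le[of u i w] by (auto intro: order_trans)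
    qed
    finally show ?thesis .
  qed
  have "measure_pmf.prob (map_pmf (\<lambda>f. mk l (f \<circ> \<sigma>)) (Pi_pmf A dflt p)) C
      \<le> measure_pmf.prob (Pi_pmf A dflt p) (Pi A B)"
    unfolding measure_map_pmf
  proof (intro measure_pmf.finite_measure_mono subsetI)
    fix f assume "f \<in> (\<lambda>f. mk l (f \<circ> \<sigma>)) -` C"
    then have f: "mk l (f \<circ> \<sigma>) \<in> C" by simp
    show "f \<in> Pi A B"
    proof (rule Pi_I, unfold B_def, safe)
      fix i assume "i < l"
      then have "f (\<sigma> i) = coord (mk l (f \<circ> \<sigma>)) i" by simp
      then show "f (\<sigma> i) \<in> (\<lambda>t. coord t i) ` C" using f by (rule image_eqI)
    qed
  qed simp
  also have "\<dots> = (\<Prod>k\<in>A. measure_pmf.prob (p k) (B k))" by (rule measure_Pi_pmf_Pi[OF A(1)])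
  also have "\<dots> = (\<Prod>k\<in>A - \<sigma> ` {..<l}. measure_pmf.prob (p k) (B k)) * (\<Prod>k\<in>\<sigma> ` {..<l}. measure_pmf.prob (p k) (B k))"
    by (rule prod.subset_diff[OF A(3,1)])
  also have "\<dots> \<le> 1 * (\<Prod>k\<in>\<sigma> ` {..<l}. measure_pmf.prob (p k) (B k))"
    by (intro mult_right_mono prod_le_1 prod_nonneg) auto
  also have "\<dots> = (\<Prod>i<l. measure_pmf.prob (p (\<sigma> i)) (B (\<sigma> i)))"
    using A(2) by (simp add: prod.reindex)
  also have "\<dots> \<le> (\<Prod>i<l. M * d powr s)" by (intro prod_mono) (auto intro: B)
  also have "\<dots> = M ^ l * d powr (s * real l)"
    using d \<open>0 < \<eta>\<close> by (simp add: power_mult_distrib powr_powr[symmetric] powr_realpow)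
  finally show "measure_pmf.prob (map_pmf (\<lambda>f. mk l (f \<circ> \<sigma>)) (Pi_pmf A dflt p)) C
      \<le> M ^ l * d powr (s * real l)" .
qed

lemma Pi_pmf_supportD:
  assumes "finite A" "f \<in> set_pmf (Pi_pmf A dflt p)" "k \<in> A"
  shows "f k \<in> set_pmf (p k)"
  using assms by (auto simp: set_Pi_pmf PiE_dflt_def)

lemma tight_weights:
  fixes cell :: "nat \<Rightarrow> 'a \<Rightarrow> 'c" and cap :: "nat \<Rightarrow> real"
  assumes "finite P" "finite J" "J \<noteq> {}" "\<And>j. j \<in> J \<Longrightarrow> 0 \<le> cap j"
  shows "\<exists>w. (\<forall>x. 0 \<le> w x) \<and> (\<forall>j\<in>J. \<forall>c. (\<Sum>x | x \<in> P \<and> cell j x = c. w x) \<le> cap j) \<and>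
    (\<forall>x\<in>P. \<exists>j\<in>J. (\<Sum>y | y \<in> P \<and> cell j y = cell j x. w y) = cap j)"
  using assms(1)
proof (induction P)
  case empty
  then show ?case using assms by (intro exI[of _ "\<lambda>_. 0"]) auto
next
  case (insert x P)
  then obtain w where w: "\<And>x. 0 \<le> w x" "\<And>j c. j \<in> J \<Longrightarrow> (\<Sum>x | x \<in> P \<and> cell j x = c. w x) \<le> cap j"
    "\<And>x. x \<in> P \<Longrightarrow> \<exists>j\<in>J. (\<Sum>y | y \<in> P \<and> cell j y = cell j x. w y) = cap j"
    using insert.IH by blast
  define gap where "gap j = cap j - (\<Sum>y | y \<in> P \<and> cell j y = cell j x. w y)" for j
  define r where "r = Min (gap ` J)"
  have r_in: "r \<in> gap ` J" unfolding r_def using assms by (intro Min_in) auto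
  have r_le: "r \<le> gap j" if "j \<in> J" for j unfolding r_def using assms that by (intro Min_le) auto
  have r0: "0 \<le> r" using r_in w(2) by (auto simp: gap_def)
  let ?w = "w(x := r)"
  have S: "(\<Sum>y | y \<in> insert x P \<and> cell j y = c. ?w y)
      = (\<Sum>y | y \<in> P \<and> cell j y = c. w y) + (if cell j x = c then r else 0)" for j c
  proof -
    have eqP: "(\<Sum>y | y \<in> P \<and> cell j y = c. ?w y) = (\<Sum>y | y \<in> P \<and> cell j y = c. w y)"
      using insert(2) by (intro sum.cong) auto
    show ?thesis
    proof (cases "cell j x = c")
      case True
      then have "{y. y \<in> insert x P \<and> cell j y = c} = insert x {y. y \<in> P \<and> cell j y = c}" by auto
      then show ?thesis using insert(1,2) True eqP by simp
    next
      case False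
      then have "{y. y \<in> insert x P \<and> cell j y = c} = {y. y \<in> P \<and> cell j y = c}" by auto
      then show ?thesis using False eqP by simp
    qed
  qed
  have cap: "(\<Sum>y | y \<in> insert x P \<and> cell j y = c. ?w y) \<le> cap j" if "j \<in> J" for j c
    unfolding S using w(2)[OF that] r_le[OF that] by (auto simp: gap_def)
  have tight: "\<exists>j\<in>J. (\<Sum>y | y \<in> insert x P \<and> cell j y = cell j z. ?w y) = cap j" if z: "z \<in> insert x P" for z
  proof (cases "z = x")
    case True
    obtain j where "j \<in> J" "r = gap j" using r_in by auto
    then show ?thesis unfolding S by (intro bexI[of _ j]) (auto simp: True gap_def)
  next
    case False
    then obtain j where j: "j \<in> J" "(\<Sum>y | y \<in> P \<and> cell j y = cell j z. w y) = cap j"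
      using w(3)[of z] z by auto
    have "(\<Sum>y | y \<in> insert x P \<and> cell j y = cell j z. ?w y) \<ge> cap j"
      unfolding S using j(2) r0 by simp
    then show ?thesis using cap[OF j(1), of "cell j z"] j(1) by (intro bexI[of _ j]) auto
  qed
  show ?case using w(1) r0 cap tight by (intro exI[of _ ?w]) auto
qed

lemma norm_le_sum_coord:
  assumes "x \<in> R_space n"
  shows "norm x \<le> (\<Sum>i<n. \<bar>coord x i\<bar>)"
proof -
  have coord_sum: "coord (\<Sum>i<k. coord x i *\<^sub>R single i (1::real)) j = (if j < k then coord x j else 0)" for k j
    by (induction k) (auto simp: less_Suc_eq)
  have "x = (\<Sum>i<n. coord x i *\<^sub>R single i (1::real))"
    by (rule finseq_eqI) (use assms in \<open>auto simp: coord_sum mem_R_space\<close>)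
  then have "norm x \<le> (\<Sum>i<n. norm (coord x i *\<^sub>R single i (1::real)))" by (metis norm_sum)
  then show ?thesis by simp
qed

definition cell :: "nat \<Rightarrow> nat \<Rightarrow> real finseq \<Rightarrow> nat \<Rightarrow> int" where
  "cell n k x i = (if i < n then \<lfloor>2 ^ k * coord x i\<rfloor> else 0)"

lemma cell_coarser:
  assumes "j \<le> k" "cell n k x = cell n k y"
  shows "cell n j x = cell n j y"
proof
  fix i
  have *: "\<lfloor>2 ^ j * coord z i\<rfloor> = \<lfloor>2 ^ k * coord z i\<rfloor> div 2 ^ (k - j)" for z :: "real finseq"
  proof -
    have "2 ^ j * coord z i = 2 ^ k * coord z i / real_of_int (2 ^ (k - j))"
      using assms(1) power_add[of "2::real" j "k - j"] by simp
    then show ?thesis using floor_divide_real_eq_div[of "2 ^ (k - j)" "2 ^ k * coord z i"] by simp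
  qed
  show "cell n j x i = cell n j y i"
    using fun_cong[OF assms(2), of i] by (auto simp: cell_def *)
qed

lemma cell_dist:
  assumes "x \<in> R_space n" "y \<in> R_space n" "cell n k x = cell n k y"
  shows "norm (x - y) \<le> real n / 2 ^ k"
proof -
  have "x - y \<in> R_space n" using assms by (simp add: subspace_diff[OF subspace_R_space])
  then have "norm (x - y) \<le> (\<Sum>i<n. \<bar>coord (x - y) i\<bar>)" by (rule norm_le_sum_coord)
  also have "\<dots> \<le> (\<Sum>i<n. 1 / 2 ^ k)"
  proof (rule sum_mono)
    fix i assume "i \<in> {..<n}"
    then have "\<lfloor>2 ^ k * coord x i\<rfloor> = \<lfloor>2 ^ k * coord y i\<rfloor>"
      using fun_cong[OF assms(3), of i] by (simp add: cell_def)
    then have "\<bar>2 ^ k * coord x i - 2 ^ k * coord y i\<bar> \<le> 1" by linarith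
    then have "2 ^ k * \<bar>coord x i - coord y i\<bar> \<le> 1"
      by (simp add: right_diff_distrib[symmetric] abs_mult)
    then show "\<bar>coord (x - y) i\<bar> \<le> 1 / 2 ^ k" by (simp add: field_simps)
  qed
  finally show ?thesis by simp
qed

lemma card_cells_le:
  assumes F: "finite F" and d: "\<forall>x\<in>F. \<forall>y\<in>F. dist x y \<le> 1 / 2 ^ k"
  shows "card (cell n k ` F) \<le> 2 ^ n"
proof (cases "F = {}")
  case False
  define lo where "lo i = Min ((\<lambda>x. \<lfloor>2 ^ k * coord x i\<rfloor>) ` F)" for i
  have "cell n k ` F \<subseteq> PiE_dflt {..<n} 0 (\<lambda>i. {lo i, lo i + 1})"
  proof
    fix c assume "c \<in> cell n k ` F"
    then obtain x where x: "x \<in> F" "c = cell n k x" by auto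
    have "\<lfloor>2 ^ k * coord x i\<rfloor> \<in> {lo i, lo i + 1}" for i
    proof -
      have "lo i \<in> (\<lambda>x. \<lfloor>2 ^ k * coord x i\<rfloor>) ` F" unfolding lo_def using F False by (intro Min_in) auto
      then obtain y where y: "y \<in> F" "lo i = \<lfloor>2 ^ k * coord y i\<rfloor>" by auto
      have le: "lo i \<le> \<lfloor>2 ^ k * coord x i\<rfloor>" unfolding lo_def using F x by (intro Min_le) auto
      have "dist (coord x i) (coord y i) \<le> 1 / 2 ^ k" using d x y dist_coord_le[of x i y] by fastforce
      then have "2 ^ k * \<bar>coord x i - coord y i\<bar> \<le> 1" by (simp add: dist_real_def field_simps)
      then have "\<bar>2 ^ k * coord x i - 2 ^ k * coord y i\<bar> \<le> 1"
        by (simp add: right_diff_distrib[symmetric] abs_mult)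
      then have "\<lfloor>2 ^ k * coord x i\<rfloor> \<le> lo i + 1" unfolding y(2) by linarith
      then show ?thesis using le by auto
    qed
    then show "c \<in> PiE_dflt {..<n} 0 (\<lambda>i. {lo i, lo i + 1})"
      by (auto simp: PiE_dflt_def x(2) cell_def)
  qed
  then have "card (cell n k ` F) \<le> card (PiE_dflt {..<n} 0 (\<lambda>i. {lo i, lo i + 1}))"
    by (intro card_mono finite_PiE_dflt) auto
  also have "\<dots> = 2 ^ n" by (subst card_PiE_dflt) (auto simp: numeral_2_eq_2)
  finally show ?thesis .
qed simp

lemma finite_cells:
  assumes "bounded U"
  shows "finite (cell n k ` U)"
proof -
  obtain R where R: "\<And>x. x \<in> U \<Longrightarrow> norm x \<le> R" using assms by (auto simp: bounded_iff)
  have "cell n k ` U \<subseteq> PiE_dflt {..<n} 0 (\<lambda>i. {\<lfloor>- (2 ^ k * R)\<rfloor>..\<lfloor>2 ^ k * R\<rfloor>})"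
  proof
    fix c assume "c \<in> cell n k ` U"
    then obtain x where x: "x \<in> U" "c = cell n k x" by auto
    have "\<bar>coord x i\<bar> \<le> R" for i using abs_coord_le[of x i] R[OF x(1)] by linarith
    then have "2 ^ k * \<bar>coord x i\<bar> \<le> 2 ^ k * R" for i by (intro mult_left_mono) auto
    then have "\<bar>2 ^ k * coord x i\<bar> \<le> 2 ^ k * R" for i by (simp add: abs_mult)
    then have "- (2 ^ k * R) \<le> 2 ^ k * coord x i" "2 ^ k * coord x i \<le> 2 ^ k * R" for i
      by (simp_all add: abs_le_iff minus_le_iff)
    then show "c \<in> PiE_dflt {..<n} 0 (\<lambda>i. {\<lfloor>- (2 ^ k * R)\<rfloor>..\<lfloor>2 ^ k * R\<rfloor>})"
      by (auto simp: PiE_dflt_def x(2) cell_def intro!: floor_mono)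
  qed
  then show ?thesis by (rule finite_subset) (intro finite_PiE_dflt; simp)
qed

lemma pmf_of_weights:
  fixes w :: "'a \<Rightarrow> real"
  assumes "finite P" "\<And>x. 0 \<le> w x" "0 < sum w P"
  obtains q where "set_pmf q \<subseteq> P" "\<And>C. measure_pmf.prob q C = sum w (P \<inter> C) / sum w P"
proof -
  define f where "f x = (if x \<in> P then w x / sum w P else 0)" for x
  have f0: "0 \<le> f x" for x using assms by (simp add: f_def)
  have "(\<integral>\<^sup>+x. ennreal (f x) \<partial>count_space UNIV) = (\<Sum>x\<in>P. ennreal (f x))"
    using assms(1) by (subst nn_integral_count_space'[of P]) (auto simp: f_def)
  also have "\<dots> = ennreal (\<Sum>x\<in>P. f x)" using f0 by (rule sum_ennreal)
  also have "(\<Sum>x\<in>P. f x) = 1" using assms by (simp add: f_def sum_divide_distrib[symmetric])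
  finally have one: "(\<integral>\<^sup>+x. ennreal (f x) \<partial>count_space UNIV) = 1" by simp
  define q where "q = embed_pmf f"
  have pq: "pmf q x = f x" for x unfolding q_def by (rule pmf_embed_pmf[OF f0 one])
  have sub: "set_pmf q \<subseteq> P" by (auto simp: set_pmf_eq pq f_def split: if_splits)
  moreover have "measure_pmf.prob q C = sum w (P \<inter> C) / sum w P" for C
  proof -
    have "measure_pmf.prob q C = measure_pmf.prob q (P \<inter> C)"
      by (rule measure_pmf.finite_measure_eq_AE) (use sub in \<open>auto simp: AE_measure_pmf_iff\<close>)
    also have "\<dots> = (\<Sum>x\<in>P \<inter> C. f x)" using assms(1) by (simp add: measure_measure_pmf_finite pq)
    also have "\<dots> = sum w (P \<inter> C) / sum w P" by (simp add: f_def sum_divide_distrib)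
    finally show ?thesis .
  qed
  ultimately show thesis by (rule that)
qed

definition frostman_const :: "nat \<Rightarrow> nat \<Rightarrow> real" where
  "frostman_const n m = 2 ^ (n + m) * (unit_ball_vol (real m) * (real n / 2) ^ m)"

text \<open>Frostman's lemma at finite resolution. The greedy weights saturate, for each point, some
  dyadic cell containing it; the largest saturated cells are disjoint and cover \<open>U\<close>.\<close>

lemma frostman:
  assumes U: "compact U" "U \<subseteq> R_space n" and "0 < n" "0 < m" and a: "0 < a" "ennreal a < hausdorff (real m) U"
  obtains \<delta> where "0 < \<delta>"
    "\<And>\<eta>. 0 < \<eta> \<Longrightarrow> \<exists>q. set_pmf q \<subseteq> U \<and> growth (real m) (frostman_const n m / a) \<eta> \<delta> q"
proof -
  obtain \<delta>0 where \<delta>0: "0 < \<delta>0" "ennreal a < hausdorff_content \<delta>0 (real m) U"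
    using a(2) unfolding hausdorff_def less_SUP_iff by auto
  obtain j0 :: nat where "(1/2) ^ j0 < \<delta>0 / real n"
    using real_arch_pow_inv[of "\<delta>0 / real n" "1/2"] \<delta>0(1) assms(3) by auto
  then have j0: "real n / 2 ^ j0 \<le> \<delta>0" using assms(3) by (simp add: field_simps)
  have main: "\<exists>q. set_pmf q \<subseteq> U \<and> growth (real m) (frostman_const n m / a) \<eta> (1 / 2 ^ j0) q" if \<eta>: "0 < \<eta>" for \<eta>
  proof -
    obtain k0 :: nat where "(1/2) ^ k0 < \<eta>" using real_arch_pow_inv[of \<eta> "1/2"] \<eta> by auto
    define k where "k = max k0 j0"
    have "(1/2::real) ^ k \<le> (1/2) ^ k0" by (rule power_decreasing) (auto simp: k_def)
    then have k: "1 / 2 ^ k \<le> \<eta>" "j0 \<le> k" using \<open>(1/2) ^ k0 < \<eta>\<close> by (auto simp: k_def power_divide)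
    obtain P where P: "P \<subseteq> U" "finite P" "cell n k ` U = cell n k ` P"
      using finite_subset_image[OF finite_cells[OF compact_imp_bounded[OF U(1)], of n k] subset_refl] by metis
    define J where "J = {j0..k}"
    define cap :: "nat \<Rightarrow> real" where "cap j = (1 / 2 ^ j) ^ m" for j
    have cap0: "0 < cap j" for j by (simp add: cap_def)
    have "\<exists>w. (\<forall>x. 0 \<le> w x) \<and> (\<forall>j\<in>J. \<forall>c. (\<Sum>x | x \<in> P \<and> cell n j x = c. w x) \<le> cap j) \<and>
        (\<forall>x\<in>P. \<exists>j\<in>J. (\<Sum>y | y \<in> P \<and> cell n j y = cell n j x. w y) = cap j)"
      by (rule tight_weights[OF P(2)]) (use k in \<open>auto simp: J_def cap_def\<close>)
    then obtain w where w': "(\<forall>x. 0 \<le> w x) \<and> (\<forall>j\<in>J. \<forall>c. (\<Sum>x | x \<in> P \<and> cell n j x = c. w x) \<le> cap j) \<and>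
        (\<forall>x\<in>P. \<exists>j\<in>J. (\<Sum>y | y \<in> P \<and> cell n j y = cell n j x. w y) = cap j)"
      by (rule exE)
    note w = w'[THEN conjunct1, rule_format] w'[THEN conjunct2, THEN conjunct1, rule_format]
      w'[THEN conjunct2, THEN conjunct2, rule_format]
    let ?tight = "\<lambda>j x. j \<in> J \<and> (\<Sum>y | y \<in> P \<and> cell n j y = cell n j x. w y) = cap j"
    define lev where "lev x = (LEAST j. ?tight j x)" for x
    have lev: "?tight (lev x) x" if xP: "x \<in> P" for x
    proof -
      obtain j where "?tight j x" using w(3)[OF xP] by (rule bexE) simp
      then show ?thesis unfolding lev_def by (rule LeastI[of "\<lambda>j. ?tight j x"])
    qed
    have lev_le: "lev x \<le> j" if "?tight j x" for x j
      unfolding lev_def by (rule Least_le[of "\<lambda>j. ?tight j x"]) (rule that)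
    define T where "T = (\<lambda>x. (lev x, cell n (lev x) x)) ` P"
    define PT where "PT = (\<lambda>(j, c). {y. y \<in> P \<and> cell n j y = c})"
    define UT where "UT = (\<lambda>(j, c). {y. y \<in> U \<and> cell n j y = c})"
    have finT: "finite T" unfolding T_def using P(2) by simp
    have T: "j \<in> J" "sum w (PT (j, c)) = cap j" if jc: "(j, c) \<in> T" for j c
    proof -
      obtain x where "x \<in> P" "j = lev x" "c = cell n (lev x) x" using jc unfolding T_def by blast
      then show "j \<in> J" "sum w (PT (j, c)) = cap j" using lev[of x] by (auto simp: PT_def)
    qed
    have disj: "t = t'" if tt: "t \<in> T" "t' \<in> T" "y \<in> PT t" "y \<in> PT t'" "fst t \<le> fst t'" for t t' y
    proof -
      obtain x x' where x: "x \<in> P" "t = (lev x, cell n (lev x) x)" "x' \<in> P" "t' = (lev x', cell n (lev x') x')"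
        using tt(1,2) unfolding T_def by blast
      have c: "cell n (lev x) y = cell n (lev x) x" "cell n (lev x') y = cell n (lev x') x'" "lev x \<le> lev x'"
        using tt x by (auto simp: PT_def)
      have same: "cell n (lev x) x' = cell n (lev x) x" using cell_coarser[OF c(3,2)] c(1) by simp
      have "?tight (lev x) x'" using lev[OF x(1)] same by simp
      then have "lev x' = lev x" using lev_le[of "lev x" x'] c(3) by simp
      then show ?thesis using x c same by simp
    qed
    define w0 where "w0 = unit_ball_vol (real m) * (real n / 2) ^ m"
    have w0: "0 < w0" using assms(3) by (simp add: w0_def)
    have cover: "U \<subseteq> (\<Union>t\<in>T. UT t)"
    proof
      fix y assume y: "y \<in> U"
      then obtain x where x: "x \<in> P" "cell n k y = cell n k x" using P(3) by (metis imageE imageI)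
      have "lev x \<le> k" using lev[OF x(1)] by (simp add: J_def)
      then have "cell n (lev x) y = cell n (lev x) x" using cell_coarser x(2) by blast
      then have "y \<in> UT (lev x, cell n (lev x) x)" using y by (simp add: UT_def)
      then show "y \<in> (\<Union>t\<in>T. UT t)" using x(1) unfolding T_def by blast
    qed
    have diamT: "diameter (UT (j, c)) \<le> real n / 2 ^ j" for j c
      by (rule diameter_le) (use U(2) in \<open>auto simp: UT_def intro!: cell_dist\<close>)
    have bddT: "bounded (UT t)" for t
      using compact_imp_bounded[OF U(1)] by (rule bounded_subset) (auto simp: UT_def)
    have "hausdorff_content \<delta>0 (real m) U \<le> (\<Sum>t\<in>T. ennreal (unit_ball_vol (real m) * (diameter (UT t) / 2) powr real m))"
    proof (rule hausdorff_content_finite_cover[OF finT cover])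
      fix t assume "t \<in> T"
      obtain j c where t: "t = (j, c)" by (cases t)
      have "j0 \<le> j" using T(1) \<open>t \<in> T\<close> t by (auto simp: J_def)
      then have "real n / 2 ^ j \<le> real n / 2 ^ j0" by (intro divide_left_mono power_increasing) auto
      then have "diameter (UT t) \<le> \<delta>0" unfolding t using diamT[of j c] j0 by linarith
      then show "bounded (UT t) \<and> diameter (UT t) \<le> \<delta>0" using bddT by simp
    qed (use \<delta>0 in simp)
    also have "\<dots> \<le> (\<Sum>t\<in>T. ennreal (w0 * cap (fst t)))"
    proof (intro sum_mono ennreal_leI)
      fix t assume "t \<in> T"
      obtain j c where t: "t = (j, c)" by (cases t)
      have "(diameter (UT t) / 2) powr real m \<le> (real n / 2 ^ j / 2) powr real m"
        unfolding t by (intro powr_mono2 divide_right_mono diamT) (auto intro: diameter_ge_0 bddT)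
      also have "\<dots> = (real n / 2) ^ m * cap j"
        using assms(3) by (simp add: powr_realpow cap_def power_mult_distrib[symmetric] mult.commute)
      finally show "unit_ball_vol (real m) * (diameter (UT t) / 2) powr real m \<le> w0 * cap (fst t)"
        by (simp add: w0_def t mult_left_mono mult.assoc)
    qed
    also have "\<dots> = ennreal (w0 * (\<Sum>t\<in>T. cap (fst t)))"
      using w0 cap0 by (subst sum_ennreal) (auto simp: sum_distrib_left intro: less_imp_le)
    also have "(\<Sum>t\<in>T. cap (fst t)) = (\<Sum>t\<in>T. sum w (PT t))"
      by (intro sum.cong) (auto simp: T)
    also have "\<dots> = sum w (\<Union>t\<in>T. PT t)"
    proof (rule sum.UNION_disjoint[symmetric, OF finT])
      show "\<forall>t\<in>T. finite (PT t)" using P(2) by (auto simp: PT_def)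
      show "\<forall>t\<in>T. \<forall>t'\<in>T. t \<noteq> t' \<longrightarrow> PT t \<inter> PT t' = {}"
      proof (intro ballI impI, rule ccontr)
        fix t t' assume tt: "t \<in> T" "t' \<in> T" "t \<noteq> t'" "PT t \<inter> PT t' \<noteq> {}"
        then obtain y where "y \<in> PT t" "y \<in> PT t'" by blast
        then show False using disj[of t t' y] disj[of t' t y] tt by (metis linear)
      qed
    qed
    also have "w0 * sum w (\<Union>t\<in>T. PT t) \<le> w0 * sum w P"
      using P(2) w0 w(1) by (intro mult_left_mono sum_mono2) (auto simp: PT_def)
    finally have "ennreal a < ennreal (w0 * sum w P)" using \<delta>0(2) by (auto intro: ennreal_leI less_le_trans)
    then have aW: "a < w0 * sum w P" using a(1) by (simp add: ennreal_less_iff)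
    have W: "0 < sum w P" using aW a(1) w0 by (metis less_trans zero_less_mult_pos)
    obtain q where q: "set_pmf q \<subseteq> P" "\<And>C. measure_pmf.prob q C = sum w (P \<inter> C) / sum w P"
      using pmf_of_weights[OF P(2) w(1) W] by metis
    have "growth (real m) (frostman_const n m / a) \<eta> (1 / 2 ^ j0) q" unfolding growth_def
    proof (intro allI impI)
      fix C :: "real finseq set" and d :: real
      assume d: "\<eta> \<le> d" "d \<le> 1 / 2 ^ j0" and C: "\<forall>x\<in>C. \<forall>y\<in>C. dist x y \<le> d"
      define j where "j = Max {j\<in>J. d \<le> 1 / 2 ^ j}"
      have "j \<in> {j\<in>J. d \<le> 1 / 2 ^ j}" unfolding j_def
        by (rule Max_in) (use d k in \<open>auto simp: J_def\<close>)
      then have j: "j \<in> J" "d \<le> 1 / 2 ^ j" by auto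
      have "1 / 2 ^ j \<le> 2 * d"
      proof (cases "j = k")
        case True
        show ?thesis unfolding True using k(1) d(1) \<eta> by linarith
      next
        case False
        then have "Suc j \<in> J" using j by (auto simp: J_def)
        have "\<not> d \<le> 1 / 2 ^ Suc j"
        proof
          assume "d \<le> 1 / 2 ^ Suc j"
          then have "Suc j \<le> Max {j\<in>J. d \<le> 1 / 2 ^ j}"
            using \<open>Suc j \<in> J\<close> by (intro Max_ge) (auto simp: J_def)
          then show False unfolding j_def[symmetric] by simp
        qed
        then show ?thesis by simp
      qed
      have "sum w (P \<inter> C) \<le> (\<Sum>c\<in>cell n j ` (P \<inter> C). \<Sum>x | x \<in> P \<and> cell n j x = c. w x)"
      proof -
        have "sum w (P \<inter> C) = (\<Sum>c\<in>cell n j ` (P \<inter> C). \<Sum>x | x \<in> P \<inter> C \<and> cell n j x = c. w x)"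
          using P(2) by (intro sum.group[symmetric]) auto
        also have "\<dots> \<le> (\<Sum>c\<in>cell n j ` (P \<inter> C). \<Sum>x | x \<in> P \<and> cell n j x = c. w x)"
          using P(2) w(1) by (intro sum_mono sum_mono2) auto
        finally show ?thesis .
      qed
      also have "\<dots> \<le> (\<Sum>c\<in>cell n j ` (P \<inter> C). cap j)" by (intro sum_mono w(2) j)
      also have "\<dots> = card (cell n j ` (P \<inter> C)) * cap j" by simp
      also have "\<dots> \<le> 2 ^ n * cap j"
      proof (rule mult_right_mono)
        have "card (cell n j ` (P \<inter> C)) \<le> 2 ^ n"
          by (rule card_cells_le) (use P(2) C j(2) in \<open>auto intro: order_trans\<close>)
        then have "real (card (cell n j ` (P \<inter> C))) \<le> real (2 ^ n)" by (rule of_nat_mono)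
        then show "real (card (cell n j ` (P \<inter> C))) \<le> 2 ^ n" by simp
      qed (use cap0 in \<open>auto intro: less_imp_le\<close>)
      also have "\<dots> \<le> 2 ^ n * (2 * d) ^ m"
        unfolding cap_def using \<open>1 / 2 ^ j \<le> 2 * d\<close> by (intro mult_left_mono power_mono) auto
      finally have "sum w (P \<inter> C) \<le> 2 ^ n * (2 * d) ^ m" .
      then have "measure_pmf.prob q C \<le> 2 ^ n * (2 * d) ^ m / sum w P"
        unfolding q(2) using W by (intro divide_right_mono) auto
      also have "\<dots> \<le> 2 ^ n * (2 * d) ^ m / (a / w0)"
        using aW a w0 W \<eta> d by (intro divide_left_mono mult_pos_pos) (auto simp: field_simps)
      also have "\<dots> = frostman_const n m / a * d powr real m"
        using \<eta> d by (simp add: frostman_const_def w0_def powr_realpow power_mult_distrib power_add)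
      finally show "measure_pmf.prob q C \<le> frostman_const n m / a * d powr real m" .
    qed
    then show ?thesis using q(1) P(1) by blast
  qed
  have "(0::real) < 1 / 2 ^ j0" by simp
  then show thesis using main by (rule that)
qed

lemma hausdorff_prodset_ge:
  assumes K: "\<And>i. i < l \<Longrightarrow> compact (K i)" "\<And>i. i < l \<Longrightarrow> K i \<subseteq> R_space n"
    and pos: "0 < n" "0 < m" "0 < l" and a: "0 < a" "\<And>i. i < l \<Longrightarrow> ennreal a < hausdorff (real m) (K i)"
  shows "ennreal (unit_ball_vol (real (m * l)) / (2 * 2 powr real (m * l) * (frostman_const n m / a) ^ l))
    \<le> hausdorff (real (m * l)) (prodset l K)"
proof -
  have "\<exists>\<delta>>0. \<forall>\<eta>>0. \<exists>q. set_pmf q \<subseteq> K i \<and> growth (real m) (frostman_const n m / a) \<eta> \<delta> q" if "i < l" for i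
    using frostman[OF K(1,2)[OF that] pos(1,2) a(1) a(2)[OF that]] by metis
  then obtain \<delta> where \<delta>: "\<And>i. i < l \<Longrightarrow> 0 < \<delta> i"
    "\<And>i \<eta>. i < l \<Longrightarrow> 0 < \<eta> \<Longrightarrow> \<exists>q. set_pmf q \<subseteq> K i \<and> growth (real m) (frostman_const n m / a) \<eta> (\<delta> i) q"
    by metis
  define \<delta>' where "\<delta>' = Min (\<delta> ` {..<l})"
  have \<delta>': "0 < \<delta>'" unfolding \<delta>'_def using \<delta>(1) pos(3) by (subst Min_gr_iff) auto
  have le: "\<delta>' \<le> \<delta> i" if "i < l" for i using that by (auto simp: \<delta>'_def)
  have c0: "0 < frostman_const n m / a" using pos a(1) by (simp add: frostman_const_def)
  show ?thesis
  proof (rule hausdorff_ge_mass[where s = "real (m * l)" and M = "(frostman_const n m / a) ^ l" and \<delta> = \<delta>'])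
    show "compact (prodset l K)" by (rule compact_prodset) (rule K(1))
    show "0 < real (m * l)" "0 < (frostman_const n m / a) ^ l" using pos c0 by auto
    show "0 < \<delta>'" by fact
    fix \<eta> :: real assume \<eta>: "0 < \<eta>"
    obtain q where q: "\<And>i. i < l \<Longrightarrow> set_pmf (q i) \<subseteq> K i"
      "\<And>i. i < l \<Longrightarrow> growth (real m) (frostman_const n m / a) \<eta> (\<delta> i) (q i)"
      using \<delta>(2)[OF _ \<eta>] by metis
    let ?q = "map_pmf (\<lambda>f. mk l (f \<circ> id)) (Pi_pmf {..<l} undefined q)"
    have "growth (real m * real l) ((frostman_const n m / a) ^ l) \<eta> \<delta>' ?q"
      by (rule prod_growth) (use q(2) le c0 \<eta> in \<open>auto intro: growth_mono_scale\<close>)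
    moreover have "set_pmf ?q \<subseteq> prodset l K"
      using q(1) Pi_pmf_supportD[of "{..<l}"] by (fastforce intro!: mk_in_prodset)
    ultimately show "\<exists>q. set_pmf q \<subseteq> prodset l K \<and> growth (real (m * l)) ((frostman_const n m / a) ^ l) \<eta> \<delta>' q"
      by (intro exI[of _ ?q]) simp
  qed
qed

section \<open>Flatness from bounded energy\<close>

definition flat :: "nat \<Rightarrow> nat \<Rightarrow> real finseq set \<Rightarrow> real finseq \<Rightarrow> real \<Rightarrow> real \<Rightarrow> bool" where
  "flat n m S x s h \<longleftrightarrow> (\<exists>e. frame n m e \<and> (\<forall>z\<in>S \<inter> cball x s. norm (rej m e (z - x)) \<le> h))"

definition mass_lb :: "nat \<Rightarrow> nat \<Rightarrow> real finseq set \<Rightarrow> real \<Rightarrow> real \<Rightarrow> bool" where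
  "mass_lb m l S c r \<longleftrightarrow> (\<forall>\<rho> y. 0 < \<rho> \<longrightarrow> \<rho> \<le> r \<longrightarrow> (\<forall>i<l. y i \<in> S) \<longrightarrow>
     ennreal (c * \<rho> ^ (m * l)) \<le> hausdorff (real (m * l)) (prodset l (\<lambda>i. S \<inter> cball (y i) \<rho>)))"

lemma flat_mono: "flat n m S x s h \<Longrightarrow> h \<le> h' \<Longrightarrow> flat n m S x s h'"
  unfolding flat_def by (meson order_trans)

lemma flat_trivial: "m \<le> n \<Longrightarrow> flat n m S x s s"
  unfolding flat_def
proof (intro exI conjI ballI)
  assume "m \<le> n"
  then show "frame n m (\<lambda>i. single i (1::real))" by (rule frame_single)
  fix z assume "z \<in> S \<inter> cball x s"
  then have "norm (z - x) \<le> s" by (simp add: dist_norm norm_minus_commute)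
  then show "norm (rej m (\<lambda>i. single i (1::real)) (z - x)) \<le> s"
    using norm_rej_le[OF orthonormal_single, of m "z - x"] by linarith
qed

lemma not_flat_heights:
  assumes S: "S \<subseteq> R_space n" "x \<in> S" and "m \<le> n" and nf: "\<not> flat n m S x s h"
  shows "\<exists>v. \<forall>j\<le>m. x + v j \<in> S \<inter> cball x s \<and> (\<forall>c. h \<le> norm (v j - (\<Sum>i<j. c i *\<^sub>R v i)))"
proof -
  have "\<exists>v. \<forall>j<k. x + v j \<in> S \<inter> cball x s \<and> (\<forall>c. h \<le> norm (v j - (\<Sum>i<j. c i *\<^sub>R v i)))"
    if "k \<le> m + 1" for k
    using that
  proof (induction k)
    case (Suc k)
    then obtain v where v: "\<And>j. j < k \<Longrightarrow> x + v j \<in> S \<inter> cball x s"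
      "\<And>j c. j < k \<Longrightarrow> h \<le> norm (v j - (\<Sum>i<j. c i *\<^sub>R v i))" by auto
    have vR: "v j \<in> R_space n" if "j < k" for j
      using v(1)[OF that] S subspace_diff[OF subspace_R_space, of "x + v j" n x] by auto
    obtain e where e: "frame n m e"
      "\<And>i. i < m \<Longrightarrow> proj m e (if i < k then v i else 0) = (if i < k then v i else 0)"
      by (rule gram_schmidt[of m "\<lambda>i. if i < k then v i else 0" n])
         (use vR assms(3) subspace_0[OF subspace_R_space] in auto)
    obtain z where z: "z \<in> S \<inter> cball x s" "h < norm (rej m e (z - x))"
      using nf e(1) unfolding flat_def by (meson not_le)
    have rej0: "rej m e (v i) = 0" if "i < k" for i
      using e(2)[of i] that Suc.prems by (simp add: rej_def)
    let ?v = "v(k := z - x)"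
    have "x + ?v j \<in> S \<inter> cball x s \<and> (\<forall>c. h \<le> norm (?v j - (\<Sum>i<j. c i *\<^sub>R ?v i)))" if "j < Suc k" for j
    proof (intro conjI allI)
      show "x + ?v j \<in> S \<inter> cball x s" using that v(1) z(1) by (cases "j = k") auto
      fix c :: "nat \<Rightarrow> real"
      have eq: "(\<Sum>i<j. c i *\<^sub>R ?v i) = (\<Sum>i<j. c i *\<^sub>R v i)"
        using that by (intro sum.cong) auto
      show "h \<le> norm (?v j - (\<Sum>i<j. c i *\<^sub>R ?v i))"
      proof (cases "j = k")
        case True
        have "rej m e (z - x - (\<Sum>i<k. c i *\<^sub>R v i)) = rej m e (z - x)"
          by (simp add: rej_simps rej0)
        then have "norm (rej m e (z - x)) \<le> norm (z - x - (\<Sum>i<k. c i *\<^sub>R v i))"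
          using norm_rej_le[OF frame_orthonormal[OF e(1)], of "z - x - (\<Sum>i<k. c i *\<^sub>R v i)"] by simp
        then show ?thesis using z(2) eq True by simp
      next
        case False
        then show ?thesis using v(2)[of j c] that eq by simp
      qed
    qed
    then show ?case by blast
  qed simp
  from this[of "m + 1"] show ?thesis by (simp add: less_Suc_eq_le)
qed

lemma fat_of_heights:
  fixes v :: "nat \<Rightarrow> 'a::real_normed_vector"
  assumes "\<And>j c. j < N \<Longrightarrow> h \<le> norm (v j - (\<Sum>i<j. c i *\<^sub>R v i))"
    and "\<And>j. j < N \<Longrightarrow> norm (v j) \<le> s" and h: "0 < h" "h \<le> s"
  shows "fat N v (2 * s * (h / (2 * s)) ^ N)"
  using assms(1,2)
proof (induction N)
  case (Suc N)
  define g where "g = 2 * s * (h / (2 * s)) ^ N"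
  have g: "0 < g" using h by (simp add: g_def)
  have gS: "2 * s * (h / (2 * s)) ^ Suc N = g * (h / (2 * s))" by (simp add: g_def)
  have "(h / (2 * s)) ^ N \<le> 1" using h by (intro power_le_one) auto
  then have gh: "g * (h / (2 * s)) \<le> h" using h by (simp add: g_def mult_left_le)
  have IH: "fat N v g" unfolding g_def using Suc by simp
  show ?case unfolding fat_def gS
  proof (intro allI impI)
    fix a :: "nat \<Rightarrow> real" and k assume k: "k < Suc N"
    define w where "w = (\<Sum>i<Suc N. a i *\<^sub>R v i)"
    have aN: "h * \<bar>a N\<bar> \<le> norm w"
    proof (cases "a N = 0")
      case False
      have "w = a N *\<^sub>R (v N - (\<Sum>i<N. (- a i / a N) *\<^sub>R v i))"
        using False by (simp add: w_def scaleR_diff_right scaleR_add_right scaleR_sum_right sum_negf add.commute)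
      then have "norm w = \<bar>a N\<bar> * norm (v N - (\<Sum>i<N. (- a i / a N) *\<^sub>R v i))" by simp
      also have "\<dots> \<ge> \<bar>a N\<bar> * h" by (intro mult_left_mono Suc.prems) auto
      finally show ?thesis by (simp add: mult.commute)
    qed simp
    show "g * (h / (2 * s)) * \<bar>a k\<bar> \<le> norm (\<Sum>i<Suc N. a i *\<^sub>R v i)"
    proof (cases "k = N")
      case True
      then show ?thesis using aN mult_right_mono[OF gh, of "\<bar>a N\<bar>"] by (simp add: w_def)
    next
      case False
      then have "g * \<bar>a k\<bar> \<le> norm (\<Sum>i<N. a i *\<^sub>R v i)" using k by (intro fatD[OF IH]) auto
      also have "(\<Sum>i<N. a i *\<^sub>R v i) = w - a N *\<^sub>R v N" by (simp add: w_def)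
      also have "norm (w - a N *\<^sub>R v N) \<le> norm w + \<bar>a N\<bar> * norm (v N)"
        using norm_triangle_ineq4[of w "a N *\<^sub>R v N"] by simp
      also have "\<bar>a N\<bar> * norm (v N) \<le> \<bar>a N\<bar> * s" by (intro mult_left_mono Suc.prems) auto
      also have "\<bar>a N\<bar> * s \<le> norm w / h * s"
        using aN h by (intro mult_right_mono) (auto simp: field_simps)
      also have "norm w + norm w / h * s \<le> norm w * (2 * s / h)"
      proof -
        have "norm w * (1 + s / h) \<le> norm w * (2 * s / h)"
          using h by (intro mult_left_mono) (auto simp: field_simps)
        then show ?thesis by (simp add: algebra_simps)
      qed
      finally have "g * \<bar>a k\<bar> \<le> norm w * (2 * s / h)" by simp
      then have "g * \<bar>a k\<bar> * (h / (2 * s)) \<le> norm w * (2 * s / h) * (h / (2 * s))"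
        using h by (intro mult_right_mono) auto
      also have "norm w * (2 * s / h) * (h / (2 * s)) = norm w" using h by simp
      finally show ?thesis by (simp add: w_def mult_ac)
    qed
  qed
qed (simp add: fat_def)

lemma fat_triangular:
  fixes v :: "nat \<Rightarrow> 'a::real_normed_vector"
  assumes "fat N v g" "j < N"
  shows "g * \<bar>a j\<bar> \<le> norm (\<Sum>i\<le>j. a i *\<^sub>R v i)"
proof -
  let ?b = "\<lambda>i. if i \<le> j then a i else 0"
  have "g * \<bar>?b j\<bar> \<le> norm (\<Sum>i<N. ?b i *\<^sub>R v i)" by (rule fatD[OF assms])
  also have "(\<Sum>i<N. ?b i *\<^sub>R v i) = (\<Sum>i\<le>j. ?b i *\<^sub>R v i)"
    using assms(2) by (intro sum.mono_neutral_right) auto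
  also have "\<dots> = (\<Sum>i\<le>j. a i *\<^sub>R v i)" by (intro sum.cong) auto
  finally show ?thesis by simp
qed

lemma energy_ge_real:
  fixes S :: "'a::real_inner set"
  assumes en: "energy m l p S \<le> ennreal E" "0 \<le> E"
    and B: "compact B" "B \<subseteq> tuples l S" "ennreal b \<le> hausdorff (real (m * l)) B" "0 \<le> b"
    and ext: "\<And>t. t \<in> B \<Longrightarrow> \<exists>x. (\<forall>i<l. x i = coord t i) \<and> (\<forall>i\<in>{l..m + 1}. x i \<in> S) \<and> c \<le> menger_curv m x"
    and "0 \<le> c" "0 \<le> p"
  shows "c powr p * b \<le> E"
proof -
  have "ennreal (c powr p * b) = ennreal (c powr p) * ennreal b" using B(4) by (simp add: ennreal_mult)
  also have "\<dots> \<le> ennreal (c powr p) * hausdorff (real (m * l)) B" by (intro mult_left_mono B) simp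
  also have "\<dots> \<le> energy m l p S" by (rule energy_ge[OF B(1,2) ext]) (use assms in auto)
  also have "\<dots> \<le> ennreal E" by (rule en)
  finally show ?thesis using en(2) by (simp add: ennreal_le_iff)
qed

definition first_exponent :: "nat \<Rightarrow> nat \<Rightarrow> real \<Rightarrow> real" where
  "first_exponent m l p = (p - real (m * l)) / (real (m + 1) * (real (m + 1) * p + real (m * l)))"

lemma flat_of_energy:
  assumes ml: "1 \<le> m" "1 \<le> l" "l \<le> m + 2" and p: "real (m * l) < p" and c: "0 < c" and E: "0 \<le> E"
  obtains K where "0 < K" "\<And>n S r x s. m \<le> n \<Longrightarrow> S \<subseteq> R_space n \<Longrightarrow> compact S \<Longrightarrow>
    energy m l p S \<le> ennreal E \<Longrightarrow> mass_lb m l S c r \<Longrightarrow> x \<in> S \<Longrightarrow> 0 < s \<Longrightarrow> s \<le> 16 * r \<Longrightarrow>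
    flat n m S x s (K * s powr first_exponent m l p * s)"
proof -
  define q where "q = real (m + 1) * p + real (m * l)"
  define N where "N = real (m + 1) * q"
  define \<kappa> where "\<kappa> = first_exponent m l p"
  have p0: "0 < p" using p by (meson le_less_trans of_nat_0_le_iff)
  have q0: "0 < q" using p0 by (simp add: q_def add_pos_nonneg)
  have N0: "0 < N" using q0 by (simp add: N_def)
  have "\<kappa> = (p - real (m * l)) / N" by (simp only: \<kappa>_def first_exponent_def N_def q_def)
  then have \<kappa>N: "\<kappa> * N = p - real (m * l)" using N0 by simp
  define A where "A = vol_const (m + 1) / (2 ^ (m + 1) * 3 ^ (m + 2))"
  have A0: "0 < A" using vol_const_pos[of "m + 1"] by (simp add: A_def)
  define A' where "A' = A powr p * c / (8 * real (m + 1)) powr real (m * l) / 2 powr (real m * q)"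
  have A'0: "0 < A'" using A0 c by (simp add: A'_def)
  define K where "K = ((E + 1) / A') powr (1 / N)"
  have K0: "0 < K" using A'0 E by (simp add: K_def)
  have KN: "K powr N = (E + 1) / A'" using N0 A'0 E by (simp add: K_def powr_powr)
  have "flat n m S x s (K * s powr \<kappa> * s)"
    if n: "m \<le> n" and S: "S \<subseteq> R_space n" "compact S" and en: "energy m l p S \<le> ennreal E"
      and lb: "mass_lb m l S c r" and x: "x \<in> S" and s: "0 < s" "s \<le> 16 * r"
    for n S r x s
  proof (rule ccontr)
    assume nf: "\<not> flat n m S x s (K * s powr \<kappa> * s)"
    define \<eta> where "\<eta> = K * s powr \<kappa>"
    have \<eta>0: "0 < \<eta>" using K0 s by (simp add: \<eta>_def)
    have "\<eta> < 1"
    proof (rule ccontr)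
      assume "\<not> \<eta> < 1"
      then have "1 * s \<le> \<eta> * s" using s by (intro mult_right_mono) auto
      then show False using nf flat_mono[OF flat_trivial[OF n, of S x s], of "\<eta> * s"] by (simp add: \<eta>_def)
    qed
    define h where "h = \<eta> * s"
    have h: "0 < h" "h \<le> s" using \<eta>0 \<open>\<eta> < 1\<close> s by (simp_all add: h_def mult_left_le_one_le)
    obtain v where v: "\<And>j. j \<le> m \<Longrightarrow> x + v j \<in> S \<inter> cball x s"
      "\<And>j c. j \<le> m \<Longrightarrow> h \<le> norm (v j - (\<Sum>i<j. c i *\<^sub>R v i))"
      using not_flat_heights[OF S(1) x n nf] unfolding h_def \<eta>_def by auto
    have vs: "norm (v j) \<le> s" if "j \<le> m" for j using v(1)[OF that] by (simp add: dist_norm)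
    define \<gamma> where "\<gamma> = \<eta> ^ (m + 1) / 2 ^ m"
    have \<gamma>0: "0 < \<gamma>" using \<eta>0 by (simp add: \<gamma>_def)
    define g where "g = s * \<gamma>"
    have g0: "0 < g" using s \<gamma>0 by (simp add: g_def)
    have "fat (m + 1) v (2 * s * (h / (2 * s)) ^ (m + 1))"
      by (rule fat_of_heights) (use v vs h in auto)
    moreover have "2 * s * (h / (2 * s)) ^ (m + 1) = g"
      using s by (simp add: h_def g_def \<gamma>_def power_divide)
    ultimately have fat: "fat (m + 1) v g" by simp
    have \<gamma>half: "\<gamma> \<le> 1 / 2"
    proof -
      have "\<eta> ^ (m + 1) \<le> 1" using \<eta>0 \<open>\<eta> < 1\<close> by (intro power_le_one) auto
      moreover have "(2::real) ^ 1 \<le> 2 ^ m" using ml by (intro power_increasing) auto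
      ultimately show ?thesis unfolding \<gamma>_def by (intro frac_le[of 1, simplified]) (auto simp: )
    qed
    define \<rho> where "\<rho> = g / (8 * real (m + 1))"
    have \<rho>0: "0 < \<rho>" using g0 by (simp add: \<rho>_def)
    have \<rho>s: "\<rho> \<le> s / 16"
    proof -
      have "g \<le> s * (1/2)" unfolding g_def using \<gamma>half s by (intro mult_left_mono) auto
      moreover have "\<rho> \<le> g / 8" unfolding \<rho>_def using g0 by (intro divide_left_mono) auto
      ultimately show ?thesis by simp
    qed
    define y where "y i = (case i of 0 \<Rightarrow> x | Suc j \<Rightarrow> x + v j)" for i
    have yS: "y i \<in> S" if "i \<le> m + 1" for i using that v(1) x by (auto simp: y_def split: nat.splits)
    have ys: "dist (y i) x \<le> s" if "i \<le> m + 1" for i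
      using that vs s by (auto simp: y_def dist_norm split: nat.splits)
    define B where "B = prodset l (\<lambda>i. S \<inter> cball (y i) \<rho>)"
    define c0 where "c0 = A * \<gamma> powr real (m + 1) / s"
    have c00: "0 \<le> c0" using A0 s by (simp add: c0_def)
    have "c0 powr p * (c * \<rho> ^ (m * l)) \<le> E"
    proof (rule energy_ge_real[OF en E])
      show "compact B" unfolding B_def by (intro compact_prodset compact_Int_closed S) auto
      show "B \<subseteq> tuples l S" by (auto simp: B_def tuples_eq_prodset prodset_def)
      show "ennreal (c * \<rho> ^ (m * l)) \<le> hausdorff (real (m * l)) B"
        unfolding B_def using lb \<rho>0 \<rho>s s(2) yS ml unfolding mass_lb_def by auto
      fix t assume t: "t \<in> B"
      define X where "X i = (if i < l then coord t i else y i)" for i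
      have X: "X i \<in> S" "dist (X i) (y i) \<le> \<rho>" if "i \<le> m + 1" for i
        using t yS[OF that] \<rho>0 by (auto simp: X_def B_def prodset_def dist_commute)
      have "vol_const (m + 1) * (\<Prod>j\<le>m. g / 2) / (3 * s) ^ (m + 2) \<le> menger_curv m X"
      proof (rule menger_curv_ge)
        have "fat (m + 1) (\<lambda>i. X (Suc i) - X 0) (g / 2)"
        proof (rule fat_perturb[OF fat])
          fix i assume "i < m + 1"
          then have 1: "norm (X (Suc i) - (x + v i)) \<le> \<rho>" and 2: "norm (X 0 - x) \<le> \<rho>"
            using X(2)[of "Suc i"] X(2)[of 0] by (auto simp: y_def dist_norm)
          have 3: "X (Suc i) - X 0 - v i = (X (Suc i) - (x + v i)) - (X 0 - x)" by simp
          show "norm (X (Suc i) - X 0 - v i) \<le> 2 * \<rho>"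
            unfolding 3 using 1 2 norm_triangle_ineq4[of "X (Suc i) - (x + v i)" "X 0 - x"] by linarith
        next
          show "real (m + 1) * (2 * \<rho>) \<le> g / 2" using g0 by (simp add: \<rho>_def field_simps)
        qed
        then show "g / 2 * \<bar>a j\<bar> \<le> norm (\<Sum>i\<le>j. a i *\<^sub>R (X (Suc i) - X 0))" if "j \<le> m" for j a
          using that by (intro fat_triangular) auto
        show "dist (X i) (X j) \<le> 3 * s" if "i \<le> m + 1" "j \<le> m + 1" for i j
        proof -
          have "dist (X i) (X j) \<le> dist (X i) (y i) + dist (y i) (y j) + dist (y j) (X j)"
            using dist_triangle[of "X i" "X j" "y i"] dist_triangle[of "y i" "X j" "y j"] by linarith
          moreover have "dist (y i) (y j) \<le> 2 * s"
            using dist_triangle2[of "y i" "y j" x] ys[OF that(1)] ys[OF that(2)] by linarith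
          ultimately show ?thesis using X(2)[OF that(1)] X(2)[OF that(2)] \<rho>s s by (simp add: dist_commute)
        qed
      qed (use g0 in auto)
      also have "vol_const (m + 1) * (\<Prod>j\<le>m. g / 2) / (3 * s) ^ (m + 2) = c0"
        using s \<gamma>0 by (simp add: c0_def A_def g_def power_mult_distrib power_divide powr_realpow[symmetric] powr_add field_simps)
      finally have "c0 \<le> menger_curv m X" .
      moreover have "\<forall>i<l. X i = coord t i" by (simp add: X_def)
      ultimately show "\<exists>x. (\<forall>i<l. x i = coord t i) \<and> (\<forall>i\<in>{l..m + 1}. x i \<in> S) \<and> c0 \<le> menger_curv m x"
        using X(1) by (intro exI[of _ X]) auto
    qed (use c \<rho>0 c00 p0 in auto)
    moreover have "c0 powr p * (c * \<rho> ^ (m * l)) = A' * K powr N"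
    proof -
      have 1: "c0 powr p = A powr p * \<gamma> powr (real (m + 1) * p) / s powr p"
        using A0 s \<gamma>0 by (simp add: c0_def powr_divide powr_mult powr_powr)
      have 2: "\<rho> ^ (m * l) = s powr real (m * l) * \<gamma> powr real (m * l) / (8 * real (m + 1)) powr real (m * l)"
        using \<rho>0 s \<gamma>0 unfolding \<rho>_def g_def
        by (subst powr_realpow[symmetric]) (auto simp: powr_divide powr_mult)
      have 3: "\<gamma> powr (real (m + 1) * p) * \<gamma> powr real (m * l) = \<gamma> powr q"
        by (simp add: q_def powr_add)
      have 4: "\<gamma> powr q = \<eta> powr N / 2 powr (real m * q)"
      proof -
        have "\<gamma> = \<eta> powr real (m + 1) / 2 powr real m"
          unfolding \<gamma>_def using \<eta>0 by (subst (1 2) powr_realpow) auto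
        then show ?thesis using \<eta>0 by (simp add: powr_divide powr_powr N_def)
      qed
      have 5: "\<eta> powr N = K powr N * s powr p / s powr real (m * l)"
        unfolding \<eta>_def using K0 s by (simp add: powr_mult powr_powr \<kappa>N powr_diff)
      have "c0 powr p * (c * \<rho> ^ (m * l)) = A powr p * c / (8 * real (m + 1)) powr real (m * l) *
          (\<gamma> powr (real (m + 1) * p) * \<gamma> powr real (m * l)) * (s powr real (m * l) / s powr p)"
        unfolding 1 2 by (simp add: mult_ac)
      also have "\<dots> = A' * K powr N * ((s powr p / s powr real (m * l)) * (s powr real (m * l) / s powr p))"
        unfolding 3 4 5 A'_def by simp
      also have "(s powr p / s powr real (m * l)) * (s powr real (m * l) / s powr p) = 1"
        using s by simp
      finally show ?thesis by simp
    qed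
    ultimately have "A' * K powr N \<le> E" by simp
    then show False unfolding KN using A'0 by simp
  qed
  then show thesis using that K0 unfolding \<kappa>_def by blast
qed

section \<open>Sets that are locally graphical\<close>

definition full :: "nat \<Rightarrow> nat \<Rightarrow> real finseq set \<Rightarrow> real \<Rightarrow> real finseq \<Rightarrow> real \<Rightarrow> bool" where
  "full n m S \<epsilon> x s \<longleftrightarrow> (\<exists>f. frame n m f \<and>
     (\<forall>v. proj m f v = v \<longrightarrow> norm v \<le> s / 2 \<longrightarrow> (\<exists>z\<in>S. norm (z - x - v) \<le> \<epsilon> * s)))"

definition graphical :: "nat \<Rightarrow> nat \<Rightarrow> real finseq set \<Rightarrow> real \<Rightarrow> real finseq \<Rightarrow> real \<Rightarrow> (nat \<Rightarrow> real finseq) \<Rightarrow> bool" where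
  "graphical n m S \<epsilon> x r e \<longleftrightarrow> frame n m e \<and>
     (\<forall>a\<in>S \<inter> cball x r. \<forall>b\<in>S \<inter> cball x r. norm (rej m e (b - a)) \<le> \<epsilon> * norm (b - a)) \<and>
     (\<forall>v. proj m e v = v \<longrightarrow> norm v \<le> r / 4 \<longrightarrow> (\<exists>a\<in>S \<inter> cball x r. proj m e (a - x) = v))"

lemma norm_le_twice_proj:
  assumes "norm (rej m e v) \<le> \<epsilon> * norm v" "\<epsilon> \<le> 1 / 2"
  shows "norm v \<le> 2 * norm (proj m e v)"
proof -
  have "\<epsilon> * norm v \<le> 1 / 2 * norm v" using assms(2) by (intro mult_right_mono) auto
  then show ?thesis using norm_le_proj_rej[of v m e] assms(1) by linarith
qed

lemma graphical_mono:
  assumes G: "graphical n m S \<epsilon> x r e" and "x \<in> S" "0 < r'" "r' \<le> r" "\<epsilon> \<le> 1 / 2"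
  shows "graphical n m S \<epsilon> x r' e"
  unfolding graphical_def
proof (intro conjI ballI allI impI)
  show "frame n m e" using G by (simp add: graphical_def)
  fix v assume v: "proj m e v = v" "norm v \<le> r' / 4"
  then have "norm v \<le> r / 4" using assms(4) by linarith
  then obtain a where a: "a \<in> S" "a \<in> cball x r" "proj m e (a - x) = v"
    using G v(1) unfolding graphical_def by blast
  have "norm (rej m e (a - x)) \<le> \<epsilon> * norm (a - x)"
    using G a assms unfolding graphical_def by auto
  then have "norm (a - x) \<le> 2 * norm v" using norm_le_twice_proj assms(5) a(3) by metis
  then have "a \<in> cball x r'" using v(2) assms(3) by (simp add: dist_norm norm_minus_commute)
  then show "\<exists>a\<in>S \<inter> cball x r'. proj m e (a - x) = v" using a by blast
qed (use assms in \<open>auto simp: graphical_def\<close>)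

lemma graphical_full:
  assumes G: "graphical n m S \<epsilon> x r e" and "x \<in> S" "0 < s" "s \<le> r / 2" "0 \<le> \<epsilon>" "\<epsilon> \<le> 1 / 2"
  shows "full n m S \<epsilon> x s"
  unfolding full_def
proof (intro exI conjI allI impI)
  show "frame n m e" using G by (simp add: graphical_def)
  fix v assume v: "proj m e v = v" "norm v \<le> s / 2"
  then have "norm v \<le> r / 4" using assms by linarith
  then obtain a where a: "a \<in> S" "a \<in> cball x r" "proj m e (a - x) = v"
    using G v(1) unfolding graphical_def by blast
  have rej: "norm (rej m e (a - x)) \<le> \<epsilon> * norm (a - x)"
    using G a assms unfolding graphical_def by auto
  then have "norm (a - x) \<le> 2 * norm v" using norm_le_twice_proj assms(6) a(3) by metis
  then have "\<epsilon> * norm (a - x) \<le> \<epsilon> * s" using v(2) assms(5) by (intro mult_left_mono) auto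
  moreover have "a - x - v = rej m e (a - x)" using a(3) by (simp add: rej_def)
  ultimately show "\<exists>z\<in>S. norm (z - x - v) \<le> \<epsilon> * s" using rej a(1) by (intro bexI[of _ a]) auto
qed

lemma full_points:
  assumes F: "full n m S \<epsilon> x s" and s: "0 < s" and \<epsilon>: "real m * \<epsilon> \<le> 1 / 4"
  obtains f w where "frame n m f" "\<And>v. proj m f v = v \<Longrightarrow> norm v \<le> s / 2 \<Longrightarrow> \<exists>z\<in>S. norm (z - x - v) \<le> \<epsilon> * s"
    "\<And>i. i < m \<Longrightarrow> x + w i \<in> S" "\<And>i. i < m \<Longrightarrow> norm (w i) \<le> s * (1 / 2 + \<epsilon>)"
    "\<And>i. i < m \<Longrightarrow> norm (rej m f (w i)) \<le> \<epsilon> * s" "fat m w (s / 4)"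
proof -
  obtain f where f: "frame n m f"
    "\<And>v. proj m f v = v \<Longrightarrow> norm v \<le> s / 2 \<Longrightarrow> \<exists>z\<in>S. norm (z - x - v) \<le> \<epsilon> * s"
    using F unfolding full_def by blast
  have orthonormal: "orthonormal m f" using f(1) by auto
  have "\<exists>z\<in>S. norm (z - x - (s / 2) *\<^sub>R f i) \<le> \<epsilon> * s" if "i < m" for i
    using orthonormal that s by (intro f(2)) (simp_all add: proj_simps proj_self_inner orthonormal_norm)
  then obtain z where z: "\<And>i. i < m \<Longrightarrow> z i \<in> S" "\<And>i. i < m \<Longrightarrow> norm (z i - x - (s / 2) *\<^sub>R f i) \<le> \<epsilon> * s"
    by metis
  show thesis
  proof (rule that[OF f, of "\<lambda>i. z i - x"])
    fix i assume i: "i < m"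
    show "x + (z i - x) \<in> S" using z(1)[OF i] by simp
    have "norm (z i - x) \<le> norm (z i - x - (s / 2) *\<^sub>R f i) + norm ((s / 2) *\<^sub>R f i)"
      using norm_triangle_ineq[of "z i - x - (s / 2) *\<^sub>R f i" "(s / 2) *\<^sub>R f i"] by simp
    then show "norm (z i - x) \<le> s * (1 / 2 + \<epsilon>)"
      using z(2)[OF i] orthonormal_norm[OF orthonormal i] s by (simp add: algebra_simps)
    show "norm (rej m f (z i - x)) \<le> \<epsilon> * s"
      using norm_rej_le_dist[OF orthonormal, of "(s / 2) *\<^sub>R f i" "z i - x"] z(2)[OF i]
      by (simp add: proj_simps proj_self_inner[OF orthonormal i])
  next
    have "fat m (\<lambda>i. (s / 2) *\<^sub>R f i) (s / 2 * 1)" using s by (intro fat_scale fat_orthonormal orthonormal) auto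
    then have "fat m (\<lambda>i. z i - x) (s / 2 * 1 / 2)"
    proof (rule fat_perturb[OF _ z(2)])
      have "real m * \<epsilon> * s \<le> 1 / 4 * s" using \<epsilon> s by (intro mult_right_mono) auto
      then show "real m * (\<epsilon> * s) \<le> s / 2 * 1 / 2" by (simp add: mult.assoc)
    qed
    then show "fat m (\<lambda>i. z i - x) (s / 4)" by simp
  qed auto
qed

lemma eps_half: "real m * \<epsilon> \<le> 1 / 4 \<Longrightarrow> 1 \<le> m \<Longrightarrow> \<epsilon> \<le> 1 / 4"
proof (cases "0 \<le> \<epsilon>")
  case True
  assume "real m * \<epsilon> \<le> 1 / 4" "1 \<le> m"
  moreover have "1 * \<epsilon> \<le> real m * \<epsilon>" using True \<open>1 \<le> m\<close> by (intro mult_right_mono) auto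
  ultimately show ?thesis by simp
qed simp

lemma tilt_of_near:
  assumes F: "full n m S \<epsilon> a \<sigma>" and \<sigma>: "0 < \<sigma>" and \<epsilon>: "real m * \<epsilon> \<le> 1 / 4" and "1 \<le> m"
    and e: "orthonormal m e" "orthonormal m e'"
    and d: "\<And>z. z \<in> S \<inter> cball a \<sigma> \<Longrightarrow> norm (rej m e (z - a)) \<le> d" "real m * d \<le> \<sigma> / 8"
    and d': "\<And>z. z \<in> S \<inter> cball a \<sigma> \<Longrightarrow> norm (rej m e' (z - a)) \<le> d'"
  shows "tilt m e e' (8 * real m * (d + d') / \<sigma>)"
proof -
  obtain w where w: "\<And>i. i < m \<Longrightarrow> a + w i \<in> S" "\<And>i. i < m \<Longrightarrow> norm (w i) \<le> \<sigma> * (1 / 2 + \<epsilon>)" "fat m w (\<sigma> / 4)"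
    using full_points[OF F \<sigma> \<epsilon>] by metis
  have in_ball: "a + w i \<in> S \<inter> cball a \<sigma>" if "i < m" for i
  proof -
    have "\<sigma> * (1 / 2 + \<epsilon>) \<le> \<sigma> * 1" using eps_half[OF \<epsilon> assms(4)] \<sigma> by (intro mult_left_mono) auto
    then show ?thesis using w(1,2)[OF that] by (simp add: dist_norm)
  qed
  have "tilt m e e' (2 * real m * (d + d') / (\<sigma> / 4))"
    by (rule fat_tilt[OF e w(3)]) (use \<sigma> d d' in_ball in force)+
  then show ?thesis by (simp add: mult_ac)
qed

lemma graphical_pmf:
  assumes G: "graphical n m S \<epsilon> x r e" and x: "x \<in> S" and \<rho>: "0 < \<rho>" "\<rho> \<le> r" and \<epsilon>: "\<epsilon> \<le> 1 / 2"
    and m: "1 \<le> m" and \<eta>: "0 < \<eta>"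
  shows "\<exists>q. set_pmf q \<subseteq> S \<inter> cball x \<rho> \<and> growth (real m) ((8 * real m / \<rho>) ^ m) \<eta> \<delta> q"
proof -
  have G': "graphical n m S \<epsilon> x \<rho> e" by (rule graphical_mono[OF G x \<rho> \<epsilon>])
  then have orthonormal: "orthonormal m e" by (auto simp: graphical_def)
  define c where "c = \<rho> / (4 * real m)"
  have c: "0 < c" using \<rho> m by (simp add: c_def)
  define Q where "Q = Suc (nat \<lceil>c / \<eta>\<rceil>)"
  have Q0: "0 < Q" by (simp add: Q_def)
  have "c / \<eta> \<le> real Q" unfolding Q_def by linarith
  then have Q: "c \<le> \<eta> * real Q" using \<eta> by (simp add: field_simps)
  define P where "P k = (\<Sum>j<m. (c * real (k j) / real Q) *\<^sub>R e j)" for k :: "nat \<Rightarrow> nat"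
  have "\<exists>a\<in>S \<inter> cball x \<rho>. proj m e (a - x) = P k" if k: "\<And>i. i < m \<Longrightarrow> k i < Q" for k
  proof -
    have "norm (P k) \<le> (\<Sum>j<m. c)"
      unfolding P_def
    proof (rule sum_norm_le)
      fix j assume j: "j \<in> {..<m}"
      have "c * real (k j) \<le> c * real Q" using k[of j] j c by simp
      then show "norm ((c * real (k j) / real Q) *\<^sub>R e j) \<le> c"
        using c Q0 j orthonormal_norm[OF orthonormal, of j] by (simp add: field_simps)
    qed
    then have "norm (P k) \<le> \<rho> / 4" using m by (simp add: c_def)
    moreover have "proj m e (P k) = P k" unfolding P_def by (rule proj_comb[OF orthonormal])
    ultimately show ?thesis using G' unfolding graphical_def by blast
  qed
  then obtain g where g: "\<And>k. (\<And>i. i < m \<Longrightarrow> k i < Q) \<Longrightarrow> g k \<in> S \<inter> cball x \<rho>"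
    "\<And>k. (\<And>i. i < m \<Longrightarrow> k i < Q) \<Longrightarrow> proj m e (g k - x) = P k"
    by metis
  have "growth (real m) (2 ^ m / (\<Prod>j<m. c)) \<eta> \<delta> (map_pmf g (grid_pmf m Q))"
  proof (rule grid_growth[OF Q0 \<eta>])
    fix k k' j assume k: "\<And>i. i < m \<Longrightarrow> k i < Q" "\<And>i. i < m \<Longrightarrow> k' i < Q" and j: "j < m"
    have "P k - P k' = (\<Sum>j<m. (c * (real (k j) - real (k' j)) / real Q) *\<^sub>R e j)"
      by (simp add: P_def sum_subtractf[symmetric] scaleR_diff_left[symmetric] diff_divide_distrib right_diff_distrib)
    then have "\<bar>c * (real (k j) - real (k' j)) / real Q\<bar> \<le> norm (P k - P k')"
      using orthonormal_coeff_le[OF orthonormal j, of "\<lambda>j. c * (real (k j) - real (k' j)) / real Q"] by simp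
    also have "P k - P k' = proj m e (g k - g k')"
      using g(2)[of k, OF k(1)] g(2)[of k', OF k(2)]
        linear_diff[OF linear_proj, of m e "g k - x" "g k' - x"] by simp
    also have "norm (proj m e (g k - g k')) \<le> dist (g k) (g k')"
      unfolding dist_norm by (rule norm_proj_le[OF orthonormal])
    finally show "c * \<bar>real (k j) - real (k' j)\<bar> / real Q \<le> dist (g k) (g k')"
      using c by (simp add: abs_mult)
  qed (use c Q in auto)
  moreover have "2 ^ m / (\<Prod>j<m. c) = (8 * real m / \<rho>) ^ m"
    using m \<rho> by (simp add: c_def power_divide[symmetric])
  moreover have "set_pmf (map_pmf g (grid_pmf m Q)) \<subseteq> S \<inter> cball x \<rho>"
    using grid_pmf_support[OF Q0] g(1) by force
  ultimately show ?thesis by metis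
qed

definition lb_const :: "nat \<Rightarrow> nat \<Rightarrow> real" where
  "lb_const m l = unit_ball_vol (real (m * l)) / (2 * 2 powr real (m * l) * (8 * real m) ^ (m * l))"

lemma lb_const_pos: "1 \<le> m \<Longrightarrow> 0 < lb_const m l"
  by (simp add: lb_const_def)

lemma mass_lb_of_graphical:
  assumes S: "compact S" and G: "\<And>x. x \<in> S \<Longrightarrow> \<exists>e. graphical n m S \<epsilon> x r e" and \<epsilon>: "\<epsilon> \<le> 1 / 2"
    and ml: "1 \<le> m" "1 \<le> l"
  shows "mass_lb m l S (lb_const m l) r"
  unfolding mass_lb_def
proof (intro allI impI)
  fix \<rho> y assume \<rho>: "0 < \<rho>" "\<rho> \<le> r" and y: "\<forall>i<l. y i \<in> S"
  let ?K = "\<lambda>i. S \<inter> cball (y i) \<rho>"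
  let ?M = "((8 * real m / \<rho>) ^ m) ^ l"
  have M0: "0 < ?M" using ml \<rho> by simp
  have "ennreal (unit_ball_vol (real (m * l)) / (2 * 2 powr real (m * l) * ?M)) \<le> hausdorff (real (m * l)) (prodset l ?K)"
  proof (rule hausdorff_ge_mass[where \<delta> = 1])
    show "compact (prodset l ?K)" by (intro compact_prodset compact_Int_closed S) auto
    fix \<eta> :: real assume \<eta>: "0 < \<eta>"
    have "\<exists>q. set_pmf q \<subseteq> ?K i \<and> growth (real m) ((8 * real m / \<rho>) ^ m) \<eta> 1 q" if i: "i < l" for i
    proof -
      obtain e where "graphical n m S \<epsilon> (y i) r e" using G y i by blast
      then show ?thesis by (rule graphical_pmf) (use y i \<rho> \<epsilon> ml \<eta> in auto)
    qed
    then obtain q where q: "\<And>i. i < l \<Longrightarrow> set_pmf (q i) \<subseteq> ?K i"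
      "\<And>i. i < l \<Longrightarrow> growth (real m) ((8 * real m / \<rho>) ^ m) \<eta> 1 (q i)"
      by metis
    let ?q = "map_pmf (\<lambda>f. mk l (f \<circ> id)) (Pi_pmf {..<l} undefined q)"
    have "growth (real m * real l) ?M \<eta> 1 ?q"
      by (rule prod_growth) (use q(2) \<eta> \<rho> in auto)
    moreover have "set_pmf ?q \<subseteq> prodset l ?K"
      using q(1) Pi_pmf_supportD[of "{..<l}"] by (fastforce intro!: mk_in_prodset)
    ultimately show "\<exists>q. set_pmf q \<subseteq> prodset l ?K \<and> growth (real (m * l)) ?M \<eta> 1 q"
      by (intro exI[of _ ?q]) simp
  qed (use ml M0 in auto)
  also have "unit_ball_vol (real (m * l)) / (2 * 2 powr real (m * l) * ?M) = lb_const m l * \<rho> ^ (m * l)"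
    by (simp add: lb_const_def power_divide power_mult)
  finally show "ennreal (lb_const m l * \<rho> ^ (m * l)) \<le> hausdorff (real (m * l)) (prodset l ?K)" .
qed

text \<open>If \<open>v\<close> were not attained, \<open>S\<close> could be followed from a point projecting closest to \<open>v\<close> in the
  direction of \<open>v\<close>. This replaces a degree argument.\<close>

lemma projection_onto_disc:
  assumes S: "compact S" "x \<in> S" and e: "frame n m e" and m: "1 \<le> m" and \<epsilon>: "0 \<le> \<epsilon>" "real m * \<epsilon> \<le> 1 / 64"
    and lip: "\<And>a b. a \<in> S \<inter> cball x R \<Longrightarrow> b \<in> S \<inter> cball x R \<Longrightarrow> norm (rej m e (b - a)) \<le> \<epsilon> * norm (b - a)"
    and F: "\<And>y s. y \<in> S \<inter> cball x R \<Longrightarrow> 0 < s \<Longrightarrow> s \<le> R / 4 \<Longrightarrow> full n m S \<epsilon> y s"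
    and v: "proj m e v = v" "norm v \<le> R / 4" and R: "0 < R"
  shows "\<exists>a\<in>S \<inter> cball x R. proj m e (a - x) = v"
proof -
  have orthonormal: "orthonormal m e" using e by auto
  have \<epsilon>': "\<epsilon> \<le> 1 / 64"
  proof -
    have "1 * \<epsilon> \<le> real m * \<epsilon>" using \<epsilon> m by (intro mult_right_mono) auto
    then show ?thesis using \<epsilon> by simp
  qed
  have xR: "x \<in> S \<inter> cball x R" using S R by simp
  have "compact (S \<inter> cball x R)" using S by (intro compact_Int_closed) auto
  moreover have "continuous_on (S \<inter> cball x R) (\<lambda>a. norm (proj m e (a - x) - v))"
    unfolding proj_def by (intro continuous_intros)
  ultimately obtain y where y: "y \<in> S \<inter> cball x R"
    "\<And>a. a \<in> S \<inter> cball x R \<Longrightarrow> norm (proj m e (y - x) - v) \<le> norm (proj m e (a - x) - v)"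
    using continuous_attains_inf[of "S \<inter> cball x R" "\<lambda>a. norm (proj m e (a - x) - v)"] xR by blast
  define \<delta> where "\<delta> = norm (proj m e (y - x) - v)"
  have "\<delta> = 0"
  proof (rule ccontr)
    assume "\<delta> \<noteq> 0"
    then have \<delta>0: "0 < \<delta>" by (simp add: \<delta>_def)
    have \<delta>v: "\<delta> \<le> norm v" using y(2)[OF xR] by (simp add: \<delta>_def proj_simps)
    then have \<delta>R: "\<delta> \<le> R / 4" using v by simp
    have "norm (proj m e (y - x)) \<le> R / 2"
      using norm_triangle_ineq2[of "proj m e (y - x)" v] \<delta>v v(2) by (simp add: \<delta>_def)
    moreover have "norm (rej m e (y - x)) \<le> 1 / 64 * norm (y - x)"
    proof -
      have "norm (rej m e (y - x)) \<le> \<epsilon> * norm (y - x)" by (rule lip[OF xR y(1)])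
      also have "\<dots> \<le> 1 / 64 * norm (y - x)" using \<epsilon>' by (intro mult_right_mono) auto
      finally show ?thesis .
    qed
    ultimately have yx: "norm (y - x) \<le> R / 2 * (64 / 63)"
      using norm_le_proj_rej[of "y - x" m e] by simp
    have \<epsilon>4: "real m * \<epsilon> \<le> 1 / 4" using \<epsilon> by simp
    obtain f w where f: "frame n m f"
      "\<And>v. proj m f v = v \<Longrightarrow> norm v \<le> \<delta> / 2 \<Longrightarrow> \<exists>z\<in>S. norm (z - y - v) \<le> \<epsilon> * \<delta>"
      and w: "\<And>i. i < m \<Longrightarrow> y + w i \<in> S" "\<And>i. i < m \<Longrightarrow> norm (w i) \<le> \<delta> * (1 / 2 + \<epsilon>)"
        "\<And>i. i < m \<Longrightarrow> norm (rej m f (w i)) \<le> \<epsilon> * \<delta>" "fat m w (\<delta> / 4)"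
      using full_points[OF F[OF y(1) \<delta>0 \<delta>R] \<delta>0 \<epsilon>4] by metis
    have near: "z \<in> cball x R" if "norm (z - y) \<le> \<delta> * (1 / 2 + \<epsilon>)" for z
    proof -
      have "\<delta> * (1 / 2 + \<epsilon>) \<le> \<delta> * 1" using \<delta>0 \<epsilon>' by (intro mult_left_mono) auto
      then have "norm (z - y) \<le> R / 4" using that \<delta>R by simp
      moreover have "norm (z - x) \<le> norm (z - y) + norm (y - x)"
        using norm_triangle_ineq[of "z - y" "y - x"] by simp
      ultimately show ?thesis using yx R by (simp add: dist_norm norm_minus_commute)
    qed
    have "tilt m e f (2 * real m * (\<epsilon> * \<delta> + \<epsilon> * \<delta>) / (\<delta> / 4))"
    proof (rule fat_tilt[OF orthonormal _ w(4)])
      fix i assume i: "i < m"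
      have "y + w i \<in> S \<inter> cball x R" using w(1)[OF i] near[of "y + w i"] w(2)[OF i] by simp
      from lip[OF y(1) this] have "norm (rej m e (w i)) \<le> \<epsilon> * norm (w i)" by simp
      also have "\<dots> \<le> \<epsilon> * \<delta>"
      proof (rule mult_left_mono)
        have "\<delta> * (1 / 2 + \<epsilon>) \<le> \<delta> * 1" using \<delta>0 \<epsilon>' by (intro mult_left_mono) auto
        then show "norm (w i) \<le> \<delta>" using w(2)[OF i] by simp
      qed (use \<epsilon> in simp)
      finally show "norm (rej m e (w i)) \<le> \<epsilon> * \<delta>" .
      show "norm (rej m f (w i)) \<le> \<epsilon> * \<delta>" by (rule w(3)[OF i])
    next
      have "real m * \<epsilon> * \<delta> \<le> 1 / 64 * \<delta>" using \<epsilon> \<delta>0 by (intro mult_right_mono) auto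
      then show "real m * (\<epsilon> * \<delta>) \<le> \<delta> / 4 / 2" using \<delta>0 by (simp add: mult.assoc)
    qed (use f \<delta>0 in auto)
    moreover have "2 * real m * (\<epsilon> * \<delta> + \<epsilon> * \<delta>) / (\<delta> / 4) \<le> 1 / 4" using \<delta>0 \<epsilon> by simp
    ultimately have tl: "tilt m e f (1 / 4)" by (rule tilt_mono)
    define u where "u = (1 / 2) *\<^sub>R (v - proj m e (y - x))"
    have pu: "proj m e u = u" using v(1) orthonormal by (simp add: u_def proj_simps)
    have nu: "norm u = \<delta> / 2" by (simp add: u_def \<delta>_def norm_minus_commute)
    have onff: "orthonormal m f" using f by auto
    obtain z where z: "z \<in> S" "norm (z - y - proj m f u) \<le> \<epsilon> * \<delta>"
      using f(2)[of "proj m f u"] norm_proj_le[OF onff, of u] nu onff by auto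
    have "norm (rej m f u) \<le> 1 / 4 * norm u" using tl pu unfolding tilt_def by metis
    then have ru: "norm (rej m f u) \<le> \<delta> / 8" using nu by simp
    have "norm (z - y) \<le> norm (z - y - proj m f u) + norm (proj m f u)"
      using norm_triangle_ineq[of "z - y - proj m f u" "proj m f u"] by simp
    then have "norm (z - y) \<le> \<delta> * (1 / 2 + \<epsilon>)"
      using z(2) norm_proj_le[OF onff, of u] nu by (simp add: algebra_simps)
    then have zR: "z \<in> S \<inter> cball x R" using near z(1) by simp
    have "proj m e (z - x) - v = proj m e (z - y - proj m f u) - proj m e (rej m f u) - u"
    proof -
      have "z - x = (z - y - proj m f u) + (u - rej m f u) + (y - x)" by (simp add: rej_def)
      then have "proj m e (z - x) = proj m e (z - y - proj m f u) + (u - proj m e (rej m f u)) + proj m e (y - x)"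
        by (simp only: proj_simps pu)
      moreover have "v = 2 *\<^sub>R u + proj m e (y - x)" by (simp add: u_def)
      ultimately show ?thesis by (simp add: scaleR_2)
    qed
    then have "norm (proj m e (z - x) - v) \<le> norm (proj m e (z - y - proj m f u)) + norm (proj m e (rej m f u)) + norm u"
      using norm_triangle_ineq4[of "proj m e (z - y - proj m f u) - proj m e (rej m f u)" u]
        norm_triangle_ineq4[of "proj m e (z - y - proj m f u)" "proj m e (rej m f u)"] by simp
    also have "\<dots> \<le> \<epsilon> * \<delta> + \<delta> / 8 + \<delta> / 2"
      using z(2) ru nu norm_proj_le[OF orthonormal, of "rej m f u"] norm_proj_le[OF orthonormal, of "z - y - proj m f u"]
      by linarith
    also have "\<dots> < \<delta>"
    proof -
      have "\<epsilon> * \<delta> \<le> 1 / 64 * \<delta>" using \<epsilon>' \<delta>0 by (intro mult_right_mono) auto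
      then show ?thesis using \<delta>0 by linarith
    qed
    finally show False using y(2)[OF zR] by (simp add: \<delta>_def)
  qed
  then show ?thesis using y(1) by (auto simp: \<delta>_def)
qed

lemma dyadic_scale:
  fixes t R :: real
  assumes "0 < t" "t \<le> R"
  obtains j :: nat where "R / 2 ^ Suc j < t" "t \<le> R / 2 ^ j"
proof -
  have R: "0 < R" using assms by simp
  obtain N :: nat where "(1/2) ^ N < t / R" using real_arch_pow_inv[of "t / R" "1/2"] assms R by auto
  then have N: "R / 2 ^ N < t" using R by (simp add: field_simps)
  define k where "k = (LEAST k. R / 2 ^ k < t)"
  have k: "R / 2 ^ k < t" unfolding k_def using N by (rule LeastI)
  have "k \<noteq> 0" using k assms by (intro notI) simp
  then obtain j where j: "k = Suc j" using not0_implies_Suc by blast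
  have "\<not> R / 2 ^ j < t" using not_less_Least[of j "\<lambda>k. R / 2 ^ k < t"] j by (simp add: k_def)
  then show thesis using that[of j] k j by simp
qed

definition geo :: "real \<Rightarrow> real" where
  "geo \<kappa> = 1 / (1 - 2 powr - \<kappa>)"

lemma geo_ge_1: "0 < \<kappa> \<Longrightarrow> 1 \<le> geo \<kappa>"
proof -
  assume "0 < \<kappa>"
  then have "2 powr - \<kappa> < 2 powr (0::real)" by (intro powr_less_mono) auto
  then show ?thesis by (simp add: geo_def field_simps)
qed

lemma geo_sum_le:
  assumes "0 < \<kappa>" "0 \<le> R" "0 \<le> K"
  shows "(\<Sum>i\<in>{i..<j}. K * (R / 2 ^ i) powr \<kappa>) \<le> geo \<kappa> * (K * (R / 2 ^ i) powr \<kappa>)"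
proof -
  define q where "q = 2 powr - \<kappa>"
  have q: "0 < q" "q < 1" using powr_less_mono[of "-\<kappa>" 0 2] assms(1) by (auto simp: q_def)
  have pw: "K * (R / 2 ^ (k + i)) powr \<kappa> = K * (R / 2 ^ i) powr \<kappa> * q ^ k" for k
  proof -
    have "(R / 2 ^ (k + i)) powr \<kappa> = (R / 2 ^ i) powr \<kappa> * (1 / 2 ^ k) powr \<kappa>"
      using assms(2) by (subst powr_mult[symmetric]) (auto simp: power_add mult.commute)
    also have "(1 / 2 ^ k) powr \<kappa> = q ^ k"
      by (simp add: q_def powr_divide powr_powr powr_realpow[symmetric] powr_minus_divide mult.commute
          powr_mult[symmetric] inverse_eq_divide power_divide[symmetric])
    finally show ?thesis by simp
  qed
  show ?thesis
  proof (cases "i \<le> j")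
    case True
    have "(\<Sum>i\<in>{i..<j}. K * (R / 2 ^ i) powr \<kappa>) = (\<Sum>k<j - i. K * (R / 2 ^ (k + i)) powr \<kappa>)"
      using True by (simp add: sum.atLeastLessThan_shift_0[of _ i j] atLeast0LessThan add.commute)
    also have "\<dots> = K * (R / 2 ^ i) powr \<kappa> * (\<Sum>k<j - i. q ^ k)"
      by (simp only: pw sum_distrib_left)
    also have "\<dots> \<le> K * (R / 2 ^ i) powr \<kappa> * geo \<kappa>"
    proof (rule mult_left_mono)
      show "(\<Sum>k<j - i. q ^ k) \<le> geo \<kappa>"
        using q by (simp add: geo_def q_def[symmetric] sum_gp_strict divide_right_mono)
    qed (use assms in simp)
    finally show ?thesis by (simp add: mult.commute)
  next
    case False
    have "0 \<le> geo \<kappa>" using geo_ge_1[OF assms(1)] by simp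
    then show ?thesis using False assms by simp
  qed
qed

lemma tilt_chain:
  assumes e: "\<And>j. orthonormal m (e j)" and t: "\<And>j. tilt m (e (Suc j)) (e j) (d j)" and d: "\<And>j. 0 \<le> d j"
    and "i \<le> j"
  shows "tilt m (e j) (e i) (sum d {i..<j})"
  using \<open>i \<le> j\<close>
proof (induction j rule: dec_induct)
  case base
  then show ?case by (simp add: tilt_refl e)
next
  case (step k)
  have "tilt m (e (Suc k)) (e i) (d k + sum d {i..<k})"
    by (rule tilt_trans[OF e e t step.IH]) (simp add: sum_nonneg d)
  then show ?case using step.hyps by (simp add: add.commute)
qed

lemma graphical_of_flat:
  assumes S: "compact S" and m: "1 \<le> m" and \<kappa>: "0 < \<kappa>" and K: "0 \<le> K" and r: "0 < r"
    and fl: "\<And>x s. x \<in> S \<Longrightarrow> 0 < s \<Longrightarrow> s \<le> 16 * r \<Longrightarrow> flat n m S x s (K * s powr \<kappa> * s)"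
    and F: "\<And>x s. x \<in> S \<Longrightarrow> 0 < s \<Longrightarrow> s \<le> r \<Longrightarrow> full n m S \<epsilon> x s"
    and \<epsilon>: "0 \<le> \<epsilon>" "real m * \<epsilon> \<le> 1 / 64"
    and small: "770 * real m * geo \<kappa> * (K * (16 * r) powr \<kappa>) \<le> \<epsilon>"
    and x: "x \<in> S"
  shows "\<exists>e. graphical n m S \<epsilon> x (4 * r) e"
proof -
  define R where "R j = 16 * r / 2 ^ j" for j :: nat
  have R0: "0 < R j" "R j \<le> 16 * r" for j using r by (auto simp: R_def field_simps)
  have RS: "R j = 2 * R (Suc j)" for j by (simp add: R_def)
  define \<omega> where "\<omega> j = K * R j powr \<kappa>" for j
  have \<omega>0: "0 \<le> \<omega> j" for j using K by (simp add: \<omega>_def)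
  have \<omega>S: "\<omega> (Suc j) \<le> \<omega> j" for j
    unfolding \<omega>_def using K R0[of "Suc j"] \<kappa> by (intro mult_left_mono powr_mono2) (auto simp: RS[of j])
  have \<omega>_le: "\<omega> j \<le> \<omega> 0" for j by (induction j) (use \<omega>S order_trans in auto)
  have g1: "1 \<le> geo \<kappa>" by (rule geo_ge_1[OF \<kappa>])
  have sm: "770 * real m * geo \<kappa> * \<omega> 0 \<le> \<epsilon>" using small by (simp add: \<omega>_def R_def)
  have sm1: "770 * (real m * \<omega> 0) \<le> \<epsilon>"
  proof -
    have "1 * (770 * (real m * \<omega> 0)) \<le> geo \<kappa> * (770 * (real m * \<omega> 0))"
      using g1 \<omega>0 by (intro mult_right_mono) auto
    then show ?thesis using sm by (simp add: mult_ac)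
  qed
  have \<epsilon>4: "real m * \<epsilon> \<le> 1 / 4" using \<epsilon> by simp
  have \<epsilon>1: "\<epsilon> \<le> 1 / 64"
  proof -
    have "1 * \<epsilon> \<le> real m * \<epsilon>" using \<epsilon> m by (intro mult_right_mono) auto
    then show ?thesis using \<epsilon> by simp
  qed
  have "\<exists>e. frame n m e \<and> (\<forall>z\<in>S \<inter> cball a (R j). norm (rej m e (z - a)) \<le> \<omega> j * R j)" if "a \<in> S" for a j
    using fl[OF that R0[of j]] by (simp add: flat_def \<omega>_def)
  then obtain e where e: "\<And>a j. a \<in> S \<Longrightarrow> frame n m (e a j)"
    "\<And>a j z. a \<in> S \<Longrightarrow> z \<in> S \<inter> cball a (R j) \<Longrightarrow> norm (rej m (e a j) (z - a)) \<le> \<omega> j * R j"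
    by metis
  have m\<omega>: "128 * (real m * \<omega> j) \<le> 1" for j
  proof -
    have "real m * \<omega> j \<le> real m * \<omega> 0" using \<omega>_le by (intro mult_left_mono) auto
    then show ?thesis using sm1 \<epsilon>1 \<omega>0[of 0] by linarith
  qed
  have step: "tilt m (e a (Suc j)) (e a j) (384 * real m * \<omega> j)" if a: "a \<in> S" for a j
  proof -
    let ?\<sigma> = "R (Suc j) / 16"
    have \<sigma>: "0 < ?\<sigma>" "?\<sigma> \<le> r" using R0[of "Suc j"] by auto
    have "tilt m (e a (Suc j)) (e a j) (8 * real m * (\<omega> (Suc j) * R (Suc j) + \<omega> j * R j) / ?\<sigma>)"
    proof (rule tilt_of_near[OF F[OF a \<sigma>] \<sigma>(1) \<epsilon>4 m])
      show "orthonormal m (e a (Suc j))" "orthonormal m (e a j)" using e(1)[OF a] by auto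
      fix z assume "z \<in> S \<inter> cball a ?\<sigma>"
      then have "z \<in> S \<inter> cball a (R (Suc j))" "z \<in> S \<inter> cball a (R j)"
        using R0(1)[of "Suc j"] by (auto simp: RS[of j])
      then show "norm (rej m (e a (Suc j)) (z - a)) \<le> \<omega> (Suc j) * R (Suc j)"
        "norm (rej m (e a j) (z - a)) \<le> \<omega> j * R j" using e(2)[OF a] by auto
    next
      have "128 * (real m * \<omega> (Suc j)) * R (Suc j) \<le> 1 * R (Suc j)"
        using m\<omega>[of "Suc j"] R0(1)[of "Suc j"] by (intro mult_right_mono) auto
      then show "real m * (\<omega> (Suc j) * R (Suc j)) \<le> ?\<sigma> / 8" by simp
    qed
    moreover have "8 * real m * (\<omega> (Suc j) * R (Suc j) + \<omega> j * R j) / ?\<sigma> = 128 * (real m * (\<omega> (Suc j) + 2 * \<omega> j))"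
      using R0(1)[of "Suc j"] by (simp add: RS[of j] field_simps)
    moreover have "real m * (\<omega> (Suc j) + 2 * \<omega> j) \<le> real m * (3 * \<omega> j)"
      using \<omega>S[of j] by (intro mult_left_mono) auto
    ultimately show ?thesis by (elim tilt_mono) simp
  qed
  have chain: "tilt m (e a j) (e a 0) (384 * real m * (geo \<kappa> * \<omega> 0))" if a: "a \<in> S" for a j
  proof -
    have "tilt m (e a j) (e a 0) (\<Sum>i\<in>{0..<j}. 384 * real m * \<omega> i)"
      by (rule tilt_chain) (use e(1)[OF a] step[OF a] \<omega>0 in auto)
    moreover have "(\<Sum>i\<in>{0..<j}. 384 * real m * \<omega> i) = 384 * real m * (\<Sum>i\<in>{0..<j}. \<omega> i)"
      by (simp only: sum_distrib_left)
    moreover have "(\<Sum>i\<in>{0..<j}. \<omega> i) \<le> geo \<kappa> * \<omega> 0"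
      using geo_sum_le[OF \<kappa>, of "16 * r" K 0 j] r K by (simp add: \<omega>_def R_def)
    ultimately show ?thesis by (elim tilt_mono) (simp add: mult_left_mono)
  qed
  define H where "H = e x 0"
  have H: "frame n m H" unfolding H_def by (rule e(1)[OF x])
  have last: "tilt m (e a 0) H (384 * real m * \<omega> 0)" if a: "a \<in> S" "dist x a \<le> 4 * r" for a
  proof -
    have "tilt m (e a 0) H (8 * real m * (\<omega> 0 * R 0 + 2 * (\<omega> 0 * R 0)) / r)"
    proof (rule tilt_of_near[OF F[OF a(1) r order_refl] r \<epsilon>4 m])
      show "orthonormal m (e a 0)" "orthonormal m H" using e(1)[OF a(1)] H by auto
      fix z assume z: "z \<in> S \<inter> cball a r"
      then have "z \<in> S \<inter> cball a (R 0)" using r by (auto simp: R_def)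
      then show "norm (rej m (e a 0) (z - a)) \<le> \<omega> 0 * R 0" by (rule e(2)[OF a(1)])
      have "dist x z \<le> 5 * r" using z a(2) dist_triangle[of x z a] by auto
      then have "z \<in> S \<inter> cball x (R 0)" "a \<in> S \<inter> cball x (R 0)" using z a r by (auto simp: R_def)
      then have "norm (rej m H (z - x)) \<le> \<omega> 0 * R 0" "norm (rej m H (a - x)) \<le> \<omega> 0 * R 0"
        unfolding H_def using e(2)[OF x] by auto
      moreover have "rej m H (z - a) = rej m H (z - x) - rej m H (a - x)"
        by (simp add: rej_simps)
      ultimately show "norm (rej m H (z - a)) \<le> 2 * (\<omega> 0 * R 0)"
        using norm_triangle_ineq4[of "rej m H (z - x)" "rej m H (a - x)"] by simp
    next
      have "128 * (real m * \<omega> 0) * r \<le> 1 * r" using m\<omega>[of 0] r by (intro mult_right_mono) auto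
      then show "real m * (\<omega> 0 * R 0) \<le> r / 8" by (simp add: R_def)
    qed
    moreover have "8 * real m * (\<omega> 0 * R 0 + 2 * (\<omega> 0 * R 0)) / r = 384 * real m * \<omega> 0"
      using r by (simp add: R_def)
    ultimately show ?thesis by simp
  qed
  have lip: "norm (rej m H (b - a)) \<le> \<epsilon> * norm (b - a)"
    if ab: "a \<in> S \<inter> cball x (4 * r)" "b \<in> S \<inter> cball x (4 * r)" for a b
  proof (cases "a = b")
    case False
    then have t0: "0 < dist a b" by simp
    have "dist a b \<le> 16 * r" using ab dist_triangle3[of a b x] r by (auto simp: dist_commute)
    then obtain j where j: "16 * r / 2 ^ Suc j < dist a b" "dist a b \<le> 16 * r / 2 ^ j"
      using dyadic_scale[OF t0] by blast
    have "b \<in> S \<inter> cball a (R j)" using ab j by (simp add: R_def)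
    then have "norm (rej m (e a j) (b - a)) \<le> \<omega> j * R j" using e(2) ab by auto
    also have "\<dots> \<le> \<omega> 0 * (2 * dist a b)"
      using \<omega>_le \<omega>0 j(1) R0(1)[of j] by (intro mult_mono) (auto simp: R_def)
    finally have 1: "norm (rej m (e a j) (b - a)) \<le> 2 * \<omega> 0 * norm (b - a)"
      by (simp add: dist_norm norm_minus_commute)
    have "tilt m (e a j) H (384 * real m * (geo \<kappa> * \<omega> 0) + 384 * real m * \<omega> 0)"
      by (rule tilt_trans[OF _ _ chain last]) (use ab e(1) H \<omega>0 in auto)
    from rej_via_tilt[OF frame_orthonormal[OF H] this, of "b - a"] 1
    have "norm (rej m H (b - a)) \<le> (2 * \<omega> 0 + (384 * real m * (geo \<kappa> * \<omega> 0) + 384 * real m * \<omega> 0)) * norm (b - a)"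
      by (simp add: algebra_simps)
    also have "\<dots> \<le> \<epsilon> * norm (b - a)"
    proof (rule mult_right_mono)
      have "real m * \<omega> 0 * 1 \<le> real m * \<omega> 0 * geo \<kappa>" using g1 \<omega>0[of 0] by (intro mult_left_mono) auto
      moreover have "\<omega> 0 \<le> real m * \<omega> 0" using m \<omega>0[of 0] by (simp add: mult_le_cancel_right1)
      ultimately have "2 * \<omega> 0 + (384 * real m * (geo \<kappa> * \<omega> 0) + 384 * real m * \<omega> 0) \<le> 770 * (real m * \<omega> 0 * geo \<kappa>)"
        by (simp add: mult_ac)
      also have "\<dots> \<le> \<epsilon>" using sm by (simp add: mult_ac)
      finally show "2 * \<omega> 0 + (384 * real m * (geo \<kappa> * \<omega> 0) + 384 * real m * \<omega> 0) \<le> \<epsilon>" .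
    qed simp
    finally show ?thesis .
  qed (simp add: rej_simps)
  have "\<exists>a\<in>S \<inter> cball x (4 * r). proj m H (a - x) = v" if v: "proj m H v = v" "norm v \<le> 4 * r / 4" for v
    by (rule projection_onto_disc[OF S x H m \<epsilon> lip]) (use F v r in auto)
  then show ?thesis using H lip unfolding graphical_def by blast
qed

section \<open>A uniform graphical scale\<close>

lemma span_frame_in_Grassmannian:
  assumes "frame n m e"
  shows "span (e ` {..<m}) \<in> Grassmannian n m"
proof -
  have f: "fat m e 1" using assms by (auto intro: fat_orthonormal)
  have "span (e ` {..<m}) \<subseteq> R_space n"
    by (rule span_minimal) (use assms subspace_R_space in \<open>auto simp: frame_def\<close>)
  moreover have "dim (span (e ` {..<m})) = m"
    using fat_independent[OF f] by (simp add: dim_eq_card_independent card_image)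
  ultimately show ?thesis by (simp add: Grassmannian_def)
qed

lemma Grassmannian_frame:
  assumes H: "H \<in> Grassmannian n m" and m: "1 \<le> m" "m \<le> n"
  obtains e where "frame n m e" "H = span (e ` {..<m})"
proof -
  have H': "subspace H" "H \<subseteq> R_space n" "dim H = m" using H by (auto simp: Grassmannian_def)
  obtain B where B: "B \<subseteq> H" "independent B" "H \<subseteq> span B" "card B = m"
    using basis_exists[of H] H'(3) by metis
  have fB: "finite B" using B(4) m by (metis card.infinite not_one_le_zero)
  obtain w where w: "bij_betw w {..<m} B"
    using bij_betw_from_nat_into_finite[OF fB] B(4) by blast
  have wB: "w i \<in> B" if "i < m" for i using w that by (auto simp: bij_betw_def)
  obtain e where e: "frame n m e" "\<And>i. i < m \<Longrightarrow> proj m e (w i) = w i"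
    by (rule gram_schmidt[of m w n]) (use wB B(1) H'(2) m in auto)
  have "B \<subseteq> span (e ` {..<m})"
  proof
    fix b assume "b \<in> B"
    then obtain i where "i < m" "b = w i" using w unfolding bij_betw_def by auto
    then show "b \<in> span (e ` {..<m})" using e by (auto simp: in_span_iff_proj)
  qed
  then have "v \<in> span B" if "v \<in> span (e ` {..<m})" for v
    using independent_spans[OF B(2) fB B(4) _ that] by simp
  moreover have "span B \<subseteq> H" by (rule span_minimal[OF B(1) H'(1)])
  moreover have "H \<subseteq> span (e ` {..<m})"
    using B(3) span_minimal[OF \<open>B \<subseteq> span (e ` {..<m})\<close> subspace_span] by blast
  ultimately have "H = span (e ` {..<m})" by blast
  with e(1) show thesis by (rule that)
qed

lemma infdist_bounds:
  assumes e: "orthonormal m e"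
  shows "infdist z ((+) x ` span (e ` {..<m})) \<le> norm (rej m e (z - x))"
proof -
  have "infdist z ((+) x ` span (e ` {..<m})) \<le> dist z (x + proj m e (z - x))"
    using proj_in_span by (intro infdist_le) auto
  also have "\<dots> = norm (rej m e (z - x))" by (simp add: dist_norm rej_def algebra_simps)
  finally show ?thesis .
qed

lemma beta_num_le:
  assumes fl: "flat n m S x s h" and x: "x \<in> S" and s: "0 < s" and h: "0 \<le> h"
  shows "beta_num n m S x s \<le> h / s"
proof -
  obtain e where e: "frame n m e" "\<And>z. z \<in> S \<inter> cball x s \<Longrightarrow> norm (rej m e (z - x)) \<le> h"
    using fl unfolding flat_def by blast
  have xs: "x \<in> S \<inter> cball x s" using x s by simp
  let ?f = "\<lambda>H. SUP z\<in>S \<inter> cball x s. infdist z ((+) x ` H)"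
  have "0 \<le> ?f H" if H: "H \<in> Grassmannian n m" for H
  proof (rule cSUP_upper2[OF _ xs])
    have "x \<in> (+) x ` H" using H subspace_0 by (force simp: Grassmannian_def)
    then have "infdist z ((+) x ` H) \<le> s" if "z \<in> S \<inter> cball x s" for z
      using infdist_le[of x "(+) x ` H" z] that by (auto simp: dist_commute)
    then show "bdd_above ((\<lambda>z. infdist z ((+) x ` H)) ` (S \<inter> cball x s))" by (intro bdd_aboveI2)
  qed (rule infdist_nonneg)
  then have "bdd_below (?f ` Grassmannian n m)" by (intro bdd_belowI2)
  then have "(INF H\<in>Grassmannian n m. ?f H) \<le> ?f (span (e ` {..<m}))"
    by (rule cINF_lower[OF _ span_frame_in_Grassmannian[OF e(1)]])
  also have "\<dots> \<le> h"
    by (rule cSUP_least) (use xs e infdist_bounds[OF frame_orthonormal[OF e(1)]] in \<open>auto intro: order_trans\<close>)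
  finally show ?thesis using s by (simp add: beta_num_def divide_right_mono)
qed

lemma flat_full_of_theta:
  assumes th: "theta_num n m S x s < h / s" and x: "x \<in> S" and s: "0 < s" and m: "1 \<le> m" "m \<le> n"
  shows "flat n m S x s h \<and> full n m S (2 * h / s) x s"
proof -
  let ?d = "\<lambda>H. haus_dist (S \<inter> cball x s) ((+) x ` H \<inter> cball x s)"
  have "(INF H\<in>Grassmannian n m. ?d H) < h" using th s by (simp add: theta_num_def divide_strict_right_mono field_simps)
  moreover have "?d ` Grassmannian n m \<noteq> {}"
    using span_frame_in_Grassmannian[OF frame_single[OF m(2)]] by blast
  ultimately obtain H where H: "H \<in> Grassmannian n m" "?d H < h"
    using cInf_lessD by (metis (no_types, lifting) imageE)
  obtain e where e: "frame n m e" and He: "H = span (e ` {..<m})"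
    using Grassmannian_frame[OF H(1) m] by metis
  have orthonormal: "orthonormal m e" using e by auto
  let ?F = "(+) x ` H \<inter> cball x s" and ?E = "S \<inter> cball x s"
  have "0 \<in> H" unfolding He by (rule span_zero)
  then have xF: "x \<in> ?F" using s by force
  have xE: "x \<in> ?E" using x s by simp
  have b1: "bdd_above ((\<lambda>y. infdist y ?F) ` ?E)"
    by (rule bdd_aboveI2[of _ _ s]) (use infdist_le[OF xF] in \<open>auto simp: dist_commute intro: order_trans\<close>)
  have b2: "bdd_above ((\<lambda>y. infdist y ?E) ` ?F)"
    by (rule bdd_aboveI2[of _ _ s]) (use infdist_le[OF xE] in \<open>auto simp: dist_commute intro: order_trans\<close>)
  have s1: "infdist y ?F \<le> (SUP y\<in>?E. infdist y ?F)" if "y \<in> ?E" for y by (rule cSUP_upper[OF that b1])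
  have s2: "infdist y ?E \<le> (SUP y\<in>?F. infdist y ?E)" if "y \<in> ?F" for y by (rule cSUP_upper[OF that b2])
  have "0 \<le> (SUP y\<in>?E. infdist y ?F)" "0 \<le> (SUP y\<in>?F. infdist y ?E)"
    using s1[OF xE] s2[OF xF] infdist_nonneg order_trans by blast+
  moreover have "(SUP y\<in>?E. infdist y ?F) + (SUP y\<in>?F. infdist y ?E) < h"
    using H(2) by (simp add: haus_dist_def)
  ultimately have less: "(SUP y\<in>?E. infdist y ?F) < h" "(SUP y\<in>?F. infdist y ?E) < h" "0 < h" by linarith+
  have near: "\<exists>q\<in>Q. dist y q < h'" if "infdist y Q < h'" "Q \<noteq> {}" for y :: "real finseq" and Q h'
    using that by (auto simp: infdist_def dest!: cInf_lessD[rotated])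
  have "flat n m S x s h" unfolding flat_def
  proof (intro exI conjI ballI)
    fix z assume "z \<in> ?E"
    then have "infdist z ?F < h" using s1 less(1) by (meson le_less_trans)
    then obtain q where q: "q \<in> ?F" "dist z q < h" using near xF by blast
    then obtain v where v: "q = x + v" "proj m e v = v" using He orthonormal by (auto simp: in_span_iff_proj)
    have "norm (rej m e (z - x)) \<le> norm (z - x - v)" by (rule norm_rej_le_dist[OF orthonormal v(2)])
    then show "norm (rej m e (z - x)) \<le> h" using q(2) v(1) by (simp add: dist_norm algebra_simps)
  qed (rule e)
  moreover have "full n m S (2 * h / s) x s" unfolding full_def
  proof (intro exI conjI allI impI)
    fix v assume v: "proj m e v = v" "norm v \<le> s / 2"
    then have "v \<in> H" unfolding He using orthonormal by (simp add: in_span_iff_proj)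
    then have "x + v \<in> ?F" using v(2) s by (auto simp: dist_norm)
    then have "infdist (x + v) ?E < h" using s2 less(2) by (meson le_less_trans)
    then obtain z where z: "z \<in> ?E" "dist (x + v) z < h" using near xE by blast
    then have "norm (z - x - v) \<le> 2 * h / s * s"
      using less(3) s by (simp add: dist_norm norm_minus_commute algebra_simps)
    then show "\<exists>z\<in>S. norm (z - x - v) \<le> 2 * h / s * s" using z(1) by blast
  qed (rule e)
  ultimately show ?thesis by blast
qed

lemma mass_lb_of_Ahlfors:
  assumes S: "S \<subseteq> R_space n" "compact S" and pos: "0 < n" "0 < m" "0 < l" and A: "0 < A"
    and ahl: "\<And>x \<rho>. x \<in> S \<Longrightarrow> 0 < \<rho> \<Longrightarrow> \<rho> \<le> r \<Longrightarrow> ennreal (A * \<rho> ^ m) \<le> hausdorff (real m) (S \<inter> ball x \<rho>)"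
  shows "\<exists>c>0. mass_lb m l S c r"
proof -
  define F where "F = frostman_const n m"
  have F0: "0 < F" using pos by (simp add: F_def frostman_const_def)
  define c where "c = unit_ball_vol (real (m * l)) / (2 * 2 powr real (m * l)) * (A / (2 * F)) ^ l"
  have "0 < c" using F0 A by (simp add: c_def)
  moreover have "mass_lb m l S c r" unfolding mass_lb_def
  proof (intro allI impI)
    fix \<rho> y assume \<rho>: "0 < \<rho>" "\<rho> \<le> r" and y: "\<forall>i<l. y i \<in> S"
    define a where "a = A * \<rho> ^ m / 2"
    have a0: "0 < a" using A \<rho> by (simp add: a_def)
    have "ennreal (unit_ball_vol (real (m * l)) / (2 * 2 powr real (m * l) * (F / a) ^ l))
        \<le> hausdorff (real (m * l)) (prodset l (\<lambda>i. S \<inter> cball (y i) \<rho>))"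
      unfolding F_def
    proof (rule hausdorff_prodset_ge[OF _ _ pos a0])
      fix i assume i: "i < l"
      show "compact (S \<inter> cball (y i) \<rho>)" using S by (intro compact_Int_closed) auto
      show "S \<inter> cball (y i) \<rho> \<subseteq> R_space n" using S by auto
      have "ennreal a < ennreal (A * \<rho> ^ m)" using A \<rho> by (simp add: a_def ennreal_less_iff)
      also have "\<dots> \<le> hausdorff (real m) (S \<inter> ball (y i) \<rho>)" using ahl y i \<rho> by blast
      also have "\<dots> \<le> hausdorff (real m) (S \<inter> cball (y i) \<rho>)" by (rule hausdorff_mono) auto
      finally show "ennreal a < hausdorff (real m) (S \<inter> cball (y i) \<rho>)" .
    qed
    also have "unit_ball_vol (real (m * l)) / (2 * 2 powr real (m * l) * (F / a) ^ l) = c * \<rho> ^ (m * l)"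
    proof -
      have 1: "(A / (2 * F)) ^ l * \<rho> ^ (m * l) = (a / F) ^ l"
        by (simp add: a_def power_mult power_mult_distrib[symmetric])
      have 2: "X / (Y * (F / a) ^ l) = X / Y * (a / F) ^ l" for X Y :: real
        by (simp add: power_divide)
      show ?thesis unfolding 2 1[symmetric] c_def by (rule mult.assoc[symmetric])
    qed
    finally show "ennreal (c * \<rho> ^ (m * l)) \<le> hausdorff (real (m * l)) (prodset l (\<lambda>i. S \<inter> cball (y i) \<rho>))" .
  qed
  ultimately show ?thesis by blast
qed

lemma small_scale:
  fixes \<kappa> c \<epsilon> :: real
  assumes "0 < \<kappa>" "0 < \<epsilon>" "0 \<le> c"
  obtains s0 where "0 < s0" "\<And>s. 0 < s \<Longrightarrow> s \<le> s0 \<Longrightarrow> c * s powr \<kappa> \<le> \<epsilon>"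
proof
  let ?s = "(\<epsilon> / (c + 1)) powr (1 / \<kappa>)"
  show "0 < ?s" using assms by simp
  fix s assume s: "0 < s" "s \<le> ?s"
  have "s powr \<kappa> \<le> ?s powr \<kappa>" using s assms by (intro powr_mono2) auto
  also have "\<dots> = \<epsilon> / (c + 1)" using assms by (simp add: powr_powr)
  finally have "c * s powr \<kappa> \<le> c * (\<epsilon> / (c + 1))" using assms by (intro mult_left_mono) auto
  also have "\<dots> \<le> \<epsilon>" using assms by (simp add: field_simps)
  finally show "c * s powr \<kappa> \<le> \<epsilon>" .
qed

definition eps :: "nat \<Rightarrow> real" where
  "eps m = 1 / (128 * real m)"

lemma eps_bounds: "1 \<le> m \<Longrightarrow> 0 < eps m" "1 \<le> m \<Longrightarrow> real m * eps m = 1 / 128" "1 \<le> m \<Longrightarrow> eps m \<le> 1 / 128"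
  by (simp_all add: eps_def field_simps)

lemma first_exponent_pos:
  assumes "real (m * l) < p"
  shows "0 < first_exponent m l p"
proof -
  have "0 < p" using assms by (meson le_less_trans of_nat_0_le_iff)
  then have "0 < real (m + 1) * p + real (m * l)" by (intro add_pos_nonneg) auto
  then show ?thesis unfolding first_exponent_def using assms by (intro divide_pos_pos mult_pos_pos) auto
qed

lemma graphical_start:
  assumes ml: "1 \<le> m" "1 \<le> l" "l \<le> m + 2" "m \<le> n" and p: "real (m * l) < p" and E: "0 \<le> E"
    and fine: "fine_set n m S" and en: "energy m l p S \<le> ennreal E"
  shows "\<exists>r>0. \<forall>x\<in>S. \<exists>e. graphical n m S (eps m) x r e"
proof -
  have S: "S \<subseteq> R_space n" "compact S" using fine by (auto simp: fine_set_def)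
  have "\<exists>R>0. \<exists>A>0. \<forall>x\<in>S. \<forall>r. 0 < r \<and> r \<le> R \<longrightarrow> hausdorff (real m) (S \<inter> ball x r) \<ge> ennreal (A * r ^ m)"
    using fine unfolding fine_set_def by (elim conjE)
  then obtain R1 A where R1: "0 < R1" "0 < A"
    "\<forall>x\<in>S. \<forall>r. 0 < r \<and> r \<le> R1 \<longrightarrow> hausdorff (real m) (S \<inter> ball x r) \<ge> ennreal (A * r ^ m)"
    by (elim exE conjE)
  note A = R1(1,2) R1(3)[rule_format, OF _ conjI]
  have "\<exists>R>0. \<exists>M>1. \<forall>x\<in>S. \<forall>r. 0 < r \<and> r \<le> R \<longrightarrow> theta_num n m S x r \<le> M * beta_num n m S x r"
    using fine unfolding fine_set_def by (elim conjE)
  then obtain R2 M where R2: "0 < R2" "1 < M"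
    "\<forall>x\<in>S. \<forall>r. 0 < r \<and> r \<le> R2 \<longrightarrow> theta_num n m S x r \<le> M * beta_num n m S x r"
    by (elim exE conjE)
  note M = R2(1,2) R2(3)[rule_format, OF _ conjI]
  obtain c where c: "0 < c" "mass_lb m l S c R1"
    using mass_lb_of_Ahlfors[OF S, of m l A R1] A ml by auto
  define \<kappa> where "\<kappa> = first_exponent m l p"
  have \<kappa>: "0 < \<kappa>" unfolding \<kappa>_def by (rule first_exponent_pos[OF p])
  obtain K where K: "0 < K" "\<And>x s. x \<in> S \<Longrightarrow> 0 < s \<Longrightarrow> s \<le> 16 * R1 \<Longrightarrow> flat n m S x s (K * s powr \<kappa> * s)"
    using flat_of_energy[OF ml(1-3) p c(1) E] S ml(4) en c(2) unfolding \<kappa>_def by metis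
  define K' where "K' = M * K + 1"
  have K'0: "0 < K'" using M K by (simp add: K'_def add_pos_pos)
  have both: "flat n m S x s (K' * s powr \<kappa> * s) \<and> full n m S (2 * (K' * s powr \<kappa>)) x s"
    if x: "x \<in> S" and s: "0 < s" "s \<le> R1" "s \<le> R2" for x s
  proof -
    have "beta_num n m S x s \<le> K * s powr \<kappa> * s / s"
      by (rule beta_num_le) (use K x s A in auto)
    then have "M * beta_num n m S x s \<le> M * (K * s powr \<kappa>)" using M s by simp
    then have "theta_num n m S x s \<le> M * (K * s powr \<kappa>)" using M(3)[OF x s(1,3)] by simp
    also have "\<dots> < K' * s powr \<kappa>" using s by (simp add: K'_def algebra_simps)
    also have "\<dots> = K' * s powr \<kappa> * s / s" using s by simp
    finally show ?thesis using flat_full_of_theta[OF _ x s(1) ml(1,4), of "K' * s powr \<kappa> * s"] s by simp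
  qed
  have g1: "1 \<le> geo \<kappa>" by (rule geo_ge_1[OF \<kappa>])
  obtain s0 where s0: "0 < s0" "\<And>s. 0 < s \<Longrightarrow> s \<le> s0 \<Longrightarrow> 770 * real m * geo \<kappa> * K' * s powr \<kappa> \<le> eps m"
    using small_scale[OF \<kappa> eps_bounds(1)[OF ml(1)], of "770 * real m * geo \<kappa> * K'"] g1 K'0 by auto
  define r where "r = min R1 (min R2 s0) / 16"
  have r: "0 < r" "16 * r \<le> R1" "16 * r \<le> R2" "16 * r \<le> s0" using A(1) M(1) s0(1) by (auto simp: r_def)
  have "\<exists>e. graphical n m S (eps m) x (4 * r) e" if x: "x \<in> S" for x
  proof (rule graphical_of_flat[OF S(2) ml(1) \<kappa> _ r(1)])
    show "0 \<le> K'" using K'0 by simp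
    show "flat n m S x s (K' * s powr \<kappa> * s)" if "x \<in> S" "0 < s" "s \<le> 16 * r" for x s
      using both[of x s] that r by simp
    show "full n m S (eps m) x s" if "x \<in> S" "0 < s" "s \<le> r" for x s
    proof -
      have "1 * (2 * (K' * s powr \<kappa>)) \<le> (385 * (real m * geo \<kappa>)) * (2 * (K' * s powr \<kappa>))"
      proof (rule mult_right_mono)
        have "1 * 1 \<le> real m * geo \<kappa>" using ml(1) g1 by (intro mult_mono) auto
        then show "1 \<le> 385 * (real m * geo \<kappa>)" by simp
      qed (use K'0 in simp)
      also have "\<dots> \<le> eps m" using s0(2)[of s] that r by (simp add: mult_ac)
      finally have le: "2 * (K' * s powr \<kappa>) \<le> eps m" by simp
      have "full n m S (2 * (K' * s powr \<kappa>)) x s" using both[of x s] that r by simp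
      then obtain f where f: "frame n m f"
        "\<And>v. proj m f v = v \<Longrightarrow> norm v \<le> s / 2 \<Longrightarrow> \<exists>z\<in>S. norm (z - x - v) \<le> 2 * (K' * s powr \<kappa>) * s"
        unfolding full_def by blast
      have "2 * (K' * s powr \<kappa>) * s \<le> eps m * s" using le that by (intro mult_right_mono) auto
      then show ?thesis unfolding full_def using f by (meson order_trans)
    qed
    show "0 \<le> eps m" "real m * eps m \<le> 1 / 64" using eps_bounds[OF ml(1)] by auto
    show "770 * real m * geo \<kappa> * (K' * (16 * r) powr \<kappa>) \<le> eps m"
      using s0(2)[of "16 * r"] r by (simp add: mult_ac)
  qed (rule x)
  then show ?thesis using r(1) by (intro exI[of _ "4 * r"]) auto
qed

text \<open>As long as \<open>S\<close> is graphical at scale \<open>r\<close>, it has controlled measure there, so the energy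
  bounds its flatness up to scale \<open>16 r\<close> independently of the constants in \<open>fine_set\<close>. Hence the
  scale can be doubled until it reaches a size depending on \<open>E\<close>, \<open>m\<close>, \<open>l\<close>, \<open>p\<close> only.\<close>

lemma graphical_uniform:
  assumes ml: "1 \<le> m" "1 \<le> l" "l \<le> m + 2" and p: "real (m * l) < p" and E: "0 \<le> E"
  obtains r where "0 < r" "\<And>n S x. m \<le> n \<Longrightarrow> fine_set n m S \<Longrightarrow> energy m l p S \<le> ennreal E \<Longrightarrow> x \<in> S \<Longrightarrow>
    \<exists>e. graphical n m S (eps m) x r e"
proof -
  define \<kappa> where "\<kappa> = first_exponent m l p"
  have \<kappa>: "0 < \<kappa>" unfolding \<kappa>_def by (rule first_exponent_pos[OF p])
  obtain K where K: "0 < K" "\<And>n S r x s. m \<le> n \<Longrightarrow> S \<subseteq> R_space n \<Longrightarrow> compact S \<Longrightarrow>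
    energy m l p S \<le> ennreal E \<Longrightarrow> mass_lb m l S (lb_const m l) r \<Longrightarrow> x \<in> S \<Longrightarrow> 0 < s \<Longrightarrow> s \<le> 16 * r \<Longrightarrow>
    flat n m S x s (K * s powr \<kappa> * s)"
    using flat_of_energy[OF ml p lb_const_pos[OF ml(1)] E] unfolding \<kappa>_def by metis
  have g1: "1 \<le> geo \<kappa>" by (rule geo_ge_1[OF \<kappa>])
  obtain R0 where R0: "0 < R0" "\<And>s. 0 < s \<Longrightarrow> s \<le> R0 \<Longrightarrow> 770 * real m * geo \<kappa> * K * s powr \<kappa> \<le> eps m"
    using small_scale[OF \<kappa> eps_bounds(1)[OF ml(1)], of "770 * real m * geo \<kappa> * K"] g1 K(1) by auto
  have eps: "0 \<le> eps m" "eps m \<le> 1 / 2" "real m * eps m \<le> 1 / 64" using eps_bounds[OF ml(1)] by auto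
  have "\<exists>e. graphical n m S (eps m) x (R0 / 8) e"
    if n: "m \<le> n" and fine: "fine_set n m S" and en: "energy m l p S \<le> ennreal E" and x: "x \<in> S" for n S x
  proof -
    have S: "S \<subseteq> R_space n" "compact S" using fine by (auto simp: fine_set_def)
    let ?G = "\<lambda>r. \<forall>x\<in>S. \<exists>e. graphical n m S (eps m) x r e"
    have mono: "?G r'" if "?G r" "0 < r'" "r' \<le> r" for r r'
      using that graphical_mono eps(2) by meson
    have double: "?G (2 * r)" if G: "?G r" and r: "0 < r" "8 * r \<le> R0" for r
    proof
      fix x assume x: "x \<in> S"
      have lb: "mass_lb m l S (lb_const m l) r"
        by (rule mass_lb_of_graphical[OF S(2) _ eps(2) ml(1,2)]) (use G in blast)
      have "\<exists>e. graphical n m S (eps m) x (4 * (r / 2)) e"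
      proof (rule graphical_of_flat[OF S(2) ml(1) \<kappa>, where K = K])
        show "flat n m S x s (K * s powr \<kappa> * s)" if "x \<in> S" "0 < s" "s \<le> 16 * (r / 2)" for x s
          using that r by (intro K(2)[OF n S en lb]) auto
        show "full n m S (eps m) x s" if "x \<in> S" "0 < s" "s \<le> r / 2" for x s
          using G that graphical_full eps by blast
        show "770 * real m * geo \<kappa> * (K * (16 * (r / 2)) powr \<kappa>) \<le> eps m"
          using R0(2)[of "8 * r"] r by (simp add: mult_ac)
      qed (use x K(1) r eps in auto)
      then show "\<exists>e. graphical n m S (eps m) x (2 * r) e" by simp
    qed
    obtain r0 where r0: "0 < r0" "?G r0"
      using graphical_start[OF ml n p E fine en] by blast
    have "?G (R0 / 8)"
    proof (cases "R0 / 8 \<le> r0")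
      case True
      then show ?thesis using mono[OF r0(2)] R0(1) by simp
    next
      case False
      then have "r0 \<le> R0 / 4" using R0(1) by simp
      then obtain j :: nat where j: "R0 / 4 / 2 ^ Suc j < r0" "r0 \<le> R0 / 4 / 2 ^ j"
        using dyadic_scale[OF r0(1)] by metis
      have "?G (2 ^ k * r0)" if "k \<le> j" for k
        using that
      proof (induction k)
        case (Suc k)
        have "(2::real) ^ Suc k * r0 \<le> 2 ^ j * r0"
          using Suc.prems r0(1) by (intro mult_right_mono power_increasing) auto
        also have "\<dots> \<le> R0 / 4" using j(2) by (simp add: field_simps)
        finally have "8 * (2 ^ k * r0) \<le> R0" by simp
        then have "?G (2 * (2 ^ k * r0))" using Suc r0(1) by (intro double) auto
        then show ?case by (simp add: mult.assoc)
      qed (use r0 in simp)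
      then have "?G (2 ^ j * r0)" by simp
      moreover have "R0 / 8 \<le> 2 ^ j * r0" using j(1) by (simp add: field_simps)
      ultimately show ?thesis using mono R0(1) by simp
    qed
    then show ?thesis using x by blast
  qed
  moreover have "0 < R0 / 8" using R0 by simp
  ultimately show thesis using that by blast
qed

section \<open>The optimal exponent\<close>

lemma continuous_on_truncate:
  "continuous_on A (\<lambda>t :: 'a::real_inner finseq. mk l (coord t))"
proof -
  have "mk l (coord t) = (\<Sum>i<l. single i (coord t i))" for t :: "'a finseq"
  proof -
    have "coord (\<Sum>i<k. single i (coord t i)) j = (if j < k then coord t j else 0)" for k j
      by (induction k) (auto simp: less_Suc_eq)
    then show ?thesis by (intro finseq_eqI) simp
  qed
  then show ?thesis by (simp add: continuous_intros)
qed

lemma compact_affine_distance: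
  fixes K :: "nat \<Rightarrow> 'a::real_inner set"
  assumes "\<And>i. i < m + 2 \<Longrightarrow> compact (K i)"
  shows "compact {t \<in> prodset (m + 2) K. \<forall>a. h \<le> norm (coord t (m + 1) - coord t 0 - (\<Sum>i<m. a i *\<^sub>R (coord t (Suc i) - coord t 0)))}"
proof -
  have "{t \<in> prodset (m + 2) K. \<forall>a. h \<le> norm (coord t (m + 1) - coord t 0 - (\<Sum>i<m. a i *\<^sub>R (coord t (Suc i) - coord t 0)))}
    = prodset (m + 2) K \<inter> (\<Inter>a. {t. h \<le> norm (coord t (m + 1) - coord t 0 - (\<Sum>i<m. a i *\<^sub>R (coord t (Suc i) - coord t 0)))})"
    by auto
  also have "compact \<dots>"
    by (intro compact_Int_closed compact_prodset assms closed_INT ballI closed_Collect_le continuous_intros)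
  finally show ?thesis .
qed

definition bad_const :: "nat \<Rightarrow> real" where
  "bad_const m = vol_const (m + 1) / (8 ^ m * 5 ^ (m + 2))"

lemma bad_const_pos: "0 < bad_const m"
  using vol_const_pos[of "m + 1"] by (simp add: bad_const_def)

text \<open>The energy bound makes it improbable that a random point near \<open>c j\<close> has distance at least \<open>h\<close>
  from the affine span of random points near \<open>y 0, \<dots>, y m\<close>; a union bound gives one affine
  span that is good for all \<open>j\<close> simultaneously.\<close>

lemma good_points:
  assumes ml: "1 \<le> m" "1 \<le> l" "l \<le> m + 2" and p: "0 \<le> p" and E: "0 \<le> E"
    and S: "compact S" and G: "\<And>x. x \<in> S \<Longrightarrow> \<exists>e. graphical n m S (eps m) x r e"
    and en: "energy m l p S \<le> ennreal E"
    and y: "\<And>i. i \<le> m \<Longrightarrow> y i \<in> S" "\<And>i. i \<le> m \<Longrightarrow> dist (y i) (y 0) \<le> s"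
    and fat: "fat m (\<lambda>i. y (Suc i) - y 0) (s / 4)"
    and c: "\<And>j. j < N \<Longrightarrow> c j \<in> S" "\<And>j. j < N \<Longrightarrow> dist (c j) (y 0) \<le> 2 * s"
    and \<rho>: "\<rho> = s / (16 * real m)" "\<rho> \<le> r" "0 < \<rho>'" "\<rho>' \<le> \<rho>" and h: "0 < h" and N: "0 < N"
    and small: "real N * (((8 * real m / \<rho>') ^ m) ^ l * (2 powr real (m * l) / unit_ball_vol (real (m * l)))
      * ((E + 1) / (bad_const m * h / s ^ 2) powr p)) < 1"
  obtains X Z where "\<And>i. i \<le> m \<Longrightarrow> X i \<in> S \<inter> cball (y i) \<rho>" "\<And>j. j < N \<Longrightarrow> Z j \<in> S \<inter> cball (c j) \<rho>'"
    "\<And>j. j < N \<Longrightarrow> \<exists>a. norm (Z j - X 0 - (\<Sum>i<m. a i *\<^sub>R (X (Suc i) - X 0))) < h"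
proof -
  have \<rho>0: "0 < \<rho>" using \<rho> by linarith
  have s: "0 < s" using \<rho>0 \<rho>(1) ml by (simp add: zero_less_divide_iff)
  have \<rho>s: "\<rho> \<le> s / 16" unfolding \<rho>(1) using ml s by (intro divide_left_mono) auto
  have eps: "eps m \<le> 1 / 2" using eps_bounds[OF ml(1)] by simp
  define K where "K j i = (if i \<le> m then S \<inter> cball (y i) \<rho> else S \<inter> cball (c j) \<rho>')" for j i
  define BT where "BT j = {t \<in> prodset (m + 2) (K j). \<forall>a. h \<le> norm (coord t (m + 1) - coord t 0 - (\<Sum>i<m. a i *\<^sub>R (coord t (Suc i) - coord t 0)))}" for j
  define Bl where "Bl j = (\<lambda>t. mk l (coord t)) ` BT j" for j
  have compBT: "compact (BT j)" for j
    unfolding BT_def by (rule compact_affine_distance) (auto simp: K_def intro!: compact_Int_closed S)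
  have compBl: "compact (Bl j)" for j
    unfolding Bl_def by (rule compact_continuous_image[OF continuous_on_truncate compBT])
  define c1 where "c1 = bad_const m * h / s ^ 2"
  have c10: "0 < c1" using bad_const_pos[of m] h s by (simp add: c1_def)
  define H0 where "H0 = (E + 1) / c1 powr p"
  have H00: "0 < H0" using E c10 by (simp add: H0_def)
  have curv: "c1 \<le> menger_curv m (coord t)" if t: "t \<in> BT j" and j: "j < N" for t j
  proof -
    let ?x = "coord t"
    have tK: "?x i \<in> K j i" if "i \<le> m + 1" for i
      using t that by (auto simp: BT_def prodset_def)
    have ti: "dist (?x i) (y i) \<le> \<rho>" if "i \<le> m" for i
      using tK[of i] that by (simp add: K_def dist_commute)
    have tm: "dist (?x (m + 1)) (c j) \<le> \<rho>'" using tK[of "m + 1"] by (simp add: K_def dist_commute)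
    define \<rho>s where "\<rho>s i = (if i < m then s / 8 else h)" for i
    have "vol_const (m + 1) * (\<Prod>i\<le>m. \<rho>s i) / (5 * s) ^ (m + 2) \<le> menger_curv m ?x"
    proof (rule menger_curv_ge)
      show "0 < \<rho>s i" for i using s h by (simp add: \<rho>s_def)
      have fat': "fat m (\<lambda>i. ?x (Suc i) - ?x 0) (s / 4 / 2)"
      proof (rule fat_perturb[OF fat])
        fix i assume i: "i < m"
        have eq: "?x (Suc i) - ?x 0 - (y (Suc i) - y 0) = (?x (Suc i) - y (Suc i)) - (?x 0 - y 0)" by simp
        show "norm (?x (Suc i) - ?x 0 - (y (Suc i) - y 0)) \<le> 2 * \<rho>"
          unfolding eq using norm_triangle_ineq4[of "?x (Suc i) - y (Suc i)" "?x 0 - y 0"]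
            ti[of "Suc i"] ti[of 0] i by (simp add: dist_norm)
      next
        show "real m * (2 * \<rho>) \<le> s / 4 / 2" using ml by (simp add: \<rho>(1))
      qed
      fix i a assume i: "i \<le> m"
      show "\<rho>s i * \<bar>a i\<bar> \<le> norm (\<Sum>k\<le>i. a k *\<^sub>R (?x (Suc k) - ?x 0))"
      proof (cases "i < m")
        case True
        then show ?thesis using fat_triangular[OF fat' True, of a] by (simp add: \<rho>s_def)
      next
        case False
        then have im: "i = m" using i by simp
        show ?thesis
        proof (cases "a m = 0")
          case False
          define b where "b k = - a k / a m" for k
          have "(\<Sum>k\<le>m. a k *\<^sub>R (?x (Suc k) - ?x 0)) = a m *\<^sub>R (?x (m + 1) - ?x 0 - (\<Sum>k<m. b k *\<^sub>R (?x (Suc k) - ?x 0)))"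
            using False by (simp add: lessThan_Suc_atMost[symmetric] scaleR_diff_right scaleR_sum_right b_def sum_negf sum_subtractf)
          then have "norm (\<Sum>k\<le>m. a k *\<^sub>R (?x (Suc k) - ?x 0)) = \<bar>a m\<bar> * norm (?x (m + 1) - ?x 0 - (\<Sum>k<m. b k *\<^sub>R (?x (Suc k) - ?x 0)))"
            by simp
          also have "\<dots> \<ge> \<bar>a m\<bar> * h" using t by (intro mult_left_mono) (auto simp: BT_def)
          finally show ?thesis by (simp add: im \<rho>s_def mult.commute)
        qed (simp add: im)
      qed
    next
      have near: "dist (?x i) (y 0) \<le> 5 / 2 * s" if "i \<le> m + 1" for i
      proof (cases "i \<le> m")
        case True
        then show ?thesis using dist_triangle[of "?x i" "y 0" "y i"] ti[OF True] y(2)[OF True] \<rho>s s by linarith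
      next
        case False
        then have "i = m + 1" using that by simp
        then show ?thesis using dist_triangle[of "?x (m + 1)" "y 0" "c j"] tm c(2)[OF j] \<rho>s \<rho>(4) s by simp
      qed
      show "dist (?x i) (?x k) \<le> 5 * s" if "i \<le> m + 1" "k \<le> m + 1" for i k
        using dist_triangle2[of "?x i" "?x k" "y 0"] near[OF that(1)] near[OF that(2)] by linarith
    qed
    also have "vol_const (m + 1) * (\<Prod>i\<le>m. \<rho>s i) / (5 * s) ^ (m + 2) = c1"
    proof -
      have "(\<Prod>i\<le>m. \<rho>s i) = (s / 8) ^ m * h"
        by (simp add: lessThan_Suc_atMost[symmetric] \<rho>s_def)
      then show ?thesis using s
        by (simp add: c1_def bad_const_def power_mult_distrib power_divide power_add field_simps power2_eq_square)
    qed
    finally show ?thesis .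
  qed
  have haus: "hausdorff (real (m * l)) (Bl j) < ennreal H0" if j: "j < N" for j
  proof (rule ccontr)
    assume "\<not> ?thesis"
    then have ge: "ennreal H0 \<le> hausdorff (real (m * l)) (Bl j)" by simp
    have "c1 powr p * H0 \<le> E"
    proof (rule energy_ge_real[OF en E compBl[of j] _ ge])
      have KS: "K j i \<subseteq> S" for i by (simp add: K_def)
      show "Bl j \<subseteq> tuples l S"
      proof
        fix t assume "t \<in> Bl j"
        then obtain u where u: "u \<in> prodset (m + 2) (K j)" "t = mk l (coord u)" by (auto simp: Bl_def BT_def)
        then have "coord u i \<in> S" if "i < l" for i
          using that ml(3) subsetD[OF KS, of "coord u i" i] by (simp add: prodset_def)
        then show "t \<in> tuples l S" by (simp add: u(2) tuples_def)
      qed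
      fix t assume "t \<in> Bl j"
      then obtain u where u: "u \<in> BT j" "t = mk l (coord u)" by (auto simp: Bl_def)
      show "\<exists>x. (\<forall>i<l. x i = coord t i) \<and> (\<forall>i\<in>{l..m + 1}. x i \<in> S) \<and> c1 \<le> menger_curv m x"
      proof (intro exI[of _ "coord u"] conjI ballI)
        show "\<forall>i<l. coord u i = coord t i" by (simp add: u(2))
        show "c1 \<le> menger_curv m (coord u)" by (rule curv[OF u(1) j])
        fix i assume "i \<in> {l..m + 1}"
        then show "coord u i \<in> S" using u(1) subsetD[OF KS, of "coord u i" i] by (simp add: BT_def prodset_def)
      qed
    qed (use H00 c10 p in auto)
    then show False using c10 by (simp add: H0_def)
  qed
  let ?T = "2 powr real (m * l) / unit_ball_vol (real (m * l))"
  have "\<exists>\<eta>>0. \<forall>q M. 0 \<le> M \<longrightarrow> growth (real (m * l)) M \<eta> 1 q \<longrightarrow> measure_pmf.prob q (Bl j) \<le> M * ?T * H0"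
    if j: "j < N" for j
  proof -
    have "0 < real (m * l)" using ml by simp
    then obtain \<eta> where \<eta>: "0 < \<eta>" "\<And>q M. 0 \<le> M \<Longrightarrow> growth (real (m * l)) M \<eta> 1 q \<Longrightarrow>
        measure_pmf.prob q (Bl j) \<le> M * ?T * H0"
      using mass_distribution[OF compBl[of j] _ haus[OF j] zero_less_one] by (auto simp del: of_nat_mult)
    show ?thesis by (intro exI[of _ \<eta>] conjI allI impI \<eta>)
  qed
  then obtain \<eta>j where \<eta>j: "\<And>j. j < N \<Longrightarrow> 0 < \<eta>j j"
    "\<And>j q M. j < N \<Longrightarrow> 0 \<le> M \<Longrightarrow> growth (real (m * l)) M (\<eta>j j) 1 q \<Longrightarrow> measure_pmf.prob q (Bl j) \<le> M * ?T * H0"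
    by metis
  define \<eta> where "\<eta> = Min (\<eta>j ` {..<N})"
  have \<eta>0: "0 < \<eta>" unfolding \<eta>_def using \<eta>j(1) N by (subst Min_gr_iff) auto
  have \<eta>le: "\<eta> \<le> \<eta>j j" if "j < N" for j unfolding \<eta>_def using that by (intro Min_le) auto
  let ?M1 = "(8 * real m / \<rho>') ^ m"
  define ctr where "ctr k = (if k \<le> m then y k else c (k - (m + 1)))" for k
  define rad where "rad k = (if k \<le> m then \<rho> else \<rho>')" for k
  let ?I = "{..<m + 1 + N}"
  have "\<exists>q. set_pmf q \<subseteq> S \<inter> cball (ctr k) (rad k) \<and> growth (real m) ?M1 \<eta> 1 q" if k: "k \<in> ?I" for k
  proof -
    have ctrS: "ctr k \<in> S" using y(1) c(1) k by (auto simp: ctr_def)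
    then obtain e where e: "graphical n m S (eps m) (ctr k) r e" using G by blast
    have rad: "0 < rad k" "rad k \<le> r" "\<rho>' \<le> rad k" using \<rho>0 \<rho> by (auto simp: rad_def)
    obtain q where q: "set_pmf q \<subseteq> S \<inter> cball (ctr k) (rad k)" "growth (real m) ((8 * real m / rad k) ^ m) \<eta> 1 q"
      using graphical_pmf[OF e ctrS rad(1,2) eps ml(1) \<eta>0] by blast
    have "(8 * real m / rad k) ^ m \<le> ?M1"
      using rad \<rho>(3) by (intro power_mono divide_left_mono) auto
    then show ?thesis using q growth_mono by blast
  qed
  then obtain q where q: "\<And>k. k \<in> ?I \<Longrightarrow> set_pmf (q k) \<subseteq> S \<inter> cball (ctr k) (rad k)"
    "\<And>k. k \<in> ?I \<Longrightarrow> growth (real m) ?M1 \<eta> 1 (q k)"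
    by metis
  define PP where "PP = Pi_pmf ?I undefined q"
  define \<sigma> where "\<sigma> j i = (if i \<le> m then i else m + 1 + j)" for j i :: nat
  define ev where "ev j = {f. mk l (f \<circ> \<sigma> j) \<in> Bl j}" for j
  have prob: "measure_pmf.prob PP (ev j) \<le> ?M1 ^ l * ?T * H0" if j: "j < N" for j
  proof -
    have "growth (real m * real l) (?M1 ^ l) \<eta> 1 (map_pmf (\<lambda>f. mk l (f \<circ> \<sigma> j)) (Pi_pmf ?I undefined q))"
    proof (rule prod_growth)
      show "inj_on (\<sigma> j) {..<l}" using ml(3) by (auto simp: inj_on_def \<sigma>_def)
      show "\<sigma> j ` {..<l} \<subseteq> ?I" using ml(3) j by (auto simp: \<sigma>_def)
      show "growth (real m) ?M1 \<eta> 1 (q (\<sigma> j i))" if "i < l" for i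
        by (rule q(2)) (use that j in \<open>auto simp: \<sigma>_def\<close>)
    qed (use \<eta>0 \<rho> in auto)
    then have "growth (real (m * l)) (?M1 ^ l) (\<eta>j j) 1 (map_pmf (\<lambda>f. mk l (f \<circ> \<sigma> j)) PP)"
      using growth_mono_scale[OF _ \<eta>le[OF j] order_refl] by (simp add: PP_def)
    then have "measure_pmf.prob (map_pmf (\<lambda>f. mk l (f \<circ> \<sigma> j)) PP) (Bl j) \<le> ?M1 ^ l * ?T * H0"
      by (intro \<eta>j(2)[OF j]) (use \<rho> in auto)
    then show ?thesis by (simp add: ev_def vimage_def)
  qed
  have "measure_pmf.prob PP (\<Union>j<N. ev j) \<le> (\<Sum>j<N. measure_pmf.prob PP (ev j))"
    by (rule measure_pmf.finite_measure_subadditive_finite) auto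
  also have "\<dots> \<le> (\<Sum>j<N. ?M1 ^ l * ?T * H0)" by (intro sum_mono prob) simp
  also have "\<dots> < 1" using small by (simp add: H0_def c1_def)
  finally have "measure_pmf.prob PP (\<Union>j<N. ev j) \<noteq> 1" by simp
  then obtain f where f: "f \<in> set_pmf PP" "f \<notin> (\<Union>j<N. ev j)"
    by (auto simp: measure_pmf.prob_eq_1 AE_measure_pmf_iff)
  have fk: "f k \<in> S \<inter> cball (ctr k) (rad k)" if "k \<in> ?I" for k
    using Pi_pmf_supportD[of ?I f undefined q k] f(1) q(1)[OF that] that by (auto simp: PP_def)
  show thesis
  proof (rule that[of f "\<lambda>j. f (m + 1 + j)"])
    show X: "f i \<in> S \<inter> cball (y i) \<rho>" if "i \<le> m" for i
      using fk[of i] that by (simp add: ctr_def rad_def)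
    show Z: "f (m + 1 + j) \<in> S \<inter> cball (c j) \<rho>'" if "j < N" for j
      using fk[of "m + 1 + j"] that by (simp add: ctr_def rad_def)
    show "\<exists>a. norm (f (m + 1 + j) - f 0 - (\<Sum>i<m. a i *\<^sub>R (f (Suc i) - f 0))) < h" if j: "j < N" for j
    proof (rule ccontr)
      assume "\<not> ?thesis"
      then have ge: "h \<le> norm (f (m + 1 + j) - f 0 - (\<Sum>i<m. a i *\<^sub>R (f (Suc i) - f 0)))" for a
        by (simp add: not_less)
      let ?u = "mk (m + 2) (f \<circ> \<sigma> j)"
      have "?u \<in> prodset (m + 2) (K j)"
        by (rule mk_in_prodset) (use X Z[OF j] in \<open>auto simp: K_def \<sigma>_def\<close>)
      moreover have "(\<Sum>i<m. a i *\<^sub>R (coord ?u (Suc i) - coord ?u 0)) = (\<Sum>i<m. a i *\<^sub>R (f (Suc i) - f 0))" for a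
        by (intro sum.cong) (auto simp: \<sigma>_def)
      moreover have "coord ?u (m + 1) = f (m + 1 + j)" "coord ?u 0 = f 0" by (auto simp: \<sigma>_def)
      ultimately have "?u \<in> BT j" using ge by (simp add: BT_def)
      moreover have "mk l (coord ?u) = mk l (f \<circ> \<sigma> j)"
        using ml(3) by (intro finseq_eqI) auto
      ultimately have "mk l (f \<circ> \<sigma> j) \<in> Bl j" unfolding Bl_def by (metis image_eqI)
      then show False using f(2) j by (auto simp: ev_def)
    qed
  qed
qed

definition second_exponent :: "nat \<Rightarrow> nat \<Rightarrow> real \<Rightarrow> real" where
  "second_exponent m l p = 1 - real (m * l) / p"

text \<open>A plane through random points of \<open>S\<close> near \<open>x\<close> is close to most points near \<open>z\<close>, but need not be
  close to \<open>z\<close>. It is close to \<open>m + 1\<close> points at distance about \<open>\<tau> s\<close> from \<open>z\<close> that span a fat simplex,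
  hence to \<open>z\<close> by the flatness of \<open>S\<close> near \<open>z\<close> at scale \<open>2 \<tau> s\<close>; the smallness of \<open>\<tau>\<close> gives the gain.\<close>

lemma flat_improve:
  assumes ml: "1 \<le> m" "1 \<le> l" "l \<le> m + 2" and p: "real (m * l) < p" and E: "0 \<le> E"
  obtains L where "0 < L"
    "\<And>n S r A B s x. m \<le> n \<Longrightarrow> S \<subseteq> R_space n \<Longrightarrow> compact S \<Longrightarrow> energy m l p S \<le> ennreal E \<Longrightarrow>
      (\<And>x. x \<in> S \<Longrightarrow> \<exists>e. graphical n m S (eps m) x r e) \<Longrightarrow> 0 \<le> A \<Longrightarrow> 0 \<le> B \<Longrightarrow> 0 < s \<Longrightarrow> s \<le> r / 2 \<Longrightarrow>
      A + B * s powr second_exponent m l p \<le> 1 / (64 * real m) \<Longrightarrow> L * s powr second_exponent m l p \<le> 1 / (96 * real m) \<Longrightarrow>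
      (\<And>y s'. y \<in> S \<Longrightarrow> 0 < s' \<Longrightarrow> s' \<le> s \<Longrightarrow> flat n m S y s' ((A + B * s' powr second_exponent m l p) * s')) \<Longrightarrow> x \<in> S \<Longrightarrow>
      flat n m S x s ((A / 2 + (B / 2 + 54 * real m * L) * s powr second_exponent m l p) * s)"
proof -
  define \<alpha> where "\<alpha> = second_exponent m l p"
  have p0: "0 < p" using p by (meson le_less_trans of_nat_0_le_iff)
  have \<alpha>: "0 < \<alpha>" using p p0 by (simp add: \<alpha>_def second_exponent_def)
  have \<alpha>p: "p * (\<alpha> - 1) = - real (m * l)" using p0 by (simp add: \<alpha>_def second_exponent_def field_simps)
  define \<tau> where "\<tau> = 1 / (288 * real m)"
  have \<tau>: "0 < \<tau>" "\<tau> \<le> 1 / 288" using ml by (auto simp: \<tau>_def field_simps)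
  define N where "N = (m + 2) * (m + 1)"
  have N0: "0 < N" by (simp add: N_def)
  define C where "C = real N * ((128 * real m ^ 2 / \<tau>) ^ (m * l) * (2 powr real (m * l) / unit_ball_vol (real (m * l))) * (E + 1))"
  have C0: "0 < C" unfolding C_def using N0 ml \<tau> E by (intro mult_pos_pos divide_pos_pos zero_less_power) auto
  define L where "L = (2 * C) powr (1 / p) / bad_const m"
  have L0: "0 < L" using C0 bad_const_pos[of m] by (simp add: L_def)
  have Lp: "(bad_const m * L) powr p = 2 * C" using C0 p0 bad_const_pos[of m] by (simp add: L_def powr_powr)
  have "flat n m S x s ((A / 2 + (B / 2 + 54 * real m * L) * s powr \<alpha>) * s)"
    if n: "m \<le> n" and S: "S \<subseteq> R_space n" "compact S" and en: "energy m l p S \<le> ennreal E"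
      and G: "\<And>x. x \<in> S \<Longrightarrow> \<exists>e. graphical n m S (eps m) x r e" and AB: "0 \<le> A" "0 \<le> B"
      and s: "0 < s" "s \<le> r / 2" and smA: "A + B * s powr \<alpha> \<le> 1 / (64 * real m)" and sm_L: "L * s powr \<alpha> \<le> 1 / (96 * real m)"
      and fl: "\<And>y s'. y \<in> S \<Longrightarrow> 0 < s' \<Longrightarrow> s' \<le> s \<Longrightarrow> flat n m S y s' ((A + B * s' powr \<alpha>) * s')" and x: "x \<in> S"
    for n S r A B s x
  proof -
    have eps: "0 \<le> eps m" "eps m \<le> 1 / 2" "real m * eps m \<le> 1 / 4" "eps m \<le> 1 / 128" using eps_bounds[OF ml(1)] by auto
    have F: "full n m S (eps m) y t" if "y \<in> S" "0 < t" "t \<le> s" for y t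
      using G[OF that(1)] graphical_full[OF _ that(1,2)] that(3) s(2) eps by (meson order_trans)
    define h where "h = L * s powr \<alpha> * s"
    have h0: "0 < h" using L0 s by (simp add: h_def)
    define \<rho> where "\<rho> = s / (16 * real m)"
    define \<rho>' where "\<rho>' = \<tau> * s / (16 * real m)"
    have \<rho>0: "0 < \<rho>" "0 < \<rho>'" using s ml \<tau> by (auto simp: \<rho>_def \<rho>'_def)
    have \<rho>s: "\<rho> \<le> s / 16" unfolding \<rho>_def using ml s by (intro divide_left_mono) auto
    have \<rho>'\<tau>: "\<rho>' = \<tau> * \<rho>" by (simp add: \<rho>_def \<rho>'_def)
    have \<rho>'\<rho>: "\<rho>' \<le> \<rho>" unfolding \<rho>'\<tau> using \<tau> \<rho>0 by (simp add: mult_left_le_one_le)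
    have \<tau>s: "0 < \<tau> * s" "2 * \<tau> * s \<le> s" "\<tau> * s \<le> s" using \<tau> s by auto
    have \<rho>'s: "\<rho>' \<le> \<tau> * s / 16" unfolding \<rho>'_def using ml \<tau>s(1) by (intro divide_left_mono) auto
    define \<phi> where "\<phi> = (A + B * (2 * \<tau> * s) powr \<alpha>) * (2 * \<tau> * s)"
    define AB' where "AB' = A + B * s powr \<alpha>"
    have AB'0: "0 \<le> AB'" using AB by (simp add: AB'_def)
    have \<phi>0: "0 \<le> \<phi>" unfolding \<phi>_def using AB \<tau> s by (intro mult_nonneg_nonneg add_nonneg_nonneg) auto
    have \<phi>le: "\<phi> \<le> AB' * (2 * \<tau> * s)"
      unfolding \<phi>_def AB'_def using AB \<tau>s \<alpha> by (intro mult_right_mono add_left_mono mult_left_mono powr_mono2) auto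
    have m\<phi>: "real m * (32 * \<phi>) \<le> \<tau> * s"
    proof -
      have "real m * AB' \<le> 1 / 64" using smA ml by (simp add: AB'_def field_simps)
      then have "real m * AB' * (64 * (\<tau> * s)) \<le> 1 / 64 * (64 * (\<tau> * s))" using \<tau>s by (intro mult_right_mono) auto
      moreover have "real m * (32 * \<phi>) \<le> real m * (32 * (AB' * (2 * \<tau> * s)))" using \<phi>le by (intro mult_left_mono) auto
      ultimately show ?thesis by (simp add: mult_ac)
    qed
    have mh: "real m * (96 * h) \<le> s"
    proof -
      have "real m * (96 * (L * s powr \<alpha>)) \<le> 1" using sm_L ml by (simp add: field_simps)
      then have "real m * (96 * (L * s powr \<alpha>)) * s \<le> 1 * s" using s by (intro mult_right_mono) auto
      then show ?thesis by (simp add: h_def mult_ac)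
    qed
    obtain w where w: "\<And>i. i < m \<Longrightarrow> x + w i \<in> S" "\<And>i. i < m \<Longrightarrow> norm (w i) \<le> s * (1 / 2 + eps m)" "fat m w (s / 4)"
      using full_points[OF F[OF x s(1) order_refl] s(1) eps(3)] by metis
    have ws: "norm (w i) \<le> s" if "i < m" for i
    proof -
      have "s * (1 / 2 + eps m) \<le> s * 1" using s eps by (intro mult_left_mono) auto
      then show ?thesis using w(2)[OF that] by simp
    qed
    define y where "y i = (case i of 0 \<Rightarrow> x | Suc k \<Rightarrow> x + w k)" for i
    have y: "y i \<in> S" "dist (y i) (y 0) \<le> s" if "i \<le> m" for i
      using that w(1) ws x s by (auto simp: y_def dist_norm split: nat.splits)
    have ywi: "(\<lambda>i. y (Suc i) - y 0) = w" by (simp add: y_def)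
    define err where "err = 8 * \<phi> + 6 * h"
    have key: "\<exists>P. frame n m P \<and> (\<forall>i<m. norm (rej m P (w i)) \<le> err) \<and> norm (rej m P (z - x)) \<le> err"
      if z: "z \<in> S \<inter> cball x s" for z
    proof -
      define b where "b k = (if k \<le> m then y k else z)" for k
      have b: "b k \<in> S" "dist (b k) x \<le> s" for k
        using y[of k] z by (auto simp: b_def y_def[of 0] dist_commute)
      have "\<exists>u. (\<forall>i<m. b k + u i \<in> S) \<and> (\<forall>i<m. norm (u i) \<le> \<tau> * s * (1 / 2 + eps m)) \<and> fat m u (\<tau> * s / 4)" for k
        by (rule full_points[OF F[OF b(1)[of k] \<tau>s(1,3)] \<tau>s(1) eps(3)]) blast
      then obtain u where u: "\<And>k i. i < m \<Longrightarrow> b k + u k i \<in> S"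
        "\<And>k i. i < m \<Longrightarrow> norm (u k i) \<le> \<tau> * s * (1 / 2 + eps m)" "\<And>k. fat m (u k) (\<tau> * s / 4)"
        by metis
      have us: "norm (u k i) \<le> \<tau> * s" if "i < m" for k i
      proof -
        have "\<tau> * s * (1 / 2 + eps m) \<le> \<tau> * s * 1" using \<tau>s eps by (intro mult_left_mono) auto
        then show ?thesis using u(2)[OF that, of k] by simp
      qed
      define c where "c k i = (case i of 0 \<Rightarrow> b k | Suc i' \<Rightarrow> b k + u k i')" for k i
      have cS: "c k i \<in> S" "dist (c k i) (b k) \<le> \<tau> * s" if "i \<le> m" for k i
        using that b(1)[of k] u(1) us \<tau>s by (auto simp: c_def dist_norm split: nat.splits)
      let ?cc = "\<lambda>j. c (j div (m + 1)) (j mod (m + 1))"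
      have modm: "j mod (m + 1) \<le> m" for j
        using mod_less_divisor[of "m + 1" j] by linarith
      obtain X Z where XZ: "\<And>i. i \<le> m \<Longrightarrow> X i \<in> S \<inter> cball (y i) \<rho>" "\<And>j. j < N \<Longrightarrow> Z j \<in> S \<inter> cball (?cc j) \<rho>'"
        "\<And>j. j < N \<Longrightarrow> \<exists>a. norm (Z j - X 0 - (\<Sum>i<m. a i *\<^sub>R (X (Suc i) - X 0))) < h"
      proof (rule good_points[OF ml _ E S(2) G en, of y s N ?cc \<rho> \<rho>' h])
        show "dist (?cc j) (y 0) \<le> 2 * s" for j
        proof -
          have "dist (?cc j) (b (j div (m + 1))) \<le> \<tau> * s" by (rule cS(2)[OF modm])
          moreover have "dist (b (j div (m + 1))) (y 0) \<le> s" using b(2) by (simp add: y_def)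
          ultimately show ?thesis using dist_triangle[of "?cc j" "y 0" "b (j div (m + 1))"] \<tau>s by linarith
        qed
        have "8 * real m / \<rho>' = 128 * real m ^ 2 / \<tau> / s"
          unfolding \<rho>'_def using \<tau> s ml by (simp add: field_simps power2_eq_square)
        moreover have "s powr real (m * l) = s ^ (m * l)" by (rule powr_realpow) (rule s)
        ultimately have 1: "((8 * real m / \<rho>') ^ m) ^ l = (128 * real m ^ 2 / \<tau>) ^ (m * l) / s powr real (m * l)"
          by (simp only: power_divide[of _ s] power_divide[of _ "s ^ m"] power_mult)
        have "bad_const m * h / s ^ 2 = bad_const m * L * s powr (\<alpha> - 1)"
          using s by (simp add: h_def power2_eq_square powr_diff)
        then have 2: "(bad_const m * h / s ^ 2) powr p = 2 * C / s powr real (m * l)"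
          using s L0 bad_const_pos[of m] Lp
          by (simp add: powr_mult[of "bad_const m * L"] powr_powr \<alpha>p[unfolded mult.commute[of p]] powr_minus_divide)
        have gen: "a * (Y / u * T * (E1 / (c2 / u))) = a * (Y * T * E1) / c2" if "u \<noteq> 0" for a Y u T E1 c2 :: real
          using that by simp
        have 3: "real N * (((8 * real m / \<rho>') ^ m) ^ l * (2 powr real (m * l) / unit_ball_vol (real (m * l)))
          * ((E + 1) / (bad_const m * h / s ^ 2) powr p)) = C / (2 * C)"
          unfolding 1 2 by (subst gen) (use s in simp, simp only: C_def)
        show "real N * (((8 * real m / \<rho>') ^ m) ^ l * (2 powr real (m * l) / unit_ball_vol (real (m * l)))
          * ((E + 1) / (bad_const m * h / s ^ 2) powr p)) < 1" unfolding 3 using C0 by simp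
        show "fat m (\<lambda>i. y (Suc i) - y 0) (s / 4)" unfolding ywi by (rule w(3))
        show "\<rho> = s / (16 * real m)" by (rule \<rho>_def)
        show "\<rho> \<le> r" using \<rho>s s by linarith
      qed (use y cS(1)[OF modm] \<rho>0 \<rho>'\<rho> h0 N0 p0 in auto)
      have XR: "X (Suc i) - X 0 \<in> R_space n" if "i < m" for i
        using XZ(1)[of "Suc i"] XZ(1)[of 0] that S(1) by (intro subspace_diff[OF subspace_R_space]) auto
      obtain P where P: "frame n m P" "\<And>i. i < m \<Longrightarrow> proj m P (X (Suc i) - X 0) = X (Suc i) - X 0"
        using gram_schmidt[of m "\<lambda>i. X (Suc i) - X 0" n] XR n by blast
      have onfP: "orthonormal m P" using P(1) by auto
      have Zh: "norm (rej m P (Z j - X 0)) \<le> h" if "j < N" for j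
      proof -
        obtain a where a: "norm (Z j - X 0 - (\<Sum>i<m. a i *\<^sub>R (X (Suc i) - X 0))) < h" using XZ(3)[OF \<open>j < N\<close>] by blast
        have "proj m P (\<Sum>i<m. a i *\<^sub>R (X (Suc i) - X 0)) = (\<Sum>i<m. a i *\<^sub>R (X (Suc i) - X 0))"
          using P(2) by (simp add: proj_simps(5) proj_simps(3))
        then show ?thesis using norm_rej_le_dist[OF onfP, of _ "Z j - X 0"] a by fastforce
      qed
      have bX: "norm (rej m P (b k - X 0)) \<le> 4 * \<phi> + 3 * h" if k: "k < m + 2" for k
      proof -
        define q where "q i = Z (k * (m + 1) + i)" for i
        have jN: "k * (m + 1) + i < N" if "i \<le> m" for i
        proof -
          have "k * (m + 1) + i < (k + 1) * (m + 1)" using that by simp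
          also have "\<dots> \<le> (m + 2) * (m + 1)" using k by (intro mult_right_mono) auto
          finally show ?thesis by (simp add: N_def)
        qed
        have dm: "(k * (m + 1) + i) div (m + 1) = k" "(k * (m + 1) + i) mod (m + 1) = i" if "i \<le> m" for i
        proof -
          have "i < m + 1" using that by simp
          then show "(k * (m + 1) + i) div (m + 1) = k"
            using div_mult_self3[of "m + 1" k i] by (simp only: div_less)
          show "(k * (m + 1) + i) mod (m + 1) = i" using \<open>i < m + 1\<close> by (simp only: mod_mult_self3 mod_less)
        qed
        have q: "q i \<in> S" "dist (q i) (c k i) \<le> \<rho>'" "norm (rej m P (q i - X 0)) \<le> h" if "i \<le> m" for i
          using XZ(2)[OF jN[OF that]] Zh[OF jN[OF that]] unfolding dm[OF that] q_def[symmetric]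
          by (auto simp: dist_commute)
        have qb: "dist (q i) (b k) \<le> 2 * \<tau> * s" if "i \<le> m" for i
          using dist_triangle[of "q i" "b k" "c k i"] q(2)[OF that] cS(2)[OF that, of k] \<rho>'s \<tau>s by linarith
        obtain e where e: "frame n m e" "\<And>z. z \<in> S \<inter> cball (b k) (2 * \<tau> * s) \<Longrightarrow> norm (rej m e (z - b k)) \<le> \<phi>"
          using fl[OF b(1)[of k], of "2 * \<tau> * s"] \<tau>s unfolding flat_def \<phi>_def by auto
        have onfe: "orthonormal m e" using e(1) by auto
        have rq: "norm (rej m e (q i - b k)) \<le> \<phi>" if "i \<le> m" for i
          using e(2)[of "q i"] q(1)[OF that] qb[OF that] by (simp add: dist_commute)
        define v where "v i = q (Suc i) - q 0" for i
        have "fat m v (\<tau> * s / 4 / 2)"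
        proof (rule fat_perturb[OF u(3)[of k]])
          fix i assume i: "i < m"
          have eq: "v i - u k i = (q (Suc i) - c k (Suc i)) - (q 0 - c k 0)" by (simp add: v_def c_def)
          show "norm (v i - u k i) \<le> 2 * \<rho>'"
            unfolding eq using norm_triangle_ineq4[of "q (Suc i) - c k (Suc i)" "q 0 - c k 0"] q(2)[of "Suc i"] q(2)[of 0] i
            by (simp add: dist_norm)
        next
          show "real m * (2 * \<rho>') \<le> \<tau> * s / 4 / 2" using ml by (simp add: \<rho>'_def)
        qed
        then have fatv: "fat m v (\<tau> * s / 8)" by simp
        have rv: "norm (rej m e (v i)) \<le> 2 * \<phi>" if "i < m" for i
        proof -
          have "rej m e (v i) = rej m e (q (Suc i) - b k) - rej m e (q 0 - b k)" by (simp add: v_def rej_simps)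
          then show ?thesis using norm_triangle_ineq4[of "rej m e (q (Suc i) - b k)" "rej m e (q 0 - b k)"]
            rq[of "Suc i"] rq[of 0] that by simp
        qed
        define t where "t = b k - q 0"
        have nt: "norm t \<le> \<rho>'" using q(2)[of 0] by (simp add: t_def c_def dist_norm norm_minus_commute)
        have rt: "norm (rej m e t) \<le> 2 * \<phi>"
        proof -
          have "rej m e t = - rej m e (q 0 - b k)" by (simp add: t_def rej_simps)
          then show ?thesis using rq[of 0] \<phi>0 by simp
        qed
        obtain a where a: "\<And>i. i < m \<Longrightarrow> \<bar>a i\<bar> \<le> 2 * norm t / (\<tau> * s / 8)"
          "norm (t - (\<Sum>i<m. a i *\<^sub>R v i)) \<le> 2 * \<phi> + real m * (2 * norm t / (\<tau> * s / 8) * (2 * \<phi>))"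
        proof (rule fat_expand[OF onfe fatv _ rv _ rt])
          show "real m * (2 * \<phi>) \<le> \<tau> * s / 8 / 2" using m\<phi> by simp
        qed (use \<tau>s in auto)
        have am: "2 * norm t / (\<tau> * s / 8) \<le> 1 / real m"
        proof -
          have "2 * norm t / (\<tau> * s / 8) \<le> 2 * \<rho>' / (\<tau> * s / 8)"
            using nt \<tau>s by (intro divide_right_mono) auto
          also have "\<dots> = 1 / real m" using \<tau> s ml by (simp add: \<rho>'_def)
          finally show ?thesis .
        qed
        have a1: "\<bar>a i\<bar> \<le> 1 / real m" if "i < m" for i using a(1)[OF that] am by linarith
        have "real m * (2 * norm t / (\<tau> * s / 8) * (2 * \<phi>)) \<le> real m * (1 / real m * (2 * \<phi>))"
          using am \<phi>0 by (intro mult_left_mono mult_right_mono) auto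
        then have a2: "norm (t - (\<Sum>i<m. a i *\<^sub>R v i)) \<le> 4 * \<phi>" using a(2) ml by simp
        have rvP: "norm (rej m P (v i)) \<le> 2 * h" if "i < m" for i
        proof -
          have "rej m P (v i) = rej m P (q (Suc i) - X 0) - rej m P (q 0 - X 0)" by (simp add: v_def rej_simps)
          then show ?thesis using norm_triangle_ineq4[of "rej m P (q (Suc i) - X 0)" "rej m P (q 0 - X 0)"]
            q(3)[of "Suc i"] q(3)[of 0] that by simp
        qed
        have "norm (rej m P (\<Sum>i<m. a i *\<^sub>R v i)) \<le> real m * (1 / real m * (2 * h))"
          by (rule norm_rej_sum_le) (use a1 rvP in auto)
        then have r1: "norm (rej m P (\<Sum>i<m. a i *\<^sub>R v i)) \<le> 2 * h" using ml by simp
        have eqb: "b k - X 0 = (t - (\<Sum>i<m. a i *\<^sub>R v i)) + ((\<Sum>i<m. a i *\<^sub>R v i) + (q 0 - X 0))" by (simp add: t_def)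
        have "norm (rej m P (b k - X 0)) \<le> norm (rej m P (t - (\<Sum>i<m. a i *\<^sub>R v i))) +
            (norm (rej m P (\<Sum>i<m. a i *\<^sub>R v i)) + norm (rej m P (q 0 - X 0)))"
          unfolding eqb using norm_rej_add[of m P "t - (\<Sum>i<m. a i *\<^sub>R v i)" "(\<Sum>i<m. a i *\<^sub>R v i) + (q 0 - X 0)"]
            norm_rej_add[of m P "\<Sum>i<m. a i *\<^sub>R v i" "q 0 - X 0"] by linarith
        then show ?thesis
          using norm_rej_le[OF onfP, of "t - (\<Sum>i<m. a i *\<^sub>R v i)"] a2 r1 q(3)[of 0] by simp
      qed
      have bx: "norm (rej m P (b k - x)) \<le> err" if "k < m + 2" for k
      proof -
        have "b 0 = x" by (simp add: b_def y_def)
        then have "rej m P (b k - x) = rej m P (b k - X 0) - rej m P (b 0 - X 0)" by (simp add: rej_simps)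
        then show ?thesis using norm_triangle_ineq4[of "rej m P (b k - X 0)" "rej m P (b 0 - X 0)"]
          bX[OF that] bX[of 0] by (simp add: err_def)
      qed
      have "norm (rej m P (w i)) \<le> err" if "i < m" for i
        using bx[of "Suc i"] that by (simp add: b_def y_def)
      moreover have "norm (rej m P (z - x)) \<le> err" using bx[of "m + 1"] by (simp add: b_def)
      ultimately show ?thesis using P(1) by blast
    qed
    have err0: "0 \<le> err" using \<phi>0 h0 by (simp add: err_def)
    have merr: "real m * err \<le> s / 8"
    proof -
      have "real m * (8 * \<phi>) \<le> s / 16"
      proof -
        have "real m * (8 * \<phi>) \<le> \<tau> * s / 4" using m\<phi> by simp
        also have "\<dots> \<le> s / 16" using \<tau>(2) s by simp
        finally show ?thesis .
      qed
      moreover have "real m * (6 * h) \<le> s / 16" using mh by simp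
      ultimately show ?thesis by (simp add: err_def algebra_simps)
    qed
    have wR: "w i \<in> R_space n" if "i < m" for i
      using subspace_diff[OF subspace_R_space, of "x + w i" n x] w(1)[OF that] x S(1) by auto
    obtain H where H: "frame n m H" "\<And>i. i < m \<Longrightarrow> proj m H (w i) = w i"
      using gram_schmidt[of m w n] wR n by blast
    have "norm (rej m H (z - x)) \<le> 9 * real m * err" if z: "z \<in> S \<inter> cball x s" for z
    proof -
      obtain P where P: "frame n m P" "\<And>i. i < m \<Longrightarrow> norm (rej m P (w i)) \<le> err" "norm (rej m P (z - x)) \<le> err"
        using key[OF z] by blast
      obtain a where a: "norm (z - x - (\<Sum>i<m. a i *\<^sub>R w i)) \<le> err + real m * (2 * norm (z - x) / (s / 4) * err)"
        using fat_expand[OF frame_orthonormal[OF P(1)] w(3) _ P(2) _ P(3)] merr s by auto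
      have "norm (z - x) \<le> s" using z by (simp add: dist_norm norm_minus_commute)
      then have "2 * norm (z - x) / (s / 4) \<le> 8" using s by (simp add: field_simps)
      then have "real m * (2 * norm (z - x) / (s / 4) * err) \<le> real m * (8 * err)"
        using err0 by (intro mult_left_mono mult_right_mono) auto
      moreover have "err \<le> real m * err" using ml err0 by (simp add: mult_le_cancel_right1)
      ultimately have le: "norm (z - x - (\<Sum>i<m. a i *\<^sub>R w i)) \<le> 9 * real m * err" using a by simp
      have "proj m H (\<Sum>i<m. a i *\<^sub>R w i) = (\<Sum>i<m. a i *\<^sub>R w i)"
        using H(2) by (simp add: proj_simps(5) proj_simps(3))
      then show ?thesis using norm_rej_le_dist[OF frame_orthonormal[OF H(1)], of _ "z - x"] le by fastforce
    qed
    then have "flat n m S x s (9 * real m * err)" unfolding flat_def using H(1) by blast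
    moreover have "9 * real m * err \<le> (A / 2 + (B / 2 + 54 * real m * L) * s powr \<alpha>) * s"
    proof -
      have "9 * real m * (8 * \<phi>) \<le> 9 * real m * (8 * (AB' * (2 * \<tau> * s)))" using \<phi>le by (intro mult_left_mono) auto
      also have "\<dots> = AB' / 2 * s" using ml by (simp add: \<tau>_def)
      finally have "9 * real m * err \<le> AB' / 2 * s + 54 * real m * h" by (simp add: err_def algebra_simps)
      also have "\<dots> = (A / 2 + (B / 2 + 54 * real m * L) * s powr \<alpha>) * s"
        by (simp add: AB'_def h_def algebra_simps)
      finally show ?thesis .
    qed
    ultimately show ?thesis by (rule flat_mono)
  qed
  then show thesis using that[OF L0] unfolding \<alpha>_def by blast
qed

lemma flat_optimal:
  assumes ml: "1 \<le> m" "1 \<le> l" "l \<le> m + 2" and p: "real (m * l) < p" and E: "0 \<le> E" and r: "0 < r"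
  obtains K R where "0 < K" "0 < R" "R \<le> r / 2"
    "\<And>n S s x. m \<le> n \<Longrightarrow> S \<subseteq> R_space n \<Longrightarrow> compact S \<Longrightarrow> energy m l p S \<le> ennreal E \<Longrightarrow>
      (\<And>x. x \<in> S \<Longrightarrow> \<exists>e. graphical n m S (eps m) x r e) \<Longrightarrow> x \<in> S \<Longrightarrow> 0 < s \<Longrightarrow> s \<le> R \<Longrightarrow>
      flat n m S x s (K * s powr second_exponent m l p * s)"
proof -
  define \<alpha> where "\<alpha> = second_exponent m l p"
  have p0: "0 < p" using p by (meson le_less_trans of_nat_0_le_iff)
  have \<alpha>: "0 < \<alpha>" using p p0 by (simp add: \<alpha>_def second_exponent_def)
  obtain L where L: "0 < L"
    "\<And>n S r A B s x. m \<le> n \<Longrightarrow> S \<subseteq> R_space n \<Longrightarrow> compact S \<Longrightarrow> energy m l p S \<le> ennreal E \<Longrightarrow>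
      (\<And>x. x \<in> S \<Longrightarrow> \<exists>e. graphical n m S (eps m) x r e) \<Longrightarrow> 0 \<le> A \<Longrightarrow> 0 \<le> B \<Longrightarrow> 0 < s \<Longrightarrow> s \<le> r / 2 \<Longrightarrow>
      A + B * s powr \<alpha> \<le> 1 / (64 * real m) \<Longrightarrow> L * s powr \<alpha> \<le> 1 / (96 * real m) \<Longrightarrow>
      (\<And>y s'. y \<in> S \<Longrightarrow> 0 < s' \<Longrightarrow> s' \<le> s \<Longrightarrow> flat n m S y s' ((A + B * s' powr \<alpha>) * s')) \<Longrightarrow> x \<in> S \<Longrightarrow>
      flat n m S x s ((A / 2 + (B / 2 + 54 * real m * L) * s powr \<alpha>) * s)"
    using flat_improve[OF ml p E] unfolding \<alpha>_def by blast
  define B where "B = 108 * real m * L"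
  have B0: "0 < B" using L ml by (simp add: B_def)
  obtain s0 where s0: "0 < s0" "\<And>s. 0 < s \<Longrightarrow> s \<le> s0 \<Longrightarrow> B * s powr \<alpha> \<le> eps m"
    using small_scale[OF \<alpha> eps_bounds(1)[OF ml(1)], of B] B0 by auto
  define R where "R = min s0 (r / 2)"
  have R: "0 < R" "R \<le> r / 2" "R \<le> s0" using s0 r by (auto simp: R_def)
  have "flat n m S x s ((B + 1) * s powr \<alpha> * s)"
    if n: "m \<le> n" and S: "S \<subseteq> R_space n" "compact S" and en: "energy m l p S \<le> ennreal E"
      and G: "\<And>x. x \<in> S \<Longrightarrow> \<exists>e. graphical n m S (eps m) x r e" and x: "x \<in> S" and s: "0 < s" "s \<le> R" for n S s x
  proof -
    have iter: "flat n m S y t ((eps m / 2 ^ k + B * t powr \<alpha>) * t)" if "y \<in> S" "0 < t" "t \<le> R" for k y t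
      using that
    proof (induction k arbitrary: y t)
      case 0
      obtain e where e: "graphical n m S (eps m) y r e" using G 0 by blast
      have "norm (rej m e (z - y)) \<le> (eps m / 2 ^ 0 + B * t powr \<alpha>) * t" if z: "z \<in> S \<inter> cball y t" for z
      proof -
        have "norm (rej m e (z - y)) \<le> eps m * norm (z - y)"
          using e z 0 R r unfolding graphical_def by auto
        also have "\<dots> \<le> eps m * t"
          using z eps_bounds(1)[OF ml(1)] by (intro mult_left_mono) (auto simp: dist_norm norm_minus_commute)
        also have "\<dots> \<le> (eps m / 2 ^ 0 + B * t powr \<alpha>) * t" using B0 0 by (intro mult_right_mono) auto
        finally show ?thesis .
      qed
      then show ?case using e unfolding flat_def graphical_def by blast
    next
      case (Suc k)
      have eps0: "0 < eps m" using eps_bounds[OF ml(1)] by simp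
      have "flat n m S y t ((eps m / 2 ^ k / 2 + (B / 2 + 54 * real m * L) * t powr \<alpha>) * t)"
      proof (rule L(2)[OF n S en G])
        have "eps m / 2 ^ k \<le> eps m / 1" using eps0 by (intro divide_left_mono) auto
        moreover have "B * t powr \<alpha> \<le> eps m" using s0(2)[of t] Suc.prems R by simp
        moreover have "2 * eps m = 1 / (64 * real m)" by (simp add: eps_def)
        ultimately show "eps m / 2 ^ k + B * t powr \<alpha> \<le> 1 / (64 * real m)" by simp
        have "108 * real m * (L * t powr \<alpha>) \<le> eps m" using s0(2)[of t] Suc.prems R by (simp add: B_def mult_ac)
        moreover have "1 * (L * t powr \<alpha>) \<le> 108 * real m * (L * t powr \<alpha>)"
          using ml L by (intro mult_right_mono) auto
        moreover have "eps m \<le> 1 / (96 * real m)" using ml by (simp add: eps_def field_simps)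
        ultimately show "L * t powr \<alpha> \<le> 1 / (96 * real m)" by simp
      qed (use Suc R eps0 B0 in auto)
      then show ?case by (simp add: B_def mult_ac)
    qed
    obtain k :: nat where "(1/2) ^ k < s powr \<alpha> / 1" using real_arch_pow_inv[of "s powr \<alpha>" "1/2"] s by auto
    then have k: "1 / 2 ^ k \<le> s powr \<alpha>" by (simp add: power_divide)
    have "eps m / 2 ^ k \<le> 1 / 2 ^ k" using eps_bounds[OF ml(1)] by (intro divide_right_mono) auto
    then have "(eps m / 2 ^ k + B * s powr \<alpha>) * s \<le> (B + 1) * s powr \<alpha> * s"
      using k s by (intro mult_right_mono) (auto simp: algebra_simps)
    then show ?thesis by (rule flat_mono[OF iter[OF x s]])
  qed
  then show thesis using that[of "B + 1" R] B0 R unfolding \<alpha>_def by simp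
qed

section \<open>Tangent planes\<close>

lemma tilt_chain_up:
  assumes e: "\<And>j. orthonormal m (e j)" and t: "\<And>j. tilt m (e j) (e (Suc j)) (d j)" and d: "\<And>j. 0 \<le> d j"
    and "i \<le> j"
  shows "tilt m (e i) (e j) (sum d {i..<j})"
  using \<open>i \<le> j\<close>
proof (induction j rule: dec_induct)
  case base
  then show ?case by (simp add: tilt_refl e)
next
  case (step k)
  have "tilt m (e i) (e (Suc k)) (sum d {i..<k} + d k)"
    by (rule tilt_trans[OF e e step.IH t]) (rule d)
  then show ?case using step.hyps by simp
qed

lemma frame_limit:
  assumes e: "\<And>j. frame n m (e j)"
  obtains f and \<sigma> :: "nat \<Rightarrow> nat" where "frame n m f" "strict_mono \<sigma>" "\<And>v. (\<lambda>j. rej m (e (\<sigma> j)) v) \<longlonglongrightarrow> rej m f v"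
proof -
  let ?Q = "prodset m (\<lambda>_. R_space n \<inter> cball 0 1)"
  have "compact ?Q" by (intro compact_prodset compact_R_space_cball)
  moreover have "mk m (e j) \<in> ?Q" for j
    using e[of j] orthonormal_norm[OF frame_orthonormal[OF e[of j]]] by (intro mk_in_prodset) (auto simp: frame_def)
  ultimately obtain L \<sigma> where L: "L \<in> ?Q" "strict_mono \<sigma>" "(\<lambda>j. mk m (e (\<sigma> j))) \<longlonglongrightarrow> L"
    using seq_compactE[of ?Q "\<lambda>j. mk m (e j)"] by (auto simp: compact_eq_seq_compact_metric o_def)
  have lim: "(\<lambda>j. e (\<sigma> j) i) \<longlonglongrightarrow> coord L i" if "i < m" for i
    using bounded_linear.tendsto[OF bounded_linear_coord L(3), of i] that by simp
  have "frame n m (coord L)" unfolding frame_def orthonormal_def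
  proof (intro conjI allI impI)
    fix i j assume ij: "i < m" "j < m"
    have "(\<lambda>k. e (\<sigma> k) i \<bullet> e (\<sigma> k) j) \<longlonglongrightarrow> coord L i \<bullet> coord L j"
      by (intro tendsto_inner lim ij)
    moreover have "e (\<sigma> k) i \<bullet> e (\<sigma> k) j = (if i = j then 1 else 0)" for k
      using frame_orthonormal[OF e[of "\<sigma> k"]] ij by (simp add: orthonormal_def)
    ultimately have "(\<lambda>k. if i = j then 1 else 0 :: real) \<longlonglongrightarrow> coord L i \<bullet> coord L j" by simp
    then show "coord L i \<bullet> coord L j = (if i = j then 1 else 0)" by (simp add: tendsto_const_iff)
  qed (use L(1) in \<open>auto simp: prodset_def\<close>)
  moreover have "(\<lambda>j. rej m (e (\<sigma> j)) v) \<longlonglongrightarrow> rej m (coord L) v" for v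
    unfolding rej_def proj_def
    by (intro tendsto_diff tendsto_const tendsto_sum tendsto_scaleR tendsto_inner lim) auto
  ultimately show thesis using L(2) that by blast
qed

text \<open>Affine planes approximating \<open>S\<close> near \<open>a\<close> at dyadic scales form a Cauchy sequence.\<close>

lemma tangent_frame:
  assumes S: "S \<subseteq> R_space n" and m: "1 \<le> m" and \<alpha>: "0 < \<alpha>" "\<alpha> \<le> 1" and K: "0 \<le> K" and R: "0 < R"
    and \<epsilon>: "real m * \<epsilon> \<le> 1 / 4"
    and F: "\<And>s. 0 < s \<Longrightarrow> s \<le> R \<Longrightarrow> full n m S \<epsilon> a s"
    and fl: "\<And>s. 0 < s \<Longrightarrow> s \<le> R \<Longrightarrow> flat n m S a s (K * s powr \<alpha> * s)"
    and small: "16 * real m * (K * R powr \<alpha>) \<le> 1"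
  shows "\<exists>f. frame n m f \<and> (\<forall>b\<in>S \<inter> cball a R. norm (rej m f (b - a))
      \<le> (4 + 64 * real m * geo \<alpha>) * K * dist a b powr \<alpha> * norm (b - a))"
proof -
  define Rj where "Rj j = R / 2 ^ j" for j :: nat
  have Rj: "0 < Rj j" "Rj j \<le> R" for j using R by (auto simp: Rj_def field_simps)
  have RS: "Rj j = 2 * Rj (Suc j)" for j by (simp add: Rj_def)
  define \<omega> where "\<omega> j = K * Rj j powr \<alpha>" for j
  have \<omega>0: "0 \<le> \<omega> j" for j using K by (simp add: \<omega>_def)
  have \<omega>S: "\<omega> (Suc j) \<le> \<omega> j" for j
    unfolding \<omega>_def using K Rj[of "Suc j"] \<alpha> by (intro mult_left_mono powr_mono2) (auto simp: RS[of j])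
  have \<omega>R: "16 * real m * \<omega> j \<le> 1" for j
  proof -
    have "\<omega> j \<le> K * R powr \<alpha>" unfolding \<omega>_def using K Rj \<alpha> by (intro mult_left_mono powr_mono2) (auto intro: less_imp_le)
    then have "16 * real m * \<omega> j \<le> 16 * real m * (K * R powr \<alpha>)" by (intro mult_left_mono) auto
    then show ?thesis using small by linarith
  qed
  have "\<exists>e. frame n m e \<and> (\<forall>z\<in>S \<inter> cball a (Rj j). norm (rej m e (z - a)) \<le> \<omega> j * Rj j)" for j
    using fl[OF Rj[of j]] by (simp add: flat_def \<omega>_def)
  then obtain e where e: "\<And>j. frame n m (e j)"
    "\<And>j z. z \<in> S \<inter> cball a (Rj j) \<Longrightarrow> norm (rej m (e j) (z - a)) \<le> \<omega> j * Rj j"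
    by metis
  have step: "tilt m (e j) (e (Suc j)) (32 * real m * \<omega> j)" for j
  proof -
    have "tilt m (e j) (e (Suc j)) (8 * real m * (\<omega> j * Rj j + \<omega> (Suc j) * Rj (Suc j)) / Rj (Suc j))"
    proof (rule tilt_of_near[OF F[OF Rj[of "Suc j"]] Rj(1) \<epsilon> m])
      fix z assume z: "z \<in> S \<inter> cball a (Rj (Suc j))"
      then show "norm (rej m (e (Suc j)) (z - a)) \<le> \<omega> (Suc j) * Rj (Suc j)" by (rule e(2))
      show "norm (rej m (e j) (z - a)) \<le> \<omega> j * Rj j"
        by (rule e(2)) (use z Rj(1)[of "Suc j"] RS[of j] in auto)
    next
      have "16 * real m * \<omega> j * Rj (Suc j) \<le> 1 * Rj (Suc j)" using \<omega>R Rj(1)[of "Suc j"] by (intro mult_right_mono) auto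
      then show "real m * (\<omega> j * Rj j) \<le> Rj (Suc j) / 8" by (simp add: RS[of j])
    qed (use e(1) in auto)
    moreover have "8 * real m * (\<omega> j * Rj j + \<omega> (Suc j) * Rj (Suc j)) / Rj (Suc j) = 8 * (real m * (2 * \<omega> j + \<omega> (Suc j)))"
      using Rj(1)[of "Suc j"] by (simp add: RS[of j] field_simps)
    moreover have "real m * (2 * \<omega> j + \<omega> (Suc j)) \<le> real m * (4 * \<omega> j)"
      using \<omega>S[of j] \<omega>0[of j] by (intro mult_left_mono) auto
    ultimately show ?thesis by (elim tilt_mono) simp
  qed
  have chain: "tilt m (e i) (e j) (32 * real m * geo \<alpha> * \<omega> i)" if "i \<le> j" for i j
  proof -
    have "tilt m (e i) (e j) (\<Sum>k\<in>{i..<j}. 32 * real m * \<omega> k)"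
      by (rule tilt_chain_up[where d = "\<lambda>k. 32 * real m * \<omega> k", OF _ step _ that]) (use e(1) \<omega>0 in auto)
    moreover have "(\<Sum>k\<in>{i..<j}. 32 * real m * \<omega> k) = 32 * real m * (\<Sum>k\<in>{i..<j}. \<omega> k)"
      by (simp only: sum_distrib_left)
    moreover have "(\<Sum>k\<in>{i..<j}. \<omega> k) \<le> geo \<alpha> * \<omega> i"
      using geo_sum_le[OF \<alpha>(1), of R K i j] R K by (simp add: \<omega>_def Rj_def)
    then have "32 * real m * (\<Sum>k\<in>{i..<j}. \<omega> k) \<le> 32 * real m * (geo \<alpha> * \<omega> i)" by (intro mult_left_mono) auto
    ultimately show ?thesis by (elim tilt_mono) (simp add: mult.assoc)
  qed
  obtain f \<sigma> where f: "frame n m f" "strict_mono \<sigma>" "\<And>v. (\<lambda>j. rej m (e (\<sigma> j)) v) \<longlonglongrightarrow> rej m f v"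
    using frame_limit[of n m e, OF e(1)] by blast
  have tf: "tilt m (e i) f (32 * real m * geo \<alpha> * \<omega> i)" for i
    unfolding tilt_def
  proof
    fix v
    show "norm (rej m f (proj m (e i) v)) \<le> 32 * real m * geo \<alpha> * \<omega> i * norm v"
    proof (rule tendsto_upperbound[OF tendsto_norm[OF f(3)[of "proj m (e i) v"]]])
      show "\<forall>\<^sub>F j in sequentially. norm (rej m (e (\<sigma> j)) (proj m (e i) v)) \<le> 32 * real m * geo \<alpha> * \<omega> i * norm v"
        using eventually_ge_at_top[of i]
      proof eventually_elim
        case (elim j)
        then have "i \<le> \<sigma> j" using seq_suble[OF f(2), of j] by simp
        then show ?case using chain[of i "\<sigma> j"] unfolding tilt_def by blast
      qed
    qed simp
  qed
  have "norm (rej m f (b - a)) \<le> (4 + 64 * real m * geo \<alpha>) * K * dist a b powr \<alpha> * norm (b - a)"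
    if b: "b \<in> S \<inter> cball a R" for b
  proof (cases "a = b")
    case False
    then have t0: "0 < dist a b" by simp
    have "dist a b \<le> R" using b by simp
    then obtain j where j: "R / 2 ^ Suc j < dist a b" "dist a b \<le> R / 2 ^ j"
      using dyadic_scale[OF t0] by blast
    have Rt: "Rj j \<le> 2 * dist a b" using j(1) by (simp add: Rj_def)
    have nt: "norm (b - a) = dist a b" by (simp add: dist_norm norm_minus_commute)
    have "\<omega> j \<le> K * (2 * dist a b) powr \<alpha>"
      unfolding \<omega>_def using K Rj Rt \<alpha> by (intro mult_left_mono powr_mono2) (auto intro: less_imp_le)
    also have "\<dots> \<le> 2 * (K * dist a b powr \<alpha>)"
    proof -
      have "2 powr \<alpha> \<le> 2 powr (1::real)" using \<alpha> by (intro powr_mono) auto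
      then have "2 powr \<alpha> * (K * dist a b powr \<alpha>) \<le> 2 * (K * dist a b powr \<alpha>)"
        using K by (intro mult_right_mono) auto
      then show ?thesis by (simp add: powr_mult mult_ac)
    qed
    finally have \<omega>t: "\<omega> j \<le> 2 * (K * dist a b powr \<alpha>)" .
    have "norm (rej m (e j) (b - a)) \<le> \<omega> j * Rj j"
      by (rule e(2)) (use b j(2) in \<open>simp add: Rj_def\<close>)
    also have "\<dots> \<le> \<omega> j * (2 * dist a b)" using Rt \<omega>0 by (intro mult_left_mono)
    finally have "norm (rej m f (b - a)) \<le> \<omega> j * ((2 + 32 * real m * geo \<alpha>) * dist a b)"
      using rej_via_tilt[OF frame_orthonormal[OF f(1)] tf[of j], of "b - a"] by (simp add: nt algebra_simps)
    also have "\<dots> \<le> 2 * (K * dist a b powr \<alpha>) * ((2 + 32 * real m * geo \<alpha>) * dist a b)"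
      using geo_ge_1[OF \<alpha>(1)] \<omega>t by (intro mult_right_mono) (auto intro!: mult_nonneg_nonneg add_nonneg_nonneg)
    also have "\<dots> = (4 + 64 * real m * geo \<alpha>) * K * dist a b powr \<alpha> * norm (b - a)"
      by (simp add: nt algebra_simps)
    finally show ?thesis .
  qed (simp add: rej_simps)
  then show ?thesis using f(1) by blast
qed

definition lift :: "nat \<Rightarrow> (nat \<Rightarrow> 'a::real_inner) \<Rightarrow> (nat \<Rightarrow> 'a) \<Rightarrow> 'a \<Rightarrow> 'a" where
  "lift m e e' u = (THE v. proj m e' v = v \<and> proj m e v = proj m e u)"

lemma norm_le_proj_tilt:
  assumes "tilt m e' e (1 / 2)" "proj m e' v = v"
  shows "norm v \<le> 2 * norm (proj m e v)"
proof (rule norm_le_twice_proj[of m e v "1/2"])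
  show "norm (rej m e v) \<le> 1 / 2 * norm v" using assms unfolding tilt_def by metis
qed simp

lemma lift_exists1:
  assumes e: "orthonormal m e" "orthonormal m e'" and t: "tilt m e' e (1 / 2)"
  shows "\<exists>!v. proj m e' v = v \<and> proj m e v = proj m e u"
proof (rule ex_ex1I)
  have "fat m (\<lambda>i. proj m e (e' i)) (1 / 2)"
    unfolding fat_def
  proof (intro allI impI)
    fix a k assume k: "k < m"
    let ?w = "\<Sum>i<m. a i *\<^sub>R e' i"
    have "\<bar>a k\<bar> \<le> norm ?w" by (rule orthonormal_coeff_le[OF e(2) k])
    also have "\<dots> \<le> 2 * norm (proj m e ?w)" by (rule norm_le_proj_tilt[OF t proj_comb[OF e(2)]])
    also have "proj m e ?w = (\<Sum>i<m. a i *\<^sub>R proj m e (e' i))" by (simp add: proj_simps)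
    finally show "1 / 2 * \<bar>a k\<bar> \<le> norm (\<Sum>i<m. a i *\<^sub>R proj m e (e' i))" by simp
  qed
  then obtain a where "proj m e u = (\<Sum>i<m. a i *\<^sub>R proj m e (e' i))"
    using fat_spans[of m e "\<lambda>i. proj m e (e' i)" "1/2" "proj m e u"] e(1) by auto
  then have "proj m e (\<Sum>i<m. a i *\<^sub>R e' i) = proj m e u" by (simp add: proj_simps)
  then show "\<exists>v. proj m e' v = v \<and> proj m e v = proj m e u" using proj_comb[OF e(2)] by blast
  fix v v' assume "proj m e' v = v \<and> proj m e v = proj m e u" "proj m e' v' = v' \<and> proj m e v' = proj m e u"
  then have "proj m e' (v - v') = v - v'" "proj m e (v - v') = 0" by (simp_all add: proj_simps)
  then show "v = v'" using norm_le_proj_tilt[OF t, of "v - v'"] by simp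
qed

lemma lift_props:
  assumes "orthonormal m e" "orthonormal m e'" "tilt m e' e (1 / 2)"
  shows "proj m e' (lift m e e' u) = lift m e e' u" "proj m e (lift m e e' u) = proj m e u"
  using theI'[OF lift_exists1[OF assms, of u]] by (auto simp: lift_def)

lemma lift_unique:
  assumes "orthonormal m e" "orthonormal m e'" "tilt m e' e (1 / 2)" "proj m e' v = v" "proj m e v = proj m e u"
  shows "lift m e e' u = v"
  unfolding lift_def by (rule the1_equality[OF lift_exists1[OF assms(1-3)]]) (use assms in simp)

lemma norm_lift_le:
  assumes "orthonormal m e" "orthonormal m e'" "tilt m e' e (1 / 2)"
  shows "norm (lift m e e' u) \<le> 2 * norm u"
  using norm_le_proj_tilt[OF assms(3) lift_props(1)[OF assms, of u]] lift_props(2)[OF assms, of u]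
    norm_proj_le[OF assms(1), of u] by simp

lemma bounded_linear_lift:
  assumes "orthonormal m e" "orthonormal m e'" "tilt m e' e (1 / 2)"
  shows "bounded_linear (lift m e e')"
proof (rule bounded_linear_intro[of _ 2])
  fix u w and c :: real
  show "lift m e e' (u + w) = lift m e e' u + lift m e e' w"
    by (rule lift_unique[OF assms]) (simp_all add: proj_simps lift_props[OF assms])
  show "lift m e e' (c *\<^sub>R u) = c *\<^sub>R lift m e e' u"
    by (rule lift_unique[OF assms]) (simp_all add: proj_simps lift_props[OF assms])
  show "norm (lift m e e' u) \<le> norm u * 2" using norm_lift_le[OF assms, of u] by simp
qed

lemma lift_diff:
  assumes e: "orthonormal m e" "orthonormal m e1" "orthonormal m e2" and t: "tilt m e1 e (1 / 2)" "tilt m e2 e (1 / 2)"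
    and d: "tilt m e1 e2 d" "0 \<le> d"
  shows "norm (lift m e e1 u - lift m e e2 u) \<le> 6 * d * norm u"
proof -
  let ?v = "lift m e e1 u" and ?w = "lift m e e2 u"
  note v = lift_props[OF e(1,2) t(1), of u] and w = lift_props[OF e(1,3) t(2), of u]
  have "norm (rej m e2 ?v) \<le> d * norm ?v" using d(1) v(1) unfolding tilt_def by metis
  also have "\<dots> \<le> d * (2 * norm u)" by (intro mult_left_mono norm_lift_le e t d)
  finally have r: "norm (rej m e2 ?v) \<le> 2 * d * norm u" by simp
  have pe: "proj m e2 (proj m e2 ?v - ?w) = proj m e2 ?v - ?w" using w(1) e(3) by (simp add: proj_simps)
  have "norm (proj m e2 ?v - ?w) \<le> 2 * norm (proj m e (proj m e2 ?v - ?w))" by (rule norm_le_proj_tilt[OF t(2) pe])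
  also have "proj m e (proj m e2 ?v - ?w) = - proj m e (rej m e2 ?v)"
    using v(2) w(2) by (simp add: rej_def proj_simps)
  also have "2 * norm (- proj m e (rej m e2 ?v)) \<le> 2 * (2 * d * norm u)"
    using norm_proj_le[OF e(1), of "rej m e2 ?v"] r by simp
  finally have "norm (proj m e2 ?v - ?w) \<le> 4 * d * norm u" by simp
  moreover have "?v - ?w = rej m e2 ?v + (proj m e2 ?v - ?w)" by (simp add: rej_def)
  then have "norm (?v - ?w) \<le> norm (rej m e2 ?v) + norm (proj m e2 ?v - ?w)" by (simp only: norm_triangle_ineq)
  ultimately show ?thesis using r by simp
qed

text \<open>A \<open>C\<^sup>1\<close> bounded odd function that is the identity on \<open>[-1, 1]\<close>, used to extend the local
  graph to the whole tangent plane.\<close>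

definition pos2 :: "real \<Rightarrow> real" where "pos2 t = (max 0 t)\<^sup>2 / 2"

lemma pos2_deriv: "(pos2 has_real_derivative max 0 t) (at t)"
proof (cases "t = 0")
  case True
  have "(pos2 has_derivative (\<lambda>h. 0)) (at 0)"
  proof (rule has_derivativeI_sandwich[of 1])
    show "norm (pos2 y - pos2 0 - 0) / norm (y - 0) \<le> \<bar>y\<bar>" if "y \<noteq> 0" for y :: real
      using that by (simp add: pos2_def power2_eq_square max_def abs_mult)
    show "((\<lambda>y::real. \<bar>y\<bar>) \<longlongrightarrow> 0) (at 0)" by (auto intro!: tendsto_eq_intros)
  qed auto
  then show ?thesis by (simp add: True has_field_derivative_def lambda_zero)
next
  case False
  have "\<forall>\<^sub>F y in nhds t. pos2 y = (if 0 < t then y\<^sup>2 / 2 else 0)"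
  proof (cases "0 < t")
    case True
    then have "\<forall>\<^sub>F y in nhds t. y \<in> {0<..}" by (intro eventually_nhds_in_open) auto
    then show ?thesis by eventually_elim (use True in \<open>simp add: pos2_def\<close>)
  next
    case False
    then have "\<forall>\<^sub>F y in nhds t. y \<in> {..<0}" using \<open>t \<noteq> 0\<close> by (intro eventually_nhds_in_open) auto
    then show ?thesis by eventually_elim (use False in \<open>simp add: pos2_def\<close>)
  qed
  moreover have "((\<lambda>y. if 0 < t then y\<^sup>2 / 2 else 0) has_real_derivative max 0 t) (at t)"
    using False by (cases "0 < t") (auto intro!: derivative_eq_intros)
  ultimately show ?thesis by (subst DERIV_cong_ev[OF refl _ refl])
qed

definition cutoff :: "real \<Rightarrow> real" where
  "cutoff t = t - pos2 (t - 1) + pos2 (t - 2) + pos2 (- t - 1) - pos2 (- t - 2)"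

definition cutoff' :: "real \<Rightarrow> real" where
  "cutoff' t = 1 - max 0 (t - 1) + max 0 (t - 2) - max 0 (- t - 1) + max 0 (- t - 2)"

lemma cutoff_deriv: "(cutoff has_real_derivative cutoff' t) (at t)"
proof -
  have 1: "((\<lambda>t. pos2 (t - c)) has_real_derivative max 0 (t - c)) (at t)" for c
  proof -
    have "((\<lambda>t. pos2 (t - c)) has_real_derivative max 0 (t - c) * 1) (at t)"
      by (rule DERIV_chain2[OF pos2_deriv]) (auto intro!: derivative_eq_intros)
    then show ?thesis by simp
  qed
  have 2: "((\<lambda>t. pos2 (- t - c)) has_real_derivative - max 0 (- t - c)) (at t)" for c
  proof -
    have "((\<lambda>t. pos2 (- t - c)) has_real_derivative max 0 (- t - c) * (- 1)) (at t)"
      by (rule DERIV_chain2[OF pos2_deriv]) (auto intro!: derivative_eq_intros)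
    then show ?thesis by simp
  qed
  show ?thesis unfolding cutoff_def[abs_def] cutoff'_def
    by (rule derivative_eq_intros 1 2 refl)+ simp
qed

lemma cutoff_id:
  assumes "\<bar>t\<bar> \<le> 1"
  shows "cutoff t = t"
proof -
  have "max 0 (t - 1) = 0" "max 0 (t - 2) = 0" "max 0 (- t - 1) = 0" "max 0 (- t - 2) = 0"
    using assms by auto
  then show ?thesis by (simp add: cutoff_def pos2_def)
qed

lemma cutoff_bound: "\<bar>cutoff t\<bar> \<le> 3 / 2"
proof -
  consider "t \<le> -2" | "-2 \<le> t \<and> t \<le> -1" | "-1 \<le> t \<and> t \<le> 1" | "1 \<le> t \<and> t \<le> 2" | "2 \<le> t" by linarith
  then show ?thesis
  proof cases
    case 1
    then have "cutoff t = - 3 / 2"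
      by (simp add: cutoff_def pos2_def max_def power2_eq_square field_simps)
    then show ?thesis by simp
  next
    case 2
    then have c: "cutoff t = t + (- t - 1)\<^sup>2 / 2" by (simp add: cutoff_def pos2_def max_def)
    define u where "u = (t + 2)\<^sup>2"
    have "cutoff t = (u - 3) / 2" unfolding c u_def by (simp add: power2_eq_square field_simps)
    moreover have "(t + 2)\<^sup>2 \<le> 1\<^sup>2" using 2 by (intro power_mono) auto
    then have "u \<le> 1" by (simp add: u_def)
    moreover have "0 \<le> u" by (simp add: u_def)
    ultimately show ?thesis by simp
  next
    case 3
    then show ?thesis using cutoff_id[of t] by auto
  next
    case 4
    then have c: "cutoff t = t - (t - 1)\<^sup>2 / 2" by (simp add: cutoff_def pos2_def max_def)
    define u where "u = (2 - t)\<^sup>2"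
    have "cutoff t = (3 - u) / 2" unfolding c u_def by (simp add: power2_eq_square field_simps)
    moreover have "(2 - t)\<^sup>2 \<le> 1\<^sup>2" using 4 by (intro power_mono) auto
    then have "u \<le> 1" by (simp add: u_def)
    moreover have "0 \<le> u" by (simp add: u_def)
    ultimately show ?thesis by simp
  next
    case 5
    then have "cutoff t = 3 / 2"
      by (simp add: cutoff_def pos2_def max_def power2_eq_square field_simps)
    then show ?thesis by simp
  qed
qed

lemma cutoff'_bound: "\<bar>cutoff' t\<bar> \<le> 1"
  by (auto simp: cutoff'_def max_def abs_le_iff)

lemma cutoff'_lipschitz: "\<bar>cutoff' s - cutoff' t\<bar> \<le> 4 * \<bar>s - t\<bar>"
  by (auto simp: cutoff'_def max_def abs_le_iff abs_if)

lemma cutoff_lipschitz: "\<bar>cutoff s - cutoff t\<bar> \<le> \<bar>s - t\<bar>"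
proof -
  have "norm (cutoff s - cutoff t) \<le> 1 * norm (s - t)"
    by (rule field_differentiable_bound[of UNIV cutoff cutoff'])
       (use cutoff_deriv cutoff'_bound in auto)
  then show ?thesis by simp
qed

section \<open>The local graph function\<close>

locale c1_graph =
  fixes n m :: nat and S :: "real finseq set" and T :: "real finseq \<Rightarrow> nat \<Rightarrow> real finseq"
    and C \<alpha> R :: real and x :: "real finseq"
  assumes m: "1 \<le> m" and C: "0 \<le> C" and \<alpha>: "0 < \<alpha>" "\<alpha> \<le> 1" and R: "0 < R"
    and S: "S \<subseteq> R_space n" and x: "x \<in> S"
    and frame: "\<And>a. a \<in> S \<Longrightarrow> frame n m (T a)"
    and near: "\<And>a b. a \<in> S \<Longrightarrow> b \<in> S \<Longrightarrow> dist a b \<le> 2 * R \<Longrightarrow>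
      norm (rej m (T a) (b - a)) \<le> C * dist a b powr \<alpha> * norm (b - a)"
    and tilts: "\<And>a b. a \<in> S \<Longrightarrow> b \<in> S \<Longrightarrow> dist a b \<le> 2 * R \<Longrightarrow> tilt m (T a) (T b) (C * dist a b powr \<alpha>)"
    and small: "C * (2 * R) powr \<alpha> \<le> 1 / 4"
    and gr: "graphical n m S (1 / 2) x R (T x)"
begin

definition P where "P = {v. proj m (T x) v = v}"

lemma orthonormal: "a \<in> S \<Longrightarrow> orthonormal m (T a)"
  using frame by auto

lemma orthonormal_x: "orthonormal m (T x)"
  by (rule orthonormal[OF x])

lemma subspace_P: "subspace P"
  by (auto simp: P_def subspace_def proj_simps)

lemma proj_P: "v \<in> P \<Longrightarrow> proj m (T x) v = v"
  by (simp add: P_def)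

lemma proj_in_P: "proj m (T x) v \<in> P"
  using orthonormal_x by (simp add: P_def)

lemma scaled_tilt:
  assumes "a \<in> S" "dist x a \<le> R"
  shows "tilt m (T a) (T x) (1 / 2)"
proof (rule tilt_mono[OF tilts])
  have "dist a x powr \<alpha> \<le> (2 * R) powr \<alpha>" using assms R \<alpha> by (intro powr_mono2) (auto simp: dist_commute)
  then show "C * dist a x powr \<alpha> \<le> 1 / 2" using mult_left_mono[OF _ C] small by fastforce
qed (use assms x R in \<open>auto simp: dist_commute\<close>)

definition \<rho> where "\<rho> = R / 4"

lemma \<rho>: "0 < \<rho>"
  using R by (simp add: \<rho>_def)

definition g where "g v = (SOME a. a \<in> S \<inter> cball x R \<and> proj m (T x) (a - x) = v)"

lemma g:
  assumes "v \<in> P" "norm v \<le> \<rho>"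
  shows "g v \<in> S" "dist x (g v) \<le> R" "proj m (T x) (g v - x) = v"
proof -
  have "\<exists>a. a \<in> S \<inter> cball x R \<and> proj m (T x) (a - x) = v"
    using gr assms unfolding graphical_def P_def \<rho>_def by blast
  from someI_ex[OF this] show "g v \<in> S" "dist x (g v) \<le> R" "proj m (T x) (g v - x) = v"
    unfolding g_def by auto
qed

lemma expand:
  assumes "a \<in> S" "dist x a \<le> R" "b \<in> S" "dist x b \<le> R"
  shows "norm (b - a) \<le> 2 * norm (proj m (T x) (b - a))"
  by (rule norm_le_twice_proj[where \<epsilon> = "1/2"]) (use gr assms in \<open>auto simp: graphical_def\<close>)

lemma g_unique:
  assumes "a \<in> S" "dist x a \<le> R" "norm (proj m (T x) (a - x)) \<le> \<rho>"
  shows "g (proj m (T x) (a - x)) = a"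
proof -
  let ?v = "proj m (T x) (a - x)"
  note gv = g[OF proj_in_P assms(3)]
  have "proj m (T x) (g ?v - a) = proj m (T x) (g ?v - x) - proj m (T x) (a - x)"
    by (simp add: proj_simps)
  then have "proj m (T x) (g ?v - a) = 0" using gv(3) by simp
  then show ?thesis using expand[OF assms(1,2) gv(1,2)] by simp
qed

lemma g_0: "g 0 = x"
  using g_unique[of x] x R \<rho> by (simp add: proj_simps)

lemma g_lip:
  assumes "v \<in> P" "norm v \<le> \<rho>" "w \<in> P" "norm w \<le> \<rho>"
  shows "norm (g w - g v) \<le> 2 * norm (w - v)"
proof -
  note gv = g[OF assms(1,2)] and gw = g[OF assms(3,4)]
  have "proj m (T x) (g w - g v) = proj m (T x) (g w - x) - proj m (T x) (g v - x)" by (simp add: proj_simps)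
  then show ?thesis using expand[OF gv(1,2) gw(1,2)] gv(3) gw(3) by simp
qed

definition dg where "dg v = lift m (T x) (T (g v))"

lemma dg_lift:
  assumes "v \<in> P" "norm v \<le> \<rho>"
  shows "bounded_linear (dg v)" "norm (dg v u) \<le> 2 * norm u" "proj m (T x) (dg v u) = proj m (T x) u"
    "proj m (T (g v)) (dg v u) = dg v u"
  using bounded_linear_lift[OF orthonormal_x orthonormal scaled_tilt] norm_lift_le[OF orthonormal_x orthonormal scaled_tilt]
    lift_props[OF orthonormal_x orthonormal scaled_tilt] g[OF assms] by (auto simp: dg_def)

lemma g_taylor:
  assumes v: "v \<in> P" "norm v \<le> \<rho>" and w: "w \<in> P" "norm w \<le> \<rho>"
  shows "norm (g w - g v - dg v (w - v)) \<le> 12 * C * norm (w - v) powr \<alpha> * norm (w - v)"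
proof -
  define a where "a = g v"
  define b where "b = g w"
  note a = g[OF v, folded a_def] and b = g[OF w, folded b_def]
  have t: "tilt m (T a) (T x) (1 / 2)" by (rule scaled_tilt[OF a(1,2)])
  have ab: "norm (b - a) \<le> 2 * norm (w - v)" unfolding a_def b_def by (rule g_lip[OF v w])
  have dab: "dist a b \<le> 2 * R" using a(2) b(2) dist_triangle3[of a b x] by simp
  define q where "q = C * (2 * norm (w - v)) powr \<alpha> * (2 * norm (w - v))"
  have "norm (rej m (T a) (b - a)) \<le> C * dist a b powr \<alpha> * norm (b - a)" by (rule near[OF a(1) b(1) dab])
  also have "\<dots> \<le> q" unfolding q_def dist_norm using C ab \<alpha>
    by (intro mult_mono mult_left_mono powr_mono2) (auto simp: norm_minus_commute)
  finally have rq: "norm (rej m (T a) (b - a)) \<le> q" .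
  let ?u = "proj m (T a) (b - a)" and ?L = "dg v (w - v)"
  have pL: "proj m (T a) (?u - ?L) = ?u - ?L"
    using dg_lift(4)[OF v, of "w - v"] orthonormal[OF a(1)] by (simp add: proj_simps a_def[symmetric])
  have "proj m (T x) (b - a) = proj m (T x) (b - x) - proj m (T x) (a - x)" by (simp add: proj_simps)
  then have "proj m (T x) (b - a) = w - v" using a(3) b(3) by simp
  moreover have "proj m (T x) ?L = w - v"
    using dg_lift(3)[OF v, of "w - v"] proj_P[OF subspace_diff[OF subspace_P w(1) v(1)]] by simp
  moreover have "?u - ?L = (b - a) - rej m (T a) (b - a) - ?L" by (simp add: rej_def)
  ultimately have "proj m (T x) (?u - ?L) = - proj m (T x) (rej m (T a) (b - a))" by (simp add: proj_simps)
  then have "norm (?u - ?L) \<le> 2 * norm (proj m (T x) (rej m (T a) (b - a)))"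
    using norm_le_proj_tilt[OF t pL] by simp
  also have "\<dots> \<le> 2 * q" using norm_proj_le[OF orthonormal_x, of "rej m (T a) (b - a)"] rq by simp
  finally have uL: "norm (?u - ?L) \<le> 2 * q" .
  have "b - a - ?L = rej m (T a) (b - a) + (?u - ?L)" by (simp add: rej_def)
  then have "norm (b - a - ?L) \<le> norm (rej m (T a) (b - a)) + norm (?u - ?L)" by (simp only: norm_triangle_ineq)
  then have "norm (b - a - ?L) \<le> 3 * q" using rq uL by simp
  also have "3 * q \<le> 12 * C * norm (w - v) powr \<alpha> * norm (w - v)"
  proof -
    have "2 powr \<alpha> \<le> 2 powr (1::real)" using \<alpha> by (intro powr_mono) auto
    then have "2 powr \<alpha> * (C * norm (w - v) powr \<alpha> * norm (w - v)) \<le> 2 * (C * norm (w - v) powr \<alpha> * norm (w - v))"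
      using C by (intro mult_right_mono) auto
    then show ?thesis unfolding q_def by (simp add: powr_mult mult_ac)
  qed
  finally show ?thesis by (simp add: a_def b_def)
qed

lemma g_deriv:
  assumes v: "v \<in> P" "norm v \<le> \<rho>"
  shows "(g has_derivative dg v) (at v within {w \<in> P. norm w \<le> \<rho>})"
proof (rule has_derivativeI_sandwich[of 1])
  show "bounded_linear (dg v)" by (rule dg_lift(1)[OF v])
  show "norm (g w - g v - dg v (w - v)) / norm (w - v) \<le> 12 * C * norm (w - v) powr \<alpha>"
    if "w \<in> {w \<in> P. norm w \<le> \<rho>}" "w \<noteq> v" for w
    using g_taylor[OF v, of w] that by (simp add: field_simps)
  have "((\<lambda>w. 12 * C * norm (w - v) powr \<alpha>) \<longlongrightarrow> 12 * C * norm (v - v) powr \<alpha>) (at v within {w \<in> P. norm w \<le> \<rho>})"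
    using \<alpha> by (intro tendsto_intros tendsto_powr') auto
  then show "((\<lambda>w. 12 * C * norm (w - v) powr \<alpha>) \<longlongrightarrow> 0) (at v within {w \<in> P. norm w \<le> \<rho>})" using \<alpha> by simp
qed simp

lemma dg_holder:
  assumes v: "v \<in> P" "norm v \<le> \<rho>" and w: "w \<in> P" "norm w \<le> \<rho>"
  shows "norm (dg v u - dg w u) \<le> 6 * C * (2 * norm (v - w)) powr \<alpha> * norm u"
proof -
  note a = g[OF v] and b = g[OF w]
  have dab: "dist (g v) (g w) \<le> 2 * R" using a(2) b(2) dist_triangle3[of "g v" "g w" x] by simp
  have "norm (dg v u - dg w u) \<le> 6 * (C * dist (g v) (g w) powr \<alpha>) * norm u"
    unfolding dg_def
    by (rule lift_diff[OF orthonormal_x orthonormal[OF a(1)] orthonormal[OF b(1)] scaled_tilt[OF a(1,2)] scaled_tilt[OF b(1,2)] tilts[OF a(1) b(1) dab]])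
       (use C in simp)
  also have "\<dots> \<le> 6 * (C * (2 * norm (v - w)) powr \<alpha>) * norm u"
    using g_lip[OF w v] C \<alpha> by (intro mult_right_mono mult_left_mono powr_mono2) (auto simp: dist_norm)
  finally show ?thesis by simp
qed

lemma tangent_space_eq: "tangent_space S x = P"
proof (intro equalityI subsetI)
  fix v assume "v \<in> tangent_space S x"
  then obtain \<gamma> e where \<gamma>: "0 < e" "\<gamma> ` {-e<..<e} \<subseteq> S" "\<gamma> 0 = x" "(\<gamma> has_vector_derivative v) (at 0)"
    unfolding tangent_space_def by blast
  have lim: "((\<lambda>t. (1 / t) *\<^sub>R (\<gamma> t - x)) \<longlongrightarrow> v) (at 0)"
  proof -
    have "((\<lambda>t. (\<gamma> t - \<gamma> 0 - t *\<^sub>R v) /\<^sub>R \<bar>t\<bar>) \<longlongrightarrow> 0) (at 0)"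
      using \<gamma>(4) unfolding has_vector_derivative_def has_derivative_def by simp
    then have "((\<lambda>t. norm ((\<gamma> t - \<gamma> 0 - t *\<^sub>R v) /\<^sub>R \<bar>t\<bar>)) \<longlongrightarrow> 0) (at 0)"
      by (rule tendsto_norm_zero)
    then have "((\<lambda>t. norm ((\<gamma> t - x - t *\<^sub>R v) /\<^sub>R \<bar>t\<bar>)) \<longlongrightarrow> 0) (at 0)"
      by (simp only: \<gamma>(3))
    moreover have "norm ((\<gamma> t - x - t *\<^sub>R v) /\<^sub>R \<bar>t\<bar>) = norm ((1 / t) *\<^sub>R (\<gamma> t - x) - v)" if "t \<noteq> 0" for t
    proof -
      have "(1 / t) *\<^sub>R (\<gamma> t - x) - v = (1 / t) *\<^sub>R (\<gamma> t - x - t *\<^sub>R v)" using that by (simp add: scaleR_diff_right)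
      then show ?thesis by (simp add: divide_inverse)
    qed
    then have "\<forall>\<^sub>F t in at 0. norm ((\<gamma> t - x - t *\<^sub>R v) /\<^sub>R \<bar>t\<bar>) = norm ((1 / t) *\<^sub>R (\<gamma> t - x) - v)"
      by (auto simp: eventually_at_filter)
    ultimately have "((\<lambda>t. norm ((1 / t) *\<^sub>R (\<gamma> t - x) - v)) \<longlongrightarrow> 0) (at 0)"
      by (rule Lim_transform_eventually)
    then have "((\<lambda>t. (1 / t) *\<^sub>R (\<gamma> t - x) - v) \<longlongrightarrow> 0) (at 0)" by (rule tendsto_norm_zero_cancel)
    then show ?thesis by (simp add: LIM_zero_iff)
  qed
  have cont: "(\<gamma> \<longlongrightarrow> x) (at 0)"
    using has_vector_derivative_continuous[OF \<gamma>(4)] \<gamma>(3) by (simp add: continuous_within)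
  have "((\<lambda>t. rej m (T x) ((1 / t) *\<^sub>R (\<gamma> t - x))) \<longlongrightarrow> rej m (T x) v) (at 0)"
    unfolding rej_def proj_def by (intro tendsto_intros lim)
  moreover have "((\<lambda>t. rej m (T x) ((1 / t) *\<^sub>R (\<gamma> t - x))) \<longlongrightarrow> 0) (at 0)"
  proof (rule Lim_null_comparison)
    have "((\<lambda>t. C * dist x (\<gamma> t) powr \<alpha> * norm ((1 / t) *\<^sub>R (\<gamma> t - x))) \<longlongrightarrow> C * dist x x powr \<alpha> * norm v) (at 0)"
      using \<alpha> by (intro tendsto_intros tendsto_powr' cont lim) auto
    then show "((\<lambda>t. C * dist x (\<gamma> t) powr \<alpha> * norm ((1 / t) *\<^sub>R (\<gamma> t - x))) \<longlongrightarrow> 0) (at 0)" using \<alpha> by simp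
    have "\<forall>\<^sub>F t in at 0. dist (\<gamma> t) x < 2 * R" using cont R by (intro tendstoD) auto
    moreover have "\<forall>\<^sub>F t in at (0::real). t \<in> {-e<..<e}" using \<gamma>(1) by (intro eventually_at_in_open') auto
    ultimately show "\<forall>\<^sub>F t in at 0. norm (rej m (T x) ((1 / t) *\<^sub>R (\<gamma> t - x)))
        \<le> C * dist x (\<gamma> t) powr \<alpha> * norm ((1 / t) *\<^sub>R (\<gamma> t - x))"
    proof eventually_elim
      case (elim t)
      then have "\<gamma> t \<in> S" using \<gamma>(2) by blast
      then have "norm (rej m (T x) (\<gamma> t - x)) \<le> C * dist x (\<gamma> t) powr \<alpha> * norm (\<gamma> t - x)"
        using near[OF x, of "\<gamma> t"] elim by (simp add: dist_commute)
      then have "\<bar>1 / t\<bar> * norm (rej m (T x) (\<gamma> t - x)) \<le> \<bar>1 / t\<bar> * (C * dist x (\<gamma> t) powr \<alpha> * norm (\<gamma> t - x))"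
        by (intro mult_left_mono) auto
      then show ?case by (simp add: rej_simps mult_ac)
    qed
  qed
  ultimately have "rej m (T x) v = 0" using tendsto_unique[OF trivial_limit_at] by blast
  then show "v \<in> P" by (simp add: P_def rej_def)
next
  fix v assume v: "v \<in> P"
  define e where "e = \<rho> / (norm v + 1)"
  have e0: "0 < e" using \<rho> by (simp add: e_def add_nonneg_pos)
  have tv: "t *\<^sub>R v \<in> P" "norm (t *\<^sub>R v) \<le> \<rho>" if "t \<in> {-e<..<e}" for t
  proof -
    show "t *\<^sub>R v \<in> P" by (rule subspace_scale[OF subspace_P v])
    have "\<bar>t\<bar> * norm v \<le> e * (norm v + 1)" using that by (intro mult_mono) auto
    also have "\<dots> = \<rho>" using norm_ge_zero[of v] by (simp add: e_def add_nonneg_eq_0_iff)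
    finally show "norm (t *\<^sub>R v) \<le> \<rho>" by simp
  qed
  define D where "D t = dg (t *\<^sub>R v) v" for t
  have der: "((\<lambda>t. g (t *\<^sub>R v)) has_vector_derivative D t) (at t)" if t: "t \<in> {-e<..<e}" for t
  proof -
    have "((\<lambda>t. g (t *\<^sub>R v)) has_derivative (\<lambda>s. dg (t *\<^sub>R v) (s *\<^sub>R v))) (at t within {-e<..<e})"
    proof (rule has_derivative_in_compose2[where t = "{w \<in> P. norm w \<le> \<rho>}" and g = g and g' = dg
        and f = "\<lambda>t. t *\<^sub>R v" and f' = "\<lambda>s. s *\<^sub>R v"])
      show "(g has_derivative dg w) (at w within {w \<in> P. norm w \<le> \<rho>})" if "w \<in> {w \<in> P. norm w \<le> \<rho>}" for w
        using that by (intro g_deriv) auto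
      show "(\<lambda>t. t *\<^sub>R v) ` {-e<..<e} \<subseteq> {w \<in> P. norm w \<le> \<rho>}" using tv by auto
      show "((\<lambda>t. t *\<^sub>R v) has_derivative (\<lambda>s. s *\<^sub>R v)) (at t within {-e<..<e})"
        by (auto intro!: derivative_eq_intros)
    qed (rule t)
    moreover have "dg (t *\<^sub>R v) (s *\<^sub>R v) = s *\<^sub>R D t" for s
      using linear_cmul[OF bounded_linear.linear[OF dg_lift(1)[OF tv[OF t]]]] by (simp add: D_def)
    ultimately show ?thesis
      using t by (simp add: has_vector_derivative_def at_within_open[OF t open_greaterThanLessThan])
  qed
  have "continuous_on {-e<..<e} D"
    unfolding continuous_on_def
  proof
    fix t assume t: "t \<in> {-e<..<e}"
    have "((\<lambda>s. D s - D t) \<longlongrightarrow> 0) (at t within {-e<..<e})"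
    proof (rule Lim_null_comparison)
      show "\<forall>\<^sub>F s in at t within {-e<..<e}. norm (D s - D t) \<le> 6 * C * (2 * norm (s *\<^sub>R v - t *\<^sub>R v)) powr \<alpha> * norm v"
        unfolding eventually_at_filter D_def
        by (rule always_eventually) (use dg_holder tv t in blast)
      have "((\<lambda>s. 6 * C * (2 * norm (s *\<^sub>R v - t *\<^sub>R v)) powr \<alpha> * norm v)
          \<longlongrightarrow> 6 * C * (2 * norm (t *\<^sub>R v - t *\<^sub>R v)) powr \<alpha> * norm v) (at t within {-e<..<e})"
        using \<alpha> by (intro tendsto_intros tendsto_powr') auto
      then show "((\<lambda>s. 6 * C * (2 * norm (s *\<^sub>R v - t *\<^sub>R v)) powr \<alpha> * norm v) \<longlongrightarrow> 0) (at t within {-e<..<e})"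
        using \<alpha> by simp
    qed
    then show "(D \<longlongrightarrow> D t) (at t within {-e<..<e})" by (simp add: LIM_zero_iff)
  qed
  with der have "(\<lambda>t. g (t *\<^sub>R v)) C1_differentiable_on {-e<..<e}"
    unfolding C1_differentiable_on_def by blast
  moreover have "D 0 = v"
  proof -
    have "lift m (T x) (T x) v = v"
      using proj_P[OF v] by (intro lift_unique orthonormal_x) (auto simp: tilt_def orthonormal_x)
    then show ?thesis by (simp add: D_def dg_def g_0)
  qed
  ultimately show "v \<in> tangent_space S x"
    unfolding tangent_space_def using e0 g(1)[OF tv] der[of 0] g_0
    by (intro CollectI exI[of _ "\<lambda>t. g (t *\<^sub>R v)"] exI[of _ e]) auto
qed

definition c where "c = \<rho> / (2 * real m)"

lemma c: "0 < c"
  using \<rho> m by (simp add: c_def)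

definition \<Phi> where "\<Phi> v = (\<Sum>i<m. (c * cutoff ((v \<bullet> T x i) / c)) *\<^sub>R T x i)"

definition d\<Phi> where "d\<Phi> v u = (\<Sum>i<m. (cutoff' ((v \<bullet> T x i) / c) * (u \<bullet> T x i)) *\<^sub>R T x i)"

lemma frame_coeff_le: "i < m \<Longrightarrow> \<bar>u \<bullet> T x i\<bar> \<le> norm u"
  using Cauchy_Schwarz_ineq2[of u "T x i"] orthonormal_norm[OF orthonormal_x] by simp

lemma norm_frame_sum:
  assumes "\<And>i. i < m \<Longrightarrow> \<bar>a i\<bar> \<le> b"
  shows "norm (\<Sum>i<m. a i *\<^sub>R T x i) \<le> real m * b"
proof -
  have "norm (\<Sum>i<m. a i *\<^sub>R T x i) \<le> (\<Sum>i<m. b)"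
    by (rule sum_norm_le) (use assms orthonormal_norm[OF orthonormal_x] in simp)
  then show ?thesis by simp
qed

lemma \<Phi>_P: "\<Phi> v \<in> P" "norm (\<Phi> v) \<le> \<rho>"
proof -
  show "\<Phi> v \<in> P" using proj_comb[OF orthonormal_x] by (simp add: P_def \<Phi>_def)
  have "norm (\<Phi> v) \<le> real m * (c * 2)" unfolding \<Phi>_def
  proof (rule norm_frame_sum)
    fix i
    have "c * \<bar>cutoff ((v \<bullet> T x i) / c)\<bar> \<le> c * 2" using cutoff_bound[of "(v \<bullet> T x i) / c"] c by (intro mult_left_mono) auto
    then show "\<bar>c * cutoff ((v \<bullet> T x i) / c)\<bar> \<le> c * 2" using c by (simp add: abs_mult)
  qed
  then show "norm (\<Phi> v) \<le> \<rho>" using m by (simp add: c_def)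
qed

lemma \<Phi>_lip: "norm (\<Phi> v - \<Phi> w) \<le> real m * norm (v - w)"
proof -
  have "\<Phi> v - \<Phi> w = (\<Sum>i<m. (c * cutoff ((v \<bullet> T x i) / c) - c * cutoff ((w \<bullet> T x i) / c)) *\<^sub>R T x i)"
    by (simp add: \<Phi>_def sum_subtractf scaleR_diff_left)
  also have "norm \<dots> \<le> real m * norm (v - w)"
  proof (rule norm_frame_sum)
    fix i assume i: "i < m"
    have "c * \<bar>cutoff ((v \<bullet> T x i) / c) - cutoff ((w \<bullet> T x i) / c)\<bar> \<le> c * \<bar>(v \<bullet> T x i) / c - (w \<bullet> T x i) / c\<bar>"
      using c by (intro mult_left_mono cutoff_lipschitz) auto
    also have "\<dots> = \<bar>(v - w) \<bullet> T x i\<bar>" using c by (simp add: diff_divide_distrib[symmetric] inner_diff_left abs_divide)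
    also have "\<dots> \<le> norm (v - w)" by (rule frame_coeff_le[OF i])
    finally show "\<bar>c * cutoff ((v \<bullet> T x i) / c) - c * cutoff ((w \<bullet> T x i) / c)\<bar> \<le> norm (v - w)"
      using c by (simp add: right_diff_distrib[symmetric] abs_mult)
  qed
  finally show ?thesis .
qed

lemma \<Phi>_id:
  assumes "v \<in> P" "norm v \<le> c"
  shows "\<Phi> v = v"
proof -
  have "c * cutoff ((v \<bullet> T x i) / c) = v \<bullet> T x i" if "i < m" for i
  proof -
    have "\<bar>(v \<bullet> T x i) / c\<bar> \<le> 1" using frame_coeff_le[OF that, of v] assms(2) c by (simp add: abs_divide field_simps)
    then show ?thesis using cutoff_id c by simp
  qed
  then have "\<Phi> v = proj m (T x) v" by (simp add: \<Phi>_def proj_def)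
  then show ?thesis using proj_P[OF assms(1)] by simp
qed

lemma \<Phi>_deriv: "(\<Phi> has_derivative d\<Phi> v) (at v within A)"
proof -
  have 1: "((\<lambda>v. c * cutoff ((v \<bullet> T x i) / c)) has_derivative (\<lambda>u. cutoff' ((v \<bullet> T x i) / c) * (u \<bullet> T x i))) (at v within A)" for i
  proof -
    have "((\<lambda>v. (v \<bullet> T x i) / c) has_derivative (\<lambda>u. (u \<bullet> T x i) / c)) (at v within A)"
      using c by (auto intro!: derivative_eq_intros)
    from has_derivative_compose[OF this, of cutoff "(*) (cutoff' ((v \<bullet> T x i) / c))"]
    have "((\<lambda>v. cutoff ((v \<bullet> T x i) / c)) has_derivative (\<lambda>u. cutoff' ((v \<bullet> T x i) / c) * ((u \<bullet> T x i) / c))) (at v within A)"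
      using cutoff_deriv by (simp add: has_field_derivative_def)
    from has_derivative_mult_right[OF this, of c] show ?thesis using c by simp
  qed
  show ?thesis unfolding \<Phi>_def[abs_def] d\<Phi>_def[abs_def]
    by (intro has_derivative_sum has_derivative_scaleR_left 1)
qed

lemma d\<Phi>_norm: "norm (d\<Phi> v u) \<le> real m * norm u"
  unfolding d\<Phi>_def
proof (rule norm_frame_sum)
  fix i assume i: "i < m"
  have "\<bar>cutoff' ((v \<bullet> T x i) / c)\<bar> * \<bar>u \<bullet> T x i\<bar> \<le> 1 * norm u"
    by (intro mult_mono cutoff'_bound frame_coeff_le i) auto
  then show "\<bar>cutoff' ((v \<bullet> T x i) / c) * (u \<bullet> T x i)\<bar> \<le> norm u" by (simp add: abs_mult)
qed

lemma le_powr_of_le_1: "0 \<le> d \<Longrightarrow> d \<le> 1 \<Longrightarrow> d \<le> d powr \<alpha>"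
  using powr_mono'[of \<alpha> 1 d] \<alpha> by (cases "d = 0") auto

lemma one_le_powr: "1 \<le> d \<Longrightarrow> 1 \<le> d powr \<alpha>"
  using ge_one_powr_ge_zero[of d \<alpha>] \<alpha> by simp

lemma d\<Phi>_holder: "norm (d\<Phi> v u - d\<Phi> w u) \<le> real m * (4 / c + 2) * norm (v - w) powr \<alpha> * norm u"
proof -
  let ?d = "norm (v - w)"
  have "d\<Phi> v u - d\<Phi> w u = (\<Sum>i<m. ((cutoff' ((v \<bullet> T x i) / c) - cutoff' ((w \<bullet> T x i) / c)) * (u \<bullet> T x i)) *\<^sub>R T x i)"
    by (simp add: d\<Phi>_def sum_subtractf scaleR_diff_left left_diff_distrib)
  also have "norm \<dots> \<le> real m * ((4 / c + 2) * ?d powr \<alpha> * norm u)"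
  proof (rule norm_frame_sum)
    fix i assume i: "i < m"
    let ?s = "(v \<bullet> T x i) / c" and ?t = "(w \<bullet> T x i) / c"
    have "\<bar>cutoff' ?s - cutoff' ?t\<bar> \<le> (4 / c + 2) * ?d powr \<alpha>"
    proof (cases "?d \<le> 1")
      case True
      have "\<bar>cutoff' ?s - cutoff' ?t\<bar> \<le> 4 * \<bar>?s - ?t\<bar>" by (rule cutoff'_lipschitz)
      also have "\<bar>?s - ?t\<bar> = \<bar>(v - w) \<bullet> T x i\<bar> / c" using c by (simp add: diff_divide_distrib[symmetric] inner_diff_left abs_divide)
      also have "4 * (\<bar>(v - w) \<bullet> T x i\<bar> / c) \<le> 4 * (?d / c)"
        using frame_coeff_le[OF i, of "v - w"] c by (intro mult_left_mono divide_right_mono) auto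
      also have "\<dots> = 4 / c * ?d" by simp
      also have "\<dots> \<le> (4 / c + 2) * ?d powr \<alpha>" using c le_powr_of_le_1[OF _ True] by (intro mult_mono) auto
      finally show ?thesis .
    next
      case False
      have "\<bar>cutoff' ?s - cutoff' ?t\<bar> \<le> 2 * 1" using cutoff'_bound[of ?s] cutoff'_bound[of ?t] by linarith
      also have "\<dots> \<le> (4 / c + 2) * ?d powr \<alpha>" using c False by (intro mult_mono one_le_powr) auto
      finally show ?thesis .
    qed
    then have "\<bar>cutoff' ?s - cutoff' ?t\<bar> * \<bar>u \<bullet> T x i\<bar> \<le> (4 / c + 2) * ?d powr \<alpha> * norm u"
      using frame_coeff_le[OF i, of u] c by (intro mult_mono) auto
    then show "\<bar>(cutoff' ?s - cutoff' ?t) * (u \<bullet> T x i)\<bar> \<le> (4 / c + 2) * ?d powr \<alpha> * norm u" by (simp add: abs_mult)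
  qed
  finally show ?thesis by (simp add: mult.assoc)
qed

definition F where "F v = rej m (T x) (g (\<Phi> v) - x)"

definition dF where "dF v u = rej m (T x) (dg (\<Phi> v) (d\<Phi> v u))"

lemma F_in: "F v \<in> R_space n" "proj m (T x) (F v) = 0"
proof -
  have "g (\<Phi> v) - x \<in> R_space n"
    using g(1)[OF \<Phi>_P] S x by (intro subspace_diff[OF subspace_R_space]) auto
  then show "F v \<in> R_space n" unfolding F_def by (rule frame_rej_in[OF frame[OF x]])
  show "proj m (T x) (F v) = 0" by (simp add: F_def orthonormal_x)
qed

lemma proj_dF: "proj m (T x) (dF v u) = 0"
  by (simp add: dF_def orthonormal_x)

lemma bounded_linear_rej: "orthonormal m e \<Longrightarrow> bounded_linear (rej m e)"
  by (rule bounded_linear_intro[of _ 1]) (auto simp: rej_simps norm_rej_le)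

lemma F_deriv: "(F has_derivative dF v) (at v within A)"
proof -
  have "((\<lambda>v. g (\<Phi> v)) has_derivative (\<lambda>u. dg (\<Phi> v) (d\<Phi> v u))) (at v within A)"
    by (rule has_derivative_in_compose[OF \<Phi>_deriv])
       (rule has_derivative_subset[OF g_deriv[OF \<Phi>_P]], use \<Phi>_P in auto)
  then have "((\<lambda>v. g (\<Phi> v) - x) has_derivative (\<lambda>u. dg (\<Phi> v) (d\<Phi> v u))) (at v within A)"
    by (auto intro!: derivative_eq_intros)
  from bounded_linear.has_derivative[OF bounded_linear_rej[OF orthonormal_x] this]
  show ?thesis by (simp add: F_def[abs_def] dF_def[abs_def])
qed

definition Cg where "Cg = 12 * C * real m * real m + 2 * (real m * (4 / c + 2)) + 1"

lemma Cg: "0 < Cg"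
  using C c by (simp add: Cg_def add_nonneg_pos)

lemma dF_holder: "norm (dF v u - dF w u) \<le> Cg * dist v w powr \<alpha> * norm u"
proof -
  let ?d = "norm (v - w)"
  have "dF v u - dF w u = rej m (T x) (dg (\<Phi> v) (d\<Phi> v u) - dg (\<Phi> w) (d\<Phi> w u))"
    by (simp add: dF_def rej_simps)
  then have "norm (dF v u - dF w u) \<le> norm (dg (\<Phi> v) (d\<Phi> v u) - dg (\<Phi> w) (d\<Phi> w u))"
    using norm_rej_le[OF orthonormal_x] by metis
  also have "dg (\<Phi> v) (d\<Phi> v u) - dg (\<Phi> w) (d\<Phi> w u)
      = (dg (\<Phi> v) (d\<Phi> v u) - dg (\<Phi> w) (d\<Phi> v u)) + dg (\<Phi> w) (d\<Phi> v u - d\<Phi> w u)"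
    by (simp add: linear_diff[OF bounded_linear.linear[OF dg_lift(1)[OF \<Phi>_P]]])
  also have "norm \<dots> \<le> norm (dg (\<Phi> v) (d\<Phi> v u) - dg (\<Phi> w) (d\<Phi> v u)) + norm (dg (\<Phi> w) (d\<Phi> v u - d\<Phi> w u))"
    by (rule norm_triangle_ineq)
  also have "\<dots> \<le> (12 * C * real m * real m * ?d powr \<alpha> * norm u) + 2 * (real m * (4 / c + 2) * ?d powr \<alpha> * norm u)"
  proof (rule add_mono)
    have "(2 * norm (\<Phi> v - \<Phi> w)) powr \<alpha> \<le> (2 * real m * ?d) powr \<alpha>"
      using \<Phi>_lip[of v w] \<alpha> by (intro powr_mono2) auto
    also have "\<dots> = (2 * real m) powr \<alpha> * ?d powr \<alpha>" by (rule powr_mult)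
    also have "\<dots> \<le> 2 * real m * ?d powr \<alpha>"
    proof (rule mult_right_mono)
      have "(2 * real m) powr \<alpha> \<le> (2 * real m) powr 1" using m \<alpha> by (intro powr_mono) auto
      then show "(2 * real m) powr \<alpha> \<le> 2 * real m" using m by simp
    qed simp
    finally have le: "(2 * norm (\<Phi> v - \<Phi> w)) powr \<alpha> \<le> 2 * real m * ?d powr \<alpha>" .
    have "norm (dg (\<Phi> v) (d\<Phi> v u) - dg (\<Phi> w) (d\<Phi> v u)) \<le> 6 * C * (2 * norm (\<Phi> v - \<Phi> w)) powr \<alpha> * norm (d\<Phi> v u)"
      by (rule dg_holder[OF \<Phi>_P \<Phi>_P])
    also have "\<dots> \<le> 6 * C * (2 * real m * ?d powr \<alpha>) * (real m * norm u)"
      using C le d\<Phi>_norm by (intro mult_mono mult_left_mono) auto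
    finally show "norm (dg (\<Phi> v) (d\<Phi> v u) - dg (\<Phi> w) (d\<Phi> v u)) \<le> 12 * C * real m * real m * ?d powr \<alpha> * norm u"
      by (simp add: mult_ac)
    have "norm (dg (\<Phi> w) (d\<Phi> v u - d\<Phi> w u)) \<le> 2 * norm (d\<Phi> v u - d\<Phi> w u)" by (rule dg_lift(2)[OF \<Phi>_P])
    then show "norm (dg (\<Phi> w) (d\<Phi> v u - d\<Phi> w u)) \<le> 2 * (real m * (4 / c + 2) * ?d powr \<alpha> * norm u)"
      using d\<Phi>_holder[of v u w] by simp
  qed
  also have "\<dots> \<le> Cg * dist v w powr \<alpha> * norm u" by (simp add: Cg_def dist_norm algebra_simps)
  finally show ?thesis .
qed

lemma c_le: "c \<le> R"
proof -
  have "c \<le> \<rho> / 2" unfolding c_def using m \<rho> by (intro divide_left_mono) auto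
  then show ?thesis using R by (simp add: \<rho>_def)
qed

lemma c_le_\<rho>: "c \<le> \<rho>"
proof -
  have "c \<le> \<rho> / 2" unfolding c_def using m \<rho> by (intro divide_left_mono) auto
  then show ?thesis using \<rho> by simp
qed

lemma graph_F:
  assumes "v \<in> P" "norm v \<le> c"
  shows "x + (v + F v) = g v"
proof -
  have "proj m (T x) (g v - x) = v" using assms c_le_\<rho> by (intro g) auto
  then have "F v = g v - x - v" by (simp add: F_def \<Phi>_id[OF assms] rej_def)
  then show ?thesis by simp
qed

lemma norm_le_norm_graph: "v \<in> P \<Longrightarrow> norm v \<le> norm (v + F v)"
  using norm_proj_le[OF orthonormal_x, of "v + F v"] F_in(2)[of v] proj_P[of v] by (simp add: proj_simps)

lemma dist_add_self: "dist (z :: real finseq) (z + w) = norm w"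
  by (simp add: dist_norm)

lemma S_ball_eq: "S \<inter> ball x c = (+) x ` graph_over P F \<inter> ball x c"
proof (intro equalityI subsetI)
  fix a assume a: "a \<in> S \<inter> ball x c"
  let ?v = "proj m (T x) (a - x)"
  have "norm (a - x) < c" using a by (simp add: dist_norm norm_minus_commute)
  then have v: "norm ?v \<le> c" using norm_proj_le[OF orthonormal_x, of "a - x"] by simp
  have "g ?v = a" by (rule g_unique) (use a v c_le c_le_\<rho> in auto)
  then have "a = x + (?v + F ?v)" using graph_F[OF proj_in_P v] by simp
  then show "a \<in> (+) x ` graph_over P F \<inter> ball x c" using a proj_in_P by (auto simp: graph_over_def)
next
  fix a assume a: "a \<in> (+) x ` graph_over P F \<inter> ball x c"
  then obtain v where v: "v \<in> P" "a = x + (v + F v)" by (auto simp: graph_over_def)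
  have "norm (v + F v) < c" using a v(2) by (simp only: Int_iff mem_ball dist_add_self)
  then have "norm v \<le> c" using norm_le_norm_graph[OF v(1)] by simp
  then have "a = g v" "norm v \<le> \<rho>" using graph_F[OF v(1)] v(2) c_le_\<rho> by auto
  then show "a \<in> S \<inter> ball x c" using g(1)[OF v(1)] a by auto
qed

lemma opnorm_on_le:
  assumes "\<And>u. u \<in> A \<Longrightarrow> norm (L u) \<le> b * norm u" "0 \<le> b" "A \<noteq> {}"
  shows "opnorm_on A L \<le> b"
  unfolding opnorm_on_def
proof (rule cSUP_least[OF assms(3)])
  fix u assume "u \<in> A"
  then show "norm (L u) / norm u \<le> b"
    using assms(1)[of u] assms(2) by (cases "norm u = 0") (auto simp: divide_le_eq)
qed

lemma opnorm_dF: "opnorm_on P (\<lambda>u. dF y u - dF z u) \<le> Cg * dist y z powr \<alpha>"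
  by (rule opnorm_on_le) (use dF_holder Cg subspace_0[OF subspace_P] in auto)

lemma F_range: "F ` P \<subseteq> R_space n \<inter> P\<^sup>\<bottom>"
proof
  fix w assume "w \<in> F ` P"
  then obtain v where v: "w = F v" by blast
  have "u \<bullet> F v = 0" if "u \<in> P" for u
    using rej_orth[OF orthonormal_x, of "g (\<Phi> v) - x" u] proj_P[OF that] by (simp add: F_def inner_commute)
  then show "w \<in> R_space n \<inter> P\<^sup>\<bottom>" using F_in(1) by (simp add: v orthogonal_comp_def orthogonal_def)
qed

lemma C1_F: "C1_holder_on \<alpha> P P F dF"
  unfolding C1_holder_on_def
  by (intro conjI ballI F_deriv exI[of _ UNIV] exI[of _ Cg]) (auto intro: opnorm_dF)

definition J where "J w = (\<Sum>i<m. coord w i *\<^sub>R T x i)"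

lemma J_P: "J w \<in> P"
  using proj_comb[OF orthonormal_x] by (simp add: P_def J_def)

lemma J_norm: "norm (J w) \<le> real m * norm w"
  unfolding J_def by (rule norm_frame_sum) (rule abs_coord_le)

lemma bounded_linear_J: "bounded_linear J"
proof (rule bounded_linear_intro[of _ "real m"])
  show "J (v + w) = J v + J w" for v w by (simp add: J_def scaleR_add_left sum.distrib)
  show "J (a *\<^sub>R w) = a *\<^sub>R J w" for a w by (simp add: J_def scaleR_sum_right)
  show "norm (J w) \<le> norm w * real m" for w using J_norm[of w] by (simp add: mult.commute)
qed

lemma J_coord: "i < m \<Longrightarrow> J w \<bullet> T x i = coord w i"
  unfolding J_def by (rule orthonormal_sum_inner[OF orthonormal_x])

lemma J_inj: "J v = J w \<Longrightarrow> v \<in> R_space m \<Longrightarrow> w \<in> R_space m \<Longrightarrow> v = w"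
  by (rule finseq_eqI) (metis J_coord mem_R_space not_le)

lemma chart:
  "\<exists>U W \<psi> \<phi> \<psi>'. open U \<and> x \<in> U \<and> openin (top_of_set (R_space m)) W \<and> homeomorphism W (S \<inter> U) \<psi> \<phi> \<and>
     C1_holder_on \<alpha> (R_space m) W \<psi> \<psi>' \<and> (\<forall>y\<in>W. inj_on (\<psi>' y) (R_space m))"
proof -
  define W where "W = R_space m \<inter> (\<lambda>w. norm (J w + F (J w))) -` {..<c}"
  define \<psi> where "\<psi> w = x + (J w + F (J w))" for w
  define \<phi> where "\<phi> a = mk m (\<lambda>i. (a - x) \<bullet> T x i)" for a
  define \<psi>' where "\<psi>' w u = J u + dF (J w) (J u)" for w u
  have der: "((\<lambda>w. J w + F (J w)) has_derivative \<psi>' w) (at w within A)" for w A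
  proof -
    have J: "(J has_derivative J) (at w within A)" by (rule bounded_linear_imp_has_derivative[OF bounded_linear_J])
    have "((\<lambda>w. F (J w)) has_derivative (\<lambda>u. dF (J w) (J u))) (at w within A)"
      by (rule has_derivative_in_compose[OF J F_deriv])
    from has_derivative_add[OF J this] show ?thesis unfolding \<psi>'_def .
  qed
  have cont: "continuous_on A (\<lambda>w. J w + F (J w))" for A
    by (rule has_derivative_continuous_on) (rule der)
  have op: "openin (top_of_set (R_space m)) W"
    unfolding W_def by (intro continuous_openin_preimage_gen continuous_on_norm cont) simp
  have Wc: "w \<in> W \<longleftrightarrow> w \<in> R_space m \<and> norm (J w + F (J w)) < c" for w by (auto simp: W_def)
  have \<psi>S: "\<psi> w \<in> S \<inter> ball x c" if "w \<in> W" for w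
  proof -
    have "\<psi> w \<in> (+) x ` graph_over P F \<inter> ball x c"
      using that J_P[of w] unfolding Wc \<psi>_def graph_over_def Int_iff mem_ball dist_add_self by blast
    then show ?thesis by (simp only: S_ball_eq)
  qed
  have J\<phi>: "J (\<phi> a) = proj m (T x) (a - x)" for a by (simp add: J_def \<phi>_def proj_def)
  have \<psi>\<phi>: "\<psi> (\<phi> a) = a" if "a \<in> S \<inter> ball x c" for a
  proof -
    have "a \<in> (+) x ` graph_over P F \<inter> ball x c" using that by (simp only: S_ball_eq)
    then obtain v where v: "v \<in> P" "a = x + (v + F v)" by (auto simp: graph_over_def)
    then have "proj m (T x) (a - x) = v" using F_in(2)[of v] proj_P[OF v(1)] by (simp add: proj_simps)
    then show ?thesis by (simp add: \<psi>_def J\<phi> v(2))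
  qed
  have \<phi>R: "\<phi> a \<in> R_space m" for a by (simp add: \<phi>_def mem_R_space)
  have \<phi>W: "\<phi> a \<in> W" if "a \<in> S \<inter> ball x c" for a
  proof -
    have "J (\<phi> a) + F (J (\<phi> a)) = a - x" using \<psi>\<phi>[OF that] by (simp add: \<psi>_def algebra_simps)
    then show ?thesis using that \<phi>R by (simp add: Wc dist_norm norm_minus_commute)
  qed
  have \<phi>\<psi>: "\<phi> (\<psi> w) = w" if "w \<in> W" for w
  proof (rule J_inj)
    show "J (\<phi> (\<psi> w)) = J w" unfolding J\<phi>
      using F_in(2)[of "J w"] proj_P[OF J_P[of w]] by (simp add: \<psi>_def proj_simps)
  qed (use that \<phi>R Wc in auto)
  have hom: "homeomorphism W (S \<inter> ball x c) \<psi> \<phi>"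
  proof (rule homeomorphismI)
    show "continuous_on W \<psi>" unfolding \<psi>_def by (intro continuous_intros cont)
    have "\<phi> a = (\<Sum>i<m. single i ((a - x) \<bullet> T x i))" for a
    proof (rule finseq_eqI)
      fix j
      have "coord (\<Sum>i<k. single i ((a - x) \<bullet> T x i)) j = (if j < k then (a - x) \<bullet> T x j else 0)" for k
        by (induction k) (auto simp: less_Suc_eq)
      then show "coord (\<phi> a) j = coord (\<Sum>i<m. single i ((a - x) \<bullet> T x i)) j" by (simp add: \<phi>_def)
    qed
    then show "continuous_on (S \<inter> ball x c) \<phi>" by (simp add: continuous_intros)
  qed (use \<psi>S \<phi>W \<phi>\<psi> \<psi>\<phi> in auto)
  have C1: "C1_holder_on \<alpha> (R_space m) W \<psi> \<psi>'" unfolding C1_holder_on_def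
  proof (intro conjI ballI)
    fix w assume "w \<in> W"
    show "(\<psi> has_derivative \<psi>' w) (at w within W)"
      unfolding \<psi>_def[abs_def] using has_derivative_add[OF has_derivative_const[of x] der[of w W]] by simp
    let ?K = "Cg * real m * real m"
    have "opnorm_on (R_space m) (\<lambda>u. \<psi>' y u - \<psi>' z u) \<le> ?K * dist y z powr \<alpha>" for y z
    proof (rule opnorm_on_le)
      fix u
      have "norm (\<psi>' y u - \<psi>' z u) = norm (dF (J y) (J u) - dF (J z) (J u))" by (simp add: \<psi>'_def)
      also have "\<dots> \<le> Cg * dist (J y) (J z) powr \<alpha> * norm (J u)" by (rule dF_holder)
      also have "\<dots> \<le> Cg * (real m * dist y z powr \<alpha>) * (real m * norm u)"
      proof (intro mult_mono mult_left_mono J_norm)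
        have "J y - J z = J (y - z)" by (simp add: linear_diff[OF bounded_linear.linear[OF bounded_linear_J]])
        then have "dist (J y) (J z) \<le> real m * dist y z" using J_norm[of "y - z"] by (simp add: dist_norm)
        then have "dist (J y) (J z) powr \<alpha> \<le> (real m * dist y z) powr \<alpha>" using \<alpha> by (intro powr_mono2) auto
        also have "\<dots> = real m powr \<alpha> * dist y z powr \<alpha>" by (rule powr_mult)
        also have "\<dots> \<le> real m * dist y z powr \<alpha>"
        proof (rule mult_right_mono)
          have "real m powr \<alpha> \<le> real m powr 1" using m \<alpha> by (intro powr_mono) auto
          then show "real m powr \<alpha> \<le> real m" using m by simp
        qed simp
        finally show "dist (J y) (J z) powr \<alpha> \<le> real m * dist y z powr \<alpha>" .
      qed (use Cg in auto)
      finally show "norm (\<psi>' y u - \<psi>' z u) \<le> ?K * dist y z powr \<alpha> * norm u" by (simp add: mult_ac)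
    next
      show "R_space m \<noteq> {}" using subspace_0[OF subspace_R_space] by blast
    qed (use Cg in auto)
    then show "\<exists>U C. open U \<and> w \<in> U \<and> (\<forall>y\<in>W \<inter> U. \<forall>z\<in>W \<inter> U.
        opnorm_on (R_space m) (\<lambda>u. \<psi>' y u - \<psi>' z u) \<le> C * dist y z powr \<alpha>)"
      by (intro exI[of _ UNIV] exI[of _ ?K]) auto
  qed
  have inj: "inj_on (\<psi>' w) (R_space m)" for w
  proof (rule inj_onI)
    fix u v assume uv: "u \<in> R_space m" "v \<in> R_space m" "\<psi>' w u = \<psi>' w v"
    have "proj m (T x) (\<psi>' w u) = J u" for u
      using proj_P[OF J_P[of u]] by (simp add: \<psi>'_def proj_simps proj_dF)
    then have "J u = J v" using uv(3) by metis
    then show "u = v" using J_inj uv by blast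
  qed
  have xc: "x \<in> ball x c" using c by simp
  show ?thesis
    by (intro exI[of _ "ball x c"] exI[of _ W] exI[of _ \<psi>] exI[of _ \<phi>] exI[of _ \<psi>'] conjI ballI
        open_ball xc op hom C1 inj)
qed

end

section \<open>Curvature energies and Hoelder regularity\<close>

lemma c1_graph_exists:
  assumes m: "1 \<le> m" and \<alpha>: "0 < \<alpha>" "\<alpha> \<le> 1" and r: "0 < r" and K: "0 < K" and R1: "0 < R1" "R1 \<le> r / 2"
  obtains C R where "\<And>n S. S \<subseteq> R_space n \<Longrightarrow> compact S \<Longrightarrow>
    (\<And>x. x \<in> S \<Longrightarrow> \<exists>e. graphical n m S (eps m) x r e) \<Longrightarrow>
    (\<And>x s. x \<in> S \<Longrightarrow> 0 < s \<Longrightarrow> s \<le> R1 \<Longrightarrow> flat n m S x s (K * s powr \<alpha> * s)) \<Longrightarrow>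
    \<exists>T. \<forall>x\<in>S. c1_graph n m S T C \<alpha> R x"
    "0 < R" "0 \<le> C"
proof -
  have eps: "0 < eps m" "eps m \<le> 1 / 128" "real m * eps m = 1 / 128" using eps_bounds[OF m] by auto
  define C1 where "C1 = (4 + 64 * real m * geo \<alpha>) * K"
  have C10: "0 < C1" unfolding C1_def using geo_ge_1[OF \<alpha>(1)] m K by (intro mult_pos_pos add_pos_nonneg) auto
  define C where "C = 48 * real m * C1"
  have C0: "0 < C" using C10 m by (simp add: C_def)
  have C1C: "C1 \<le> C"
  proof -
    have "1 * C1 \<le> 48 * real m * C1" using m C10 by (intro mult_right_mono) auto
    then show ?thesis by (simp add: C_def)
  qed
  obtain s0 where s0: "0 < s0" "\<And>s. 0 < s \<Longrightarrow> s \<le> s0 \<Longrightarrow> 16 * real m * K * s powr \<alpha> \<le> 1"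
    using small_scale[OF \<alpha>(1), of 1 "16 * real m * K"] K by auto
  obtain s1 where s1: "0 < s1" "\<And>s. 0 < s \<Longrightarrow> s \<le> s1 \<Longrightarrow> C * s powr \<alpha> \<le> eps m / 2"
    using small_scale[OF \<alpha>(1), of "eps m / 2" C] C0 eps by auto
  define R2 where "R2 = min R1 s0"
  have R2: "0 < R2" "R2 \<le> R1" "R2 \<le> s0" using R1 s0 by (auto simp: R2_def)
  define R where "R = min (R2 / 4) (s1 / 2)"
  have R: "0 < R" "2 * R \<le> R2 / 2" "2 * R \<le> s1" using R2 s1 by (auto simp: R_def)
  have CR: "C * s powr \<alpha> \<le> eps m / 2" if "0 \<le> s" "s \<le> 2 * R" for s
    using s1(2)[of s] that R eps \<alpha> by (cases "s = 0") auto
  have "\<exists>T. \<forall>x\<in>S. c1_graph n m S T C \<alpha> R x"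
    if S: "S \<subseteq> R_space n" "compact S" and G: "\<And>x. x \<in> S \<Longrightarrow> \<exists>e. graphical n m S (eps m) x r e"
      and fl: "\<And>x s. x \<in> S \<Longrightarrow> 0 < s \<Longrightarrow> s \<le> R1 \<Longrightarrow> flat n m S x s (K * s powr \<alpha> * s)" for n S
  proof -
    have F: "full n m S (eps m) y s" if y: "y \<in> S" and s: "0 < s" "s \<le> R1" for y s
    proof -
      obtain e where "graphical n m S (eps m) y r e" using G y by blast
      then show ?thesis by (rule graphical_full) (use y s R1 eps in auto)
    qed
    have "\<exists>f. frame n m f \<and> (\<forall>b\<in>S \<inter> cball a R2. norm (rej m f (b - a))
      \<le> (4 + 64 * real m * geo \<alpha>) * K * dist a b powr \<alpha> * norm (b - a))" if a: "a \<in> S" for a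
    proof (rule tangent_frame[OF S(1) m \<alpha> _ R2(1)])
      show "16 * real m * (K * R2 powr \<alpha>) \<le> 1" using s0(2)[of R2] R2 by (simp add: mult_ac)
      show "real m * eps m \<le> 1 / 4" using eps by simp
    qed (use F fl a R2 K in auto)
    then obtain T where T: "\<And>a. a \<in> S \<Longrightarrow> frame n m (T a)"
      "\<And>a b. a \<in> S \<Longrightarrow> b \<in> S \<Longrightarrow> dist a b \<le> R2 \<Longrightarrow> norm (rej m (T a) (b - a)) \<le> C1 * dist a b powr \<alpha> * norm (b - a)"
      unfolding C1_def by (metis Int_iff mem_cball)
    have tilts: "tilt m (T a) (T b) (C * dist a b powr \<alpha>)"
      if ab: "a \<in> S" "b \<in> S" "dist a b \<le> 2 * R" for a b
    proof (cases "a = b")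
      case True
      then show ?thesis using tilt_refl[OF frame_orthonormal[OF T(1)[OF ab(1)]]] by simp
    next
      case False
      define s where "s = dist a b"
      have s: "0 < s" "s \<le> R2 / 2" "s \<le> 2 * R" using False ab R by (auto simp: s_def)
      have sR1: "s \<le> R1" using s R2 by linarith
      have "tilt m (T a) (T b) (8 * real m * (C1 * s powr \<alpha> * s + 5 * (C1 * s powr \<alpha> * s)) / s)"
      proof (rule tilt_of_near[OF F[OF ab(1) s(1) sR1] s(1) _ m])
        show "real m * eps m \<le> 1 / 4" using eps by simp
        show "orthonormal m (T a)" "orthonormal m (T b)" using T(1) ab by auto
        have "48 * real m * C1 * s powr \<alpha> \<le> 1 / 2" using CR[of s] s eps by (simp add: C_def)
        then have "(48 * real m * C1 * s powr \<alpha>) * s \<le> 1 / 2 * s" using s by (intro mult_right_mono) auto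
        then show "real m * (C1 * s powr \<alpha> * s) \<le> s / 8" using s by (simp add: mult_ac)
        fix z assume z: "z \<in> S \<inter> cball a s"
        have nz: "norm (z - a) \<le> s" using z by (simp add: dist_norm norm_minus_commute)
        have "norm (rej m (T a) (z - a)) \<le> C1 * dist a z powr \<alpha> * norm (z - a)" using T(2)[OF ab(1), of z] z s by auto
        also have "\<dots> \<le> C1 * s powr \<alpha> * s" using z nz C10 \<alpha> by (intro mult_mono mult_left_mono powr_mono2) auto
        finally show "norm (rej m (T a) (z - a)) \<le> C1 * s powr \<alpha> * s" .
        have zb: "dist b z \<le> 2 * s" using z dist_triangle[of b z a] by (auto simp: s_def dist_commute)
        have "norm (rej m (T b) (z - b)) \<le> C1 * dist b z powr \<alpha> * norm (z - b)" using T(2)[OF ab(2), of z] z zb s by auto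
        also have "\<dots> \<le> C1 * (2 * s) powr \<alpha> * (2 * s)"
          using zb C10 \<alpha> by (intro mult_mono mult_left_mono powr_mono2) (auto simp: dist_norm norm_minus_commute)
        also have "\<dots> = 2 powr \<alpha> * (2 * (C1 * s powr \<alpha> * s))" by (simp add: powr_mult mult_ac)
        also have "\<dots> \<le> 2 * (2 * (C1 * s powr \<alpha> * s))"
        proof (rule mult_right_mono)
          have "2 powr \<alpha> \<le> 2 powr (1::real)" using \<alpha> by (intro powr_mono) auto
          then show "2 powr \<alpha> \<le> 2" by simp
        qed (use C10 s in auto)
        finally have 1: "norm (rej m (T b) (z - b)) \<le> 4 * (C1 * s powr \<alpha> * s)" by simp
        have ab2: "dist b a \<le> R2" using s R2 by (simp add: s_def dist_commute)
        have "norm (rej m (T b) (a - b)) \<le> C1 * dist b a powr \<alpha> * norm (a - b)" using T(2)[OF ab(2,1)] ab2 by simp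
        then have 2: "norm (rej m (T b) (a - b)) \<le> C1 * s powr \<alpha> * s" by (simp add: s_def dist_commute dist_norm[symmetric])
        have "rej m (T b) (z - a) = rej m (T b) (z - b) - rej m (T b) (a - b)" by (simp add: rej_simps)
        then show "norm (rej m (T b) (z - a)) \<le> 5 * (C1 * s powr \<alpha> * s)"
          using 1 2 norm_triangle_ineq4[of "rej m (T b) (z - b)" "rej m (T b) (a - b)"] by simp
      qed
      moreover have "8 * real m * (C1 * s powr \<alpha> * s + 5 * (C1 * s powr \<alpha> * s)) / s = C * s powr \<alpha>"
        using s by (simp add: C_def field_simps)
      ultimately show ?thesis by (simp add: s_def)
    qed
    have near: "norm (rej m (T a) (b - a)) \<le> C * dist a b powr \<alpha> * norm (b - a)"
      if ab: "a \<in> S" "b \<in> S" "dist a b \<le> 2 * R" for a b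
    proof -
      have "norm (rej m (T a) (b - a)) \<le> C1 * dist a b powr \<alpha> * norm (b - a)" using T(2) ab R by simp
      also have "\<dots> \<le> C * dist a b powr \<alpha> * norm (b - a)" using C1C by (intro mult_right_mono) auto
      finally show ?thesis .
    qed
    have "c1_graph n m S T C \<alpha> R x" if x: "x \<in> S" for x
    proof
      have lip: "norm (rej m (T x) (b - a)) \<le> eps m * norm (b - a)"
        if ab: "a \<in> S \<inter> cball x R" "b \<in> S \<inter> cball x R" for a b
      proof -
        have d: "dist a b \<le> 2 * R" using ab dist_triangle3[of a b x] by simp
        have "norm (rej m (T a) (b - a)) \<le> C * dist a b powr \<alpha> * norm (b - a)" by (rule near) (use ab d in auto)
        also have "\<dots> \<le> eps m / 2 * norm (b - a)" by (intro mult_right_mono CR d) auto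
        finally have 1: "norm (rej m (T a) (b - a)) \<le> eps m / 2 * norm (b - a)" .
        have "tilt m (T a) (T x) (C * dist a x powr \<alpha>)" by (rule tilts) (use ab x R in \<open>auto simp: dist_commute\<close>)
        moreover have "C * dist a x powr \<alpha> \<le> eps m / 2"
          by (rule CR) (use ab R in \<open>auto simp: dist_commute\<close>)
        ultimately have "tilt m (T a) (T x) (eps m / 2)" by (rule tilt_mono)
        from rej_via_tilt[OF frame_orthonormal[OF T(1)[OF x]] this, of "b - a"] 1 show ?thesis by simp
      qed
      show "graphical n m S (1 / 2) x R (T x)" unfolding graphical_def
      proof (intro conjI ballI allI impI)
        fix a b assume "a \<in> S \<inter> cball x R" "b \<in> S \<inter> cball x R"
        then have "norm (rej m (T x) (b - a)) \<le> eps m * norm (b - a)" by (rule lip)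
        also have "\<dots> \<le> 1 / 2 * norm (b - a)" using eps by (intro mult_right_mono) auto
        finally show "norm (rej m (T x) (b - a)) \<le> 1 / 2 * norm (b - a)" .
      next
        fix v assume v: "proj m (T x) v = v" "norm v \<le> R / 4"
        show "\<exists>a\<in>S \<inter> cball x R. proj m (T x) (a - x) = v"
        proof (rule projection_onto_disc[OF S(2) x T(1)[OF x] m _ _ lip _ v R(1)])
          show "full n m S (eps m) y s" if "y \<in> S \<inter> cball x R" "0 < s" "s \<le> R / 4" for y s
            by (rule F) (use that R R2 in auto)
        qed (use eps in auto)
      qed (rule T(1)[OF x])
      show "C * (2 * R) powr \<alpha> \<le> 1 / 4" using CR[of "2 * R"] R eps by simp
    qed (use m C0 \<alpha> R S x T(1) near tilts in auto)
    then show ?thesis by blast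
  qed
  then show thesis using that[of C R] R(1) C0 by auto
qed

lemma (in c1_graph) holder_graph:
  "\<exists>F F'. F ` tangent_space S x \<subseteq> R_space n \<inter> (tangent_space S x)\<^sup>\<bottom> \<and>
     C1_holder_on \<alpha> (tangent_space S x) (tangent_space S x) F F' \<and>
     S \<inter> ball x (R / (8 * real m)) = (+) x ` graph_over (tangent_space S x) F \<inter> ball x (R / (8 * real m)) \<and>
     (\<forall>y\<in>tangent_space S x. \<forall>z\<in>tangent_space S x. opnorm_on (tangent_space S x) (\<lambda>v. F' y v - F' z v)
        \<le> (12 * C * real m * real m + 2 * (real m * (32 * real m / R + 2)) + 1) * dist y z powr \<alpha>)"
proof -
  have "c = R / (8 * real m)" by (simp add: c_def \<rho>_def)
  moreover from this have "Cg = 12 * C * real m * real m + 2 * (real m * (32 * real m / R + 2)) + 1"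
    by (simp add: Cg_def)
  ultimately show ?thesis unfolding tangent_space_eq using F_range C1_F S_ball_eq opnorm_dF
    by (intro exI[of _ F] exI[of _ dF] conjI ballI) simp_all
qed

theorem theorem3:
  fixes m l :: nat and p \<alpha> :: real and E :: ennreal
  assumes "1 \<le> m" and "l \<in> {1..m + 2}"
    and "p > real (m * l)" and "\<alpha> = 1 - real (m * l) / p"
    and "E < \<infinity>"
  shows "\<exists>Rg>0. \<exists>Cg>0. \<forall>n\<ge>m. \<forall>S.
     fine_set n m S \<and> energy m l p S \<le> E \<longrightarrow>
       closed_C1_holder_manifold n m \<alpha> S \<and>
       (\<forall>x\<in>S. \<exists>F F'.
          F ` tangent_space S x \<subseteq> R_space n \<inter> (tangent_space S x)\<^sup>\<bottom> \<and>
          C1_holder_on \<alpha> (tangent_space S x) (tangent_space S x) F F' \<and>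
          S \<inter> ball x Rg = (+) x ` graph_over (tangent_space S x) F \<inter> ball x Rg \<and>
          (\<forall>y\<in>tangent_space S x. \<forall>z\<in>tangent_space S x.
             opnorm_on (tangent_space S x) (\<lambda>v. F' y v - F' z v) \<le> Cg * dist y z powr \<alpha>))"
proof -
  have ml: "1 \<le> m" "1 \<le> l" "l \<le> m + 2" using assms(1,2) by auto
  have p0: "0 < p" using assms(3) by (meson le_less_trans of_nat_0_le_iff)
  have \<alpha>: "0 < \<alpha>" "\<alpha> \<le> 1" using assms(3,4) p0 by auto
  have second: "second_exponent m l p = \<alpha>" by (simp add: second_exponent_def assms(4))
  obtain E' where E': "0 \<le> E'" "E = ennreal E'" using assms(5) by (cases E) auto
  obtain r where r: "0 < r" "\<And>n S x. m \<le> n \<Longrightarrow> fine_set n m S \<Longrightarrow> energy m l p S \<le> ennreal E' \<Longrightarrow> x \<in> S \<Longrightarrow>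
    \<exists>e. graphical n m S (eps m) x r e"
    by (rule graphical_uniform[OF ml assms(3) E'(1)]) blast
  obtain K R1 where K: "0 < K" "0 < R1" "R1 \<le> r / 2"
    "\<And>n S s x. m \<le> n \<Longrightarrow> S \<subseteq> R_space n \<Longrightarrow> compact S \<Longrightarrow> energy m l p S \<le> ennreal E' \<Longrightarrow>
      (\<And>x. x \<in> S \<Longrightarrow> \<exists>e. graphical n m S (eps m) x r e) \<Longrightarrow> x \<in> S \<Longrightarrow> 0 < s \<Longrightarrow> s \<le> R1 \<Longrightarrow>
      flat n m S x s (K * s powr \<alpha> * s)"
    by (rule flat_optimal[OF ml assms(3) E'(1) r(1), unfolded second]) blast
  obtain C R where CR: "\<And>n S. S \<subseteq> R_space n \<Longrightarrow> compact S \<Longrightarrow>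
    (\<And>x. x \<in> S \<Longrightarrow> \<exists>e. graphical n m S (eps m) x r e) \<Longrightarrow>
    (\<And>x s. x \<in> S \<Longrightarrow> 0 < s \<Longrightarrow> s \<le> R1 \<Longrightarrow> flat n m S x s (K * s powr \<alpha> * s)) \<Longrightarrow>
    \<exists>T. \<forall>x\<in>S. c1_graph n m S T C \<alpha> R x" "0 < R" "0 \<le> C"
    by (rule c1_graph_exists[OF ml(1) \<alpha> r(1) K(1-3)]) blast
  show ?thesis
  proof (rule exI[of _ "R / (8 * real m)"],
      intro exI[of _ "12 * C * real m * real m + 2 * (real m * (32 * real m / R + 2)) + 1"] conjI allI impI ballI)
    show "0 < R / (8 * real m)" using CR(2) ml(1) by simp
    show "0 < 12 * C * real m * real m + 2 * (real m * (32 * real m / R + 2)) + 1"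
      using CR(2,3) by (intro add_nonneg_pos add_nonneg_nonneg mult_nonneg_nonneg divide_nonneg_pos) auto
    fix n S assume n: "m \<le> n" and S: "fine_set n m S \<and> energy m l p S \<le> E"
    have S': "S \<subseteq> R_space n" "compact S" "fine_set n m S" "energy m l p S \<le> ennreal E'"
      using S E' by (auto simp: fine_set_def)
    have g: "\<exists>e. graphical n m S (eps m) x r e" if "x \<in> S" for x by (rule r(2)[OF n S'(3,4) that])
    have "\<exists>T. \<forall>x\<in>S. c1_graph n m S T C \<alpha> R x"
      by (rule CR(1)[OF S'(1,2) g K(4)[OF n S'(1,2,4) g]])
    then obtain T where T: "\<And>x. x \<in> S \<Longrightarrow> c1_graph n m S T C \<alpha> R x" by blast
    show "closed_C1_holder_manifold n m \<alpha> S" unfolding closed_C1_holder_manifold_def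
      using S'(1,2) c1_graph.chart[OF T] by blast
    show "\<exists>F F'. F ` tangent_space S x \<subseteq> R_space n \<inter> (tangent_space S x)\<^sup>\<bottom> \<and>
        C1_holder_on \<alpha> (tangent_space S x) (tangent_space S x) F F' \<and>
        S \<inter> ball x (R / (8 * real m)) = (+) x ` graph_over (tangent_space S x) F \<inter> ball x (R / (8 * real m)) \<and>
        (\<forall>y\<in>tangent_space S x. \<forall>z\<in>tangent_space S x. opnorm_on (tangent_space S x) (\<lambda>v. F' y v - F' z v)
          \<le> (12 * C * real m * real m + 2 * (real m * (32 * real m / R + 2)) + 1) * dist y z powr \<alpha>)"
      if "x \<in> S" for x by (rule c1_graph.holder_graph[OF T[OF that]])
  qed
qed

end
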